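(* Let $F=\mathbb F_q(\mathcal X)$ be the function field of the Kummer curve $y^m=f(x)$ with $f$ separable of degree $n$, with the places $Q_0,Q_1,\dots,Q_n$ and $R_1,\dots,R_N$, as described in the context. Let $D=\sum_{k=1}^NR_k$ and let $$E_1=\sum_{k=1}^n\alpha_kQ_k\quad\text{and}\quad E_2=\sum_{k=0}^{n-1}\beta_kQ_k$$ (with $\alpha_k,\beta_k\in\mathbb Z$) be two non-special divisors of degree $g-1$. Suppose that $s$ is an integer satisfying (i) $\alpha_k-\beta_k\le s$ for $1\le k\le n-1$, (ii) $\alpha_n\le s\le(\beta_0+N)/n$, and (iii) $\frac{g-1+\beta_0-\alpha_n}{n-1}<s<\frac{N-g+1+\beta_0-\alpha_n}{n-1}$. Consider the divisors $$G=\sum_{k=1}^{n-1}\alpha_kQ_k+sQ_n+(\beta_0+N-sn)Q_0\quad\text{and}\quad H=\sum_{k=1}^{n-1}(s+\beta_k)Q_k+\alpha_nQ_n.$$ Then $(C_{\mathcal L}(D,G),C_{\mathcal L}(D,H))$ is a linear complementary pair of algebraic geometry codes with parameters (length and dimension) $$[N,\,N-s(n-1)-(\alpha_n-\beta_0)]\quad\text{and}\quad[N,\,s(n-1)+\alpha_n-\beta_0],$$ respectively.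
   Context: Let $\mathbb F_q$ be the finite field with $q$ elements, $m,n\ge2$ integers with $\operatorname{char}(\mathbb F_q)\nmid m$ and $\gcd(m,n)=1$, and $a_1,\dots,a_n\in\mathbb F_q$ pairwise distinct. Let $\mathcal X$ be the curve over $\mathbb F_q$ defined by $y^m=f(x)=\prod_{k=1}^n(x-a_k)$, with function field $F=\mathbb F_q(\mathcal X)=\mathbb F_q(x,y)$ of genus $g\ge1$. Let $Q_0$ be the only place at infinity of $F$ and let $Q_k$ be the (unique, totally ramified) place of $F$ over the place of $\mathbb F_q(x)$ corresponding to $a_k$, $1\le k\le n$. Let $P_1,\dots,P_t$ be pairwise distinct rational places of $\mathbb F_q(x)$ that split completely in $F/\mathbb F_q(x)$, and let $R_1,\dots,R_N$ be all the $N=mt$ rational places of $F$ lying over $P_1,\dots,P_t$. A divisor $A$ of $F$ is non-special if $\ell(A)=\deg(A)+1-g$, where $\ell(A)=\dim_{\mathbb F_q}\mathcal L(A)$. If $D$ is a sum of $M$ distinct rational places $S_1,\dots,S_M$ and $A$ is a divisor with support disjoint from that of $D$, then $C_{\mathcal L}(D,A)=\{(z(S_1),\dots,z(S_M)):z\in\mathcal L(A)\}\subseteq\mathbb F_q^M$. A pair $(\mathcal C_1,\mathcal C_2)$ of linear codes in $\mathbb F_q^M$ is a linear complementary pair (LCP) if $\mathcal C_1\oplus\mathcal C_2=\mathbb F_q^M$. An $[M,k]$ code is a linear code of length $M$ and dimension $k$. *)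

theory Defs
  imports
    "HOL-Analysis.Analysis"
    "HOL-Computational_Algebra.Computational_Algebra"
    "HOL-Library.FuncSet"
    "HOL-Library.Poly_Mapping"
begin

text \<open>
  All fields live inside one ambient field \<open>'a\<close>.  The constant field is a type \<open>'q\<close>, embedded
  by a homomorphism \<open>\<iota> :: 'q \<Rightarrow> 'a\<close>; a function field is a subset of \<open>'a\<close>.
\<close>

definition field_hom :: "('q::field \<Rightarrow> 'a::field) \<Rightarrow> bool" where
  "field_hom \<iota> \<longleftrightarrow> \<iota> 1 = 1 \<and> (\<forall>a b. \<iota> (a + b) = \<iota> a + \<iota> b) \<and> (\<forall>a b. \<iota> (a * b) = \<iota> a * \<iota> b)"

definition transcendental_over :: "('q::field \<Rightarrow> 'a::field) \<Rightarrow> 'a \<Rightarrow> bool" where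
  "transcendental_over \<iota> x \<longleftrightarrow> (\<forall>p. p \<noteq> 0 \<longrightarrow> poly (map_poly \<iota> p) x \<noteq> 0)"

definition is_subfield :: "'a::field set \<Rightarrow> bool" where
  "is_subfield E \<longleftrightarrow> 0 \<in> E \<and> 1 \<in> E \<and> (\<forall>a\<in>E. \<forall>b\<in>E. a + b \<in> E \<and> a * b \<in> E)
     \<and> (\<forall>a\<in>E. - a \<in> E \<and> inverse a \<in> E)"

definition adjoin :: "('q::field \<Rightarrow> 'a::field) \<Rightarrow> 'a set \<Rightarrow> 'a set" where
  "adjoin \<iota> S = is_subfield hull (range \<iota> \<union> S)"

text \<open>
  The dimension of the quotient \<open>V / W\<close> over a subfield \<open>S\<close> of the ambient field, for \<open>S\<close>-subspaces
  \<open>W \<subseteq> V\<close> with finite-dimensional quotient: \<open>B\<close> represents a basis of \<open>V / W\<close>.  (The scalars form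
  a set here, so that \<^const>\<open>vector_space.dim\<close> does not apply.)
\<close>

definition quotient_dim :: "'a::field set \<Rightarrow> 'a set \<Rightarrow> 'a set \<Rightarrow> nat" where
  "quotient_dim S V W = (THE d. \<exists>B. finite B \<and> card B = d \<and> B \<subseteq> V \<and>
     (\<forall>v\<in>V. \<exists>!c. c \<in> B \<rightarrow>\<^sub>E S \<and> v - (\<Sum>b\<in>B. c b * b) \<in> W))"

definition ext_degree :: "'a::field set \<Rightarrow> 'a set \<Rightarrow> nat" where
  "ext_degree F E = quotient_dim E F {0}"


section \<open>Places and valuations\<close>

definition valuation_ring :: "('q::field \<Rightarrow> 'a::field) \<Rightarrow> 'a set \<Rightarrow> 'a set \<Rightarrow> bool" where
  "valuation_ring \<iota> E R \<longleftrightarrow> range \<iota> \<subset> R \<and> R \<subset> E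
     \<and> (\<forall>a\<in>R. \<forall>b\<in>R. a + b \<in> R \<and> a * b \<in> R)
     \<and> (\<forall>z\<in>E. z \<noteq> 0 \<longrightarrow> z \<in> R \<or> inverse z \<in> R)"

text \<open>
  A place is the maximal ideal of a valuation ring; as valuation rings are local, it consists of
  the non-units.  The case \<open>z = 0\<close> is listed separately because \<open>inverse 0 = 0\<close>.
\<close>

definition places :: "('q::field \<Rightarrow> 'a::field) \<Rightarrow> 'a set \<Rightarrow> 'a set set" where
  "places \<iota> E = {P. \<exists>R. valuation_ring \<iota> E R \<and> P = {z \<in> R. z = 0 \<or> inverse z \<notin> R}}"

definition local_ring :: "'a::field set \<Rightarrow> 'a set \<Rightarrow> 'a set" where
  "local_ring E P = {z \<in> E. z = 0 \<or> inverse z \<notin> P}"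

text \<open>
  For \<open>z \<noteq> 0\<close>: write \<open>z = t\<^sup>k u\<close> with a generator \<open>t\<close> of \<open>P\<close> and a unit \<open>u\<close> of the local ring.
  The value at \<open>z = 0\<close> (conventionally infinite) is never used.
\<close>

definition val :: "'a::field set \<Rightarrow> 'a set \<Rightarrow> 'a \<Rightarrow> int" where
  "val E P z = (THE k. \<exists>t u. P = (\<lambda>w. t * w) ` local_ring E P \<and> u \<in> local_ring E P - P
     \<and> z = t powi k * u)"

definition place_degree :: "('q::field \<Rightarrow> 'a::field) \<Rightarrow> 'a set \<Rightarrow> 'a set \<Rightarrow> nat" where
  "place_degree \<iota> E P = quotient_dim (range \<iota>) (local_ring E P) P"

definition rational_places :: "('q::field \<Rightarrow> 'a::field) \<Rightarrow> 'a set \<Rightarrow> 'a set set" where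
  "rational_places \<iota> E = {P \<in> places \<iota> E. place_degree \<iota> E P = 1}"

definition places_over :: "('q::field \<Rightarrow> 'a::field) \<Rightarrow> 'a set \<Rightarrow> 'a set \<Rightarrow> 'a set set" where
  "places_over \<iota> F P = {Q \<in> places \<iota> F. P \<subseteq> Q}"

definition splits_completely ::
  "('q::field \<Rightarrow> 'a::field) \<Rightarrow> 'a set \<Rightarrow> 'a set \<Rightarrow> 'a set \<Rightarrow> bool" where
  "splits_completely \<iota> F E P \<longleftrightarrow>
     finite (places_over \<iota> F P) \<and> card (places_over \<iota> F P) = ext_degree F E"

definition place_at :: "('q::field \<Rightarrow> 'a::field) \<Rightarrow> 'a \<Rightarrow> 'q \<Rightarrow> 'a set" where
  "place_at \<iota> x a = {poly (map_poly \<iota> p) x / poly (map_poly \<iota> r) x | p r.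
     poly p a = 0 \<and> poly r a \<noteq> 0}"

definition place_at_infinity :: "('q::field \<Rightarrow> 'a::field) \<Rightarrow> 'a \<Rightarrow> 'a set" where
  "place_at_infinity \<iota> x = {poly (map_poly \<iota> p) x / poly (map_poly \<iota> r) x | p r.
     r \<noteq> 0 \<and> (p = 0 \<or> degree p < degree r)}"


section \<open>Divisors and Riemann--Roch spaces\<close>

text \<open>
  Divisors are elements of the free abelian group on the places, \<open>'a set \<Rightarrow>\<^sub>0 int\<close>.
\<close>

definition divisors :: "('q::field \<Rightarrow> 'a::field) \<Rightarrow> 'a set \<Rightarrow> ('a set \<Rightarrow>\<^sub>0 int) set" where
  "divisors \<iota> F = {A. Poly_Mapping.keys A \<subseteq> places \<iota> F}"

definition div_degree :: "('q::field \<Rightarrow> 'a::field) \<Rightarrow> 'a set \<Rightarrow> ('a set \<Rightarrow>\<^sub>0 int) \<Rightarrow> int" where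
  "div_degree \<iota> F A =
     (\<Sum>P\<in>Poly_Mapping.keys A. Poly_Mapping.lookup A P * int (place_degree \<iota> F P))"

definition RR_space ::
  "('q::field \<Rightarrow> 'a::field) \<Rightarrow> 'a set \<Rightarrow> ('a set \<Rightarrow>\<^sub>0 int) \<Rightarrow> 'a set" where
  "RR_space \<iota> F A =
     {z \<in> F. z = 0 \<or> (\<forall>P\<in>places \<iota> F. val F P z + Poly_Mapping.lookup A P \<ge> 0)}"

definition ell :: "('q::field \<Rightarrow> 'a::field) \<Rightarrow> 'a set \<Rightarrow> ('a set \<Rightarrow>\<^sub>0 int) \<Rightarrow> nat" where
  "ell \<iota> F A = vector_space.dim (\<lambda>c z. \<iota> c * z) (RR_space \<iota> F A)"

definition genus :: "('q::field \<Rightarrow> 'a::field) \<Rightarrow> 'a set \<Rightarrow> int" where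
  "genus \<iota> F = Sup {div_degree \<iota> F A - int (ell \<iota> F A) + 1 | A. A \<in> divisors \<iota> F}"

definition non_special ::
  "('q::field \<Rightarrow> 'a::field) \<Rightarrow> 'a set \<Rightarrow> ('a set \<Rightarrow>\<^sub>0 int) \<Rightarrow> bool" where
  "non_special \<iota> F A \<longleftrightarrow> int (ell \<iota> F A) = div_degree \<iota> F A + 1 - genus \<iota> F"


section \<open>Codes\<close>

text \<open>The residue class of \<open>z\<close> at a rational place \<open>P\<close>, as an element of the constant field.\<close>

definition eval_at :: "('q::field \<Rightarrow> 'a::field) \<Rightarrow> 'a set \<Rightarrow> 'a \<Rightarrow> 'q" where
  "eval_at \<iota> P z = (THE c. z - \<iota> c \<in> P)"

text \<open>
  The code of \<open>(D, A)\<close> for \<open>D = (\<Sum>i. S i)\<close>; the enumeration \<open>S\<close> of the support of \<open>D\<close> fixes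
  the order of the coordinates.
\<close>

definition AG_code ::
  "('q::field \<Rightarrow> 'a::field) \<Rightarrow> 'a set \<Rightarrow> ('l::finite \<Rightarrow> 'a set) \<Rightarrow> ('a set \<Rightarrow>\<^sub>0 int) \<Rightarrow> ('q ^ 'l) set"
  where "AG_code \<iota> F S A = {(\<chi> i. eval_at \<iota> (S i) z) | z. z \<in> RR_space \<iota> F A}"

definition LCP :: "('q::field ^ 'l) set \<Rightarrow> ('q ^ 'l) set \<Rightarrow> bool" where
  "LCP C1 C2 \<longleftrightarrow> vec.subspace C1 \<and> vec.subspace C2 \<and> C1 \<inter> C2 = {0} \<and>
     {u + v | u v. u \<in> C1 \<and> v \<in> C2} = UNIV"

end

theory Submission
  imports Defs
begin

text \<open>
  Let \<open>h = \<Prod>\<^sub>i (x - c\<^sub>i)\<close>, where \<open>x = c\<^sub>i\<close> is the place \<open>P\<^sub>i\<close> of \<open>K(x)\<close>.  Then \<open>div h = D - N Q\<^sub>0\<close> and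
  \<open>div y = Q\<^sub>1 + \<dots> + Q\<^sub>n - n Q\<^sub>0\<close>.  The inequalities \<open>\<alpha>\<^sub>k - \<beta>\<^sub>k \<le> s\<close> and
  \<open>\<alpha>\<^sub>n \<le> s \<le> (\<beta>\<^sub>0 + N)/n\<close> say that \<open>min(G, H) = E\<^sub>1\<close> and that
  \<open>max(G, H) - D = E\<^sub>2 + s div y - div h\<close>, which is linearly equivalent to \<open>E\<^sub>2\<close>.  Both \<open>E\<^sub>1\<close> and
  \<open>E\<^sub>2\<close> are non-special of degree \<open>g - 1\<close>, so \<open>L(E\<^sub>1) = L(E\<^sub>2) = 0\<close>.  Two functions with the same
  codeword, taken from \<open>L(G)\<close> or \<open>L(H)\<close>, differ by an element of \<open>L(max(G, H) - D) = 0\<close>.  Hence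
  the evaluation maps are injective, and a common codeword comes from \<open>L(min(G, H)) = 0\<close>.  This gives
  \<open>\<ell>(G) + \<ell>(H) \<le> N\<close>.  On the other hand \<open>deg G + deg H = N + 2g - 2\<close>, and Riemann's inequality bounds
  \<open>\<ell>(G)\<close> and \<open>\<ell>(H)\<close> from below by numbers that add up to \<open>N\<close>; so they are the dimensions, and the codes
  are complementary (\<open>LCP_of_AG_codes\<close>).

  The genus is defined as the supremum of \<open>deg A - \<ell>(A) + 1\<close>, so Riemann's inequality is the statement
  that this set of integers is bounded.  Its proof rests on one observation, \<open>indep_mod_multiples_card_le\<close>:
  if \<open>V\<close> is closed under multiplication by \<open>z\<close>, elements of \<open>V\<close> that are independent over \<open>K\<close> modulo
  \<open>zV\<close> are independent over \<open>K(z)\<close>, so that \<open>V/zV\<close> has dimension at most \<open>[F : K(z)]\<close>.  For the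
  valuation ring of a place this shows that the place is discrete and of finite degree; for a
  semilocal ring, together with weak approximation, it gives \<open>\<Sum> v\<^sub>P(z) deg P \<le> [F : K(z)]\<close>, the sum
  ranging over zeros of \<open>z\<close> (\<open>degree_of_zeros_le\<close>).  The space \<open>L(A)\<close> is finite-dimensional because a
  function without poles has no zeros, which needs the existence of places (\<open>place_containing_exists\<close>).
  Subtracting the divisor of a polynomial in \<open>x\<close> replaces \<open>A\<close> by a divisor below a multiple of \<open>m Q\<^sub>0\<close>
  (\<open>deg_minus_ell_bounded\<close>), and \<open>L(l m Q\<^sub>0)\<close> contains enough functions \<open>x\<^sup>i y\<^sup>j\<close>.

  The arithmetic of the Kummer extension comes from \<open>total_ramification\<close>.  At a place over \<open>a\<^sub>k\<close> or over
  infinity the valuations of the terms of \<open>\<Sum> u\<^sub>j y\<^sup>j\<close>, \<open>u\<^sub>j \<in> K(x)\<close>, are distinct modulo \<open>m\<close>, because \<open>m\<close> is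
  prime to \<open>1\<close> and to \<open>n\<close>.  So the valuation of the sum is the minimum; this makes the place unique and
  of degree 1, and gives \<open>[F : K(x)] = m\<close>.  Over a completely split place the \<open>m\<close> places exhaust the
  degree of the zeros of \<open>x - c\<^sub>i\<close>, so each of them is a simple zero (\<open>split_place\<close>).
\<close>

section \<open>Linear algebra modulo a subspace\<close>

lemma is_subfieldD:
  assumes "is_subfield S"
  shows "0 \<in> S" "1 \<in> S" "a \<in> S \<Longrightarrow> b \<in> S \<Longrightarrow> a + b \<in> S" "a \<in> S \<Longrightarrow> b \<in> S \<Longrightarrow> a * b \<in> S"
    "a \<in> S \<Longrightarrow> - a \<in> S" "a \<in> S \<Longrightarrow> inverse a \<in> S" "a \<in> S \<Longrightarrow> b \<in> S \<Longrightarrow> a - b \<in> S"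
    "a \<in> S \<Longrightarrow> b \<in> S \<Longrightarrow> a / b \<in> S" "a \<in> S \<Longrightarrow> a ^ k \<in> S" "a \<in> S \<Longrightarrow> a powi i \<in> S"
proof -
  show *: "0 \<in> S" "1 \<in> S" "\<And>a b. a \<in> S \<Longrightarrow> b \<in> S \<Longrightarrow> a + b \<in> S"
     "\<And>a b. a \<in> S \<Longrightarrow> b \<in> S \<Longrightarrow> a * b \<in> S"
    "\<And>a. a \<in> S \<Longrightarrow> - a \<in> S" "\<And>a. a \<in> S \<Longrightarrow> inverse a \<in> S"
    using assms unfolding is_subfield_def by blast+
  show "a \<in> S \<Longrightarrow> b \<in> S \<Longrightarrow> a - b \<in> S" using *(3)[of a "- b"] *(5)[of b] by simp
  show "a \<in> S \<Longrightarrow> b \<in> S \<Longrightarrow> a / b \<in> S" using *(4)[of a "inverse b"] *(6)[of b] by (simp add: field_simps)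
  show pow: "a \<in> S \<Longrightarrow> a ^ k \<in> S" for a k by (induction k) (use * in auto)
  show "a \<in> S \<Longrightarrow> a powi i \<in> S"
    by (simp add: power_int_def pow *)
qed

lemma is_subfield_sum:
  assumes "is_subfield S" "\<And>i. i \<in> I \<Longrightarrow> f i \<in> S"
  shows "sum f I \<in> S"
  using assms(2) by (induction I rule: infinite_finite_induct) (use is_subfieldD[OF assms(1)] in auto)

lemma is_subfield_prod:
  assumes "is_subfield S" "\<And>i. i \<in> I \<Longrightarrow> f i \<in> S"
  shows "prod f I \<in> S"
  using assms(2) by (induction I rule: infinite_finite_induct) (use is_subfieldD[OF assms(1)] in auto)

text \<open>
  Gaussian elimination, one equation at a time: solve an equation for an unknown that occurs in it
  and substitute into the others.
\<close>

lemma homogeneous_system_nontrivial: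
  fixes A :: "'i \<Rightarrow> 'j \<Rightarrow> 'a::field"
  assumes S: "is_subfield S" and "finite I" "finite J" "card I < card J"
    and "\<And>i j. i \<in> I \<Longrightarrow> j \<in> J \<Longrightarrow> A i j \<in> S"
  shows "\<exists>c. (\<forall>j\<in>J. c j \<in> S) \<and> (\<exists>j\<in>J. c j \<noteq> 0) \<and> (\<forall>i\<in>I. (\<Sum>j\<in>J. A i j * c j) = 0)"
  using assms(2-)
proof (induction I arbitrary: J A rule: finite_induct)
  case empty
  then have "J \<noteq> {}" by auto
  then show ?case using is_subfieldD(2)[OF S] by (intro exI[of _ "\<lambda>_. 1"]) auto
next
  case (insert i0 I)
  show ?case
  proof (cases "\<forall>j\<in>J. A i0 j = 0")
    case True
    have "\<exists>c. (\<forall>j\<in>J. c j \<in> S) \<and> (\<exists>j\<in>J. c j \<noteq> 0) \<and> (\<forall>i\<in>I. (\<Sum>j\<in>J. A i j * c j) = 0)"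
      by (rule insert.IH) (use insert in auto)
    then show ?thesis using True by (auto simp: sum.neutral)
  next
    case False
    then obtain j0 where j0: "j0 \<in> J" "A i0 j0 \<noteq> 0" by auto
    define J' where "J' = J - {j0}"
    define A' where "A' = (\<lambda>i j. A i j - A i j0 * A i0 j / A i0 j0)"
    have J: "J = insert j0 J'" "j0 \<notin> J'" "finite J'" using j0 insert.prems by (auto simp: J'_def)
    have cJ: "card I < card J'"
      using insert.prems insert.hyps J by simp
    have AS: "A i j \<in> S" if "i \<in> insert i0 I" "j \<in> J" for i j using insert.prems(3) that by auto
    have A'S: "A' i j \<in> S" if "i \<in> I" "j \<in> J'" for i j
      unfolding A'_def using that J j0 by (intro is_subfieldD[OF S] AS) auto
    obtain c where c: "\<forall>j\<in>J'. c j \<in> S" "\<exists>j\<in>J'. c j \<noteq> 0" "\<forall>i\<in>I. (\<Sum>j\<in>J'. A' i j * c j) = 0"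
      using insert.IH[OF J(3) cJ, of A'] A'S by blast
    define s where "s = (\<Sum>j\<in>J'. A i0 j * c j)"
    define c' where "c' = c(j0 := - s / A i0 j0)"
    have c'_eq: "(\<Sum>j\<in>J'. f j * c' j) = (\<Sum>j\<in>J'. f j * c j)" for f
      by (rule sum.cong) (use J in \<open>auto simp: c'_def\<close>)
    have eq: "(\<Sum>j\<in>J. A i j * c' j) = (\<Sum>j\<in>J'. A i j * c j) - A i j0 * s / A i0 j0" for i
      using J by (simp add: c'_eq) (simp add: c'_def)
    have "s \<in> S" unfolding s_def using c AS J by (intro is_subfield_sum[OF S] is_subfieldD(4)[OF S]) auto
    then have "\<forall>j\<in>J. c' j \<in> S"
      using c J j0 by (auto simp: c'_def intro!: is_subfieldD[OF S] AS)
    moreover have "\<exists>j\<in>J. c' j \<noteq> 0" using c(2) J by (auto simp: c'_def)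
    moreover have "(\<Sum>j\<in>J. A i j * c' j) = 0" if "i \<in> insert i0 I" for i
    proof (cases "i = i0")
      case True
      then show ?thesis using j0 unfolding eq by (simp add: s_def)
    next
      case False
      then have "(\<Sum>j\<in>J'. A' i j * c j) = 0" using that c by auto
      moreover have "(\<Sum>j\<in>J'. A' i j * c j) = (\<Sum>j\<in>J'. A i j * c j) - A i j0 * s / A i0 j0"
        by (simp add: A'_def s_def algebra_simps sum_subtractf sum_distrib_left
            sum_divide_distrib)
      ultimately show ?thesis unfolding eq by simp
    qed
    ultimately show ?thesis by blast
  qed
qed

definition subspace_over :: "'a::field set \<Rightarrow> 'a set \<Rightarrow> bool" where
  "subspace_over S W \<longleftrightarrow> 0 \<in> W \<and> (\<forall>v\<in>W. \<forall>w\<in>W. v + w \<in> W) \<and> (\<forall>c\<in>S. \<forall>w\<in>W. c * w \<in> W)"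

definition indep_mod :: "'a::field set \<Rightarrow> 'a set \<Rightarrow> 'a set \<Rightarrow> bool" where
  "indep_mod S W B \<longleftrightarrow> finite B \<and>
     (\<forall>c. (\<forall>b\<in>B. c b \<in> S) \<longrightarrow> (\<Sum>b\<in>B. c b * b) \<in> W \<longrightarrow> (\<forall>b\<in>B. c b = 0))"

definition spans_mod :: "'a::field set \<Rightarrow> 'a set \<Rightarrow> 'a set \<Rightarrow> 'a set \<Rightarrow> bool" where
  "spans_mod S W B V \<longleftrightarrow> (\<forall>v\<in>V. \<exists>c. (\<forall>b\<in>B. c b \<in> S) \<and> v - (\<Sum>b\<in>B. c b * b) \<in> W)"

text \<open>
  A relation instead of the function \<^const>\<open>quotient_dim\<close>, whose value is unspecified as long as it is
  not known that the quotient has a finite basis.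
\<close>

definition has_qdim :: "'a::field set \<Rightarrow> 'a set \<Rightarrow> 'a set \<Rightarrow> nat \<Rightarrow> bool" where
  "has_qdim S V W d \<longleftrightarrow> (\<exists>B\<subseteq>V. indep_mod S W B \<and> spans_mod S W B V \<and> card B = d)"

lemma subspace_overD:
  assumes "subspace_over S W"
  shows "0 \<in> W" "v \<in> W \<Longrightarrow> w \<in> W \<Longrightarrow> v + w \<in> W" "c \<in> S \<Longrightarrow> w \<in> W \<Longrightarrow> c * w \<in> W"
  using assms unfolding subspace_over_def by blast+

lemma subspace_over_minus:
  assumes "is_subfield S" "subspace_over S W"
  shows "w \<in> W \<Longrightarrow> - w \<in> W" "v \<in> W \<Longrightarrow> w \<in> W \<Longrightarrow> v - w \<in> W"
proof -
  have "-1 \<in> S" using is_subfieldD[OF assms(1)] by blast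
  then show *: "- w \<in> W" if "w \<in> W" for w using subspace_overD(3)[OF assms(2), of "-1" w] that by simp
  show "v \<in> W \<Longrightarrow> w \<in> W \<Longrightarrow> v - w \<in> W" using subspace_overD(2)[OF assms(2), of v "- w"] * by simp
qed

lemma subspace_over_sum:
  assumes "subspace_over S W" "\<And>i. i \<in> I \<Longrightarrow> f i \<in> W"
  shows "sum f I \<in> W"
  using assms(2) by (induction I rule: infinite_finite_induct) (use subspace_overD[OF assms(1)] in auto)

lemma subspace_over_lincomb:
  assumes "subspace_over S W" "B \<subseteq> W" "\<And>b. b \<in> B \<Longrightarrow> c b \<in> S"
  shows "(\<Sum>b\<in>B. c b * b) \<in> W"
  using assms by (intro subspace_over_sum[OF assms(1)] subspace_overD(3)[OF assms(1)]) auto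

lemma indep_modD:
  assumes "indep_mod S W B" "\<And>b. b \<in> B \<Longrightarrow> c b \<in> S" "(\<Sum>b\<in>B. c b * b) \<in> W" "b \<in> B"
  shows "c b = 0"
  using assms unfolding indep_mod_def by blast

text \<open>
  Steinitz' bound.  Write each element of \<open>B\<close> in terms of the smaller set \<open>C\<close>; the coefficient
  matrix has a nontrivial kernel, and this is a relation on \<open>B\<close> modulo \<open>W\<close>.
\<close>

lemma indep_mod_card_le_spanning:
  assumes S: "is_subfield S" and W: "subspace_over S W"
    and B: "B \<subseteq> V" "indep_mod S W B" and C: "finite C" "spans_mod S W C V"
  shows "card B \<le> card C"
proof (rule ccontr)
  assume "\<not> card B \<le> card C"
  then have less: "card C < card B" by simp
  have fB: "finite B" using B by (simp add: indep_mod_def)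
  have "\<forall>b\<in>B. \<exists>a. (\<forall>c\<in>C. a c \<in> S) \<and> b - (\<Sum>c\<in>C. a c * c) \<in> W"
    using B C unfolding spans_mod_def by blast
  then obtain a where a: "\<And>b c. b \<in> B \<Longrightarrow> c \<in> C \<Longrightarrow> a b c \<in> S"
    "\<And>b. b \<in> B \<Longrightarrow> b - (\<Sum>c\<in>C. a b c * c) \<in> W" by metis
  obtain x where x: "\<forall>b\<in>B. x b \<in> S" "\<exists>b\<in>B. x b \<noteq> 0" "\<forall>c\<in>C. (\<Sum>b\<in>B. a b c * x b) = 0"
    using homogeneous_system_nontrivial[OF S C(1) fB less, of "\<lambda>c b. a b c"] a by auto
  have "(\<Sum>b\<in>B. x b * (b - (\<Sum>c\<in>C. a b c * c)))
      = (\<Sum>b\<in>B. x b * b) - (\<Sum>b\<in>B. \<Sum>c\<in>C. x b * (a b c * c))"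
    by (simp add: right_diff_distrib sum_subtractf sum_distrib_left)
  also have "(\<Sum>b\<in>B. \<Sum>c\<in>C. x b * (a b c * c)) = (\<Sum>c\<in>C. (\<Sum>b\<in>B. a b c * x b) * c)"
    by (subst sum.swap) (simp add: sum_distrib_left sum_distrib_right mult_ac)
  also have "\<dots> = 0" using x(3) by simp
  finally have "(\<Sum>b\<in>B. x b * b) = (\<Sum>b\<in>B. x b * (b - (\<Sum>c\<in>C. a b c * c)))" by simp
  also have "\<dots> \<in> W"
    using x(1) a(2) by (intro subspace_over_sum[OF W] subspace_overD(3)[OF W]) auto
  finally have "\<forall>b\<in>B. x b = 0" using indep_modD[OF B(2), of x] x(1) by blast
  then show False using x(2) by blast
qed

lemma has_qdim_unique:
  assumes "is_subfield S" "subspace_over S W" "has_qdim S V W d" "has_qdim S V W d'"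
  shows "d = d'"
proof -
  obtain B B' where B: "B \<subseteq> V" "indep_mod S W B" "spans_mod S W B V" "card B = d"
    "B' \<subseteq> V" "indep_mod S W B'" "spans_mod S W B' V" "card B' = d'"
    using assms by (auto simp: has_qdim_def)
  have "finite B" "finite B'" using B by (auto simp: indep_mod_def)
  with B show ?thesis
    using indep_mod_card_le_spanning[OF assms(1,2)] by (meson le_antisym)
qed

text \<open>
  Unique representation of all vectors amounts to independence and spanning, so that the description
  in \<^const>\<open>quotient_dim\<close> is met by exactly one number.
\<close>

lemma quotient_dim_eq:
  assumes S: "is_subfield S" and V: "subspace_over S V" and W: "subspace_over S W"
    and d: "has_qdim S V W d"
  shows "quotient_dim S V W = d"
proof -
  have "(finite B \<and> card B = k \<and> B \<subseteq> V \<and>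
     (\<forall>v\<in>V. \<exists>!c. c \<in> B \<rightarrow>\<^sub>E S \<and> v - (\<Sum>b\<in>B. c b * b) \<in> W)) \<longleftrightarrow>
     (B \<subseteq> V \<and> indep_mod S W B \<and> spans_mod S W B V \<and> card B = k)" (is "?L \<longleftrightarrow> ?R") for B k
  proof
    assume L: ?L
    have "indep_mod S W B" unfolding indep_mod_def
    proof (intro conjI allI impI ballI)
      fix c b assume c: "\<forall>b\<in>B. c b \<in> S" "(\<Sum>b\<in>B. c b * b) \<in> W" "b \<in> B"
      have "\<exists>!c. c \<in> B \<rightarrow>\<^sub>E S \<and> 0 - (\<Sum>b\<in>B. c b * b) \<in> W"
        using L subspace_overD(1)[OF V] by blast
      moreover have "restrict c B \<in> B \<rightarrow>\<^sub>E S \<and> 0 - (\<Sum>b\<in>B. restrict c B b * b) \<in> W"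
        using c subspace_over_minus[OF S W] by auto
      moreover have "restrict (\<lambda>_. 0) B \<in> B \<rightarrow>\<^sub>E S \<and> 0 - (\<Sum>b\<in>B. restrict (\<lambda>_. 0) B b * b) \<in> W"
        using is_subfieldD(1)[OF S] subspace_overD(1)[OF W] by (auto simp: sum.neutral)
      ultimately have "restrict c B = restrict (\<lambda>_. 0) B" by blast
      then show "c b = 0" using c(3) by (metis restrict_apply')
    qed (use L in auto)
    moreover have "spans_mod S W B V" unfolding spans_mod_def
    proof
      fix v assume "v \<in> V"
      then obtain c where "c \<in> B \<rightarrow>\<^sub>E S" "v - (\<Sum>b\<in>B. c b * b) \<in> W" using L by blast
      then show "\<exists>c. (\<forall>b\<in>B. c b \<in> S) \<and> v - (\<Sum>b\<in>B. c b * b) \<in> W" by blast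
    qed
    ultimately show ?R using L by auto
  next
    assume R: ?R
    have "\<exists>!c. c \<in> B \<rightarrow>\<^sub>E S \<and> v - (\<Sum>b\<in>B. c b * b) \<in> W" if v: "v \<in> V" for v
    proof -
      obtain c where c: "\<forall>b\<in>B. c b \<in> S" "v - (\<Sum>b\<in>B. c b * b) \<in> W"
        using R v unfolding spans_mod_def by blast
      show ?thesis
      proof (rule ex1I[of _ "restrict c B"])
        show "restrict c B \<in> B \<rightarrow>\<^sub>E S \<and> v - (\<Sum>b\<in>B. restrict c B b * b) \<in> W"
          using c by auto
        fix e assume e: "e \<in> B \<rightarrow>\<^sub>E S \<and> v - (\<Sum>b\<in>B. e b * b) \<in> W"
        have "(v - (\<Sum>b\<in>B. c b * b)) - (v - (\<Sum>b\<in>B. e b * b)) \<in> W"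
          using c e subspace_over_minus(2)[OF S W] by blast
        then have "(\<Sum>b\<in>B. (e b - c b) * b) \<in> W"
          by (simp add: left_diff_distrib sum_subtractf)
        moreover have "\<And>b. b \<in> B \<Longrightarrow> e b - c b \<in> S"
          using c e by (intro is_subfieldD(7)[OF S]) auto
        ultimately have "e b - c b = 0" if "b \<in> B" for b
          using indep_modD[of S W B "\<lambda>b. e b - c b"] R that by blast
        then show "e = restrict c B"
          using e by (intro ext) (auto simp: restrict_def PiE_def extensional_def)
      qed
    qed
    then show ?L using R by (auto simp: indep_mod_def)
  qed
  note eq0 = this
  have eq: "(\<exists>B. finite B \<and> card B = k \<and> B \<subseteq> V \<and>
     (\<forall>v\<in>V. \<exists>!c. c \<in> B \<rightarrow>\<^sub>E S \<and> v - (\<Sum>b\<in>B. c b * b) \<in> W)) \<longleftrightarrow> has_qdim S V W k" for k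
    unfolding has_qdim_def eq0 ..
  show ?thesis unfolding quotient_dim_def eq
    by (rule the_equality) (use d has_qdim_unique[OF S W] in auto)
qed

text \<open>
  An independent set of maximal size spans.
\<close>

lemma has_qdim_exists:
  assumes S: "is_subfield S" and W: "subspace_over S W"
    and bound: "\<And>B. B \<subseteq> V \<Longrightarrow> indep_mod S W B \<Longrightarrow> card B \<le> M"
  shows "\<exists>d\<le>M. has_qdim S V W d"
proof -
  define P where "P = (\<lambda>k. \<exists>B\<subseteq>V. indep_mod S W B \<and> card B = k)"
  have "P 0" unfolding P_def by (intro exI[of _ "{}"]) (auto simp: indep_mod_def)
  moreover have bd: "\<And>k. P k \<Longrightarrow> k \<le> M" using bound by (auto simp: P_def)
  ultimately have PG: "P (Greatest P)" and G: "\<And>k. P k \<Longrightarrow> k \<le> Greatest P"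
    using GreatestI_nat[of P 0 M] Greatest_le_nat[of P _ M] by blast+
  obtain B where B: "B \<subseteq> V" "indep_mod S W B" "card B = Greatest P" using PG by (auto simp: P_def)
  have fB: "finite B" using B by (simp add: indep_mod_def)
  have "spans_mod S W B V" unfolding spans_mod_def
  proof (rule ballI, rule ccontr)
    fix v assume v: "v \<in> V" and nspan: "\<nexists>c. (\<forall>b\<in>B. c b \<in> S) \<and> v - (\<Sum>b\<in>B. c b * b) \<in> W"
    have vB: "v \<notin> B"
    proof
      assume "v \<in> B"
      then have "(\<Sum>b\<in>B. (if b = v then 1 else 0) * b) = v"
        using fB by (simp add: if_distrib[of "\<lambda>c. c * _"] cong: if_cong)
      then have "v - (\<Sum>b\<in>B. (if b = v then 1 else 0) * b) \<in> W"
        using subspace_overD(1)[OF W] by simp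
      moreover have "\<forall>b\<in>B. (if b = v then 1 else 0) \<in> S" using is_subfieldD(1,2)[OF S] by auto
      ultimately show False using nspan by (auto dest!: spec[of _ "\<lambda>b. if b = v then 1 else 0"])
    qed
    have "indep_mod S W (insert v B)" unfolding indep_mod_def
    proof (intro conjI allI impI)
      fix c assume c: "\<forall>b\<in>insert v B. c b \<in> S" and "(\<Sum>b\<in>insert v B. c b * b) \<in> W"
      then have sW: "c v * v + (\<Sum>b\<in>B. c b * b) \<in> W" using fB vB by simp
      have cv: "c v = 0"
      proof (rule ccontr)
        assume nz: "c v \<noteq> 0"
        have "inverse (c v) * (c v * v + (\<Sum>b\<in>B. c b * b)) \<in> W"
          using c by (intro subspace_overD(3)[OF W] sW is_subfieldD[OF S]) auto
        moreover have "inverse (c v) * (c v * v + (\<Sum>b\<in>B. c b * b))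
            = v - (\<Sum>b\<in>B. (- inverse (c v) * c b) * b)"
          using nz by (simp add: distrib_left sum_distrib_left sum_negf mult_ac)
        moreover have "\<forall>b\<in>B. - inverse (c v) * c b \<in> S"
          using c by (auto intro!: is_subfieldD[OF S])
        ultimately show False
          using nspan by (auto dest!: spec[of _ "\<lambda>b. - inverse (c v) * c b"])
      qed
      then have "(\<Sum>b\<in>B. c b * b) \<in> W" using sW by simp
      then show "\<forall>b\<in>insert v B. c b = 0" using cv c indep_modD[OF B(2)] by blast
    qed (use fB in simp)
    then have "P (Suc (card B))" unfolding P_def using v vB fB B(1) by (intro exI[of _ "insert v B"]) auto
    then show False using G B(3) by fastforce
  qed
  then show ?thesis using B bd[OF PG] unfolding has_qdim_def by auto
qed

text \<open>Bases of \<open>U/V\<close> and of \<open>V/W\<close> together represent a basis of \<open>U/W\<close>.\<close>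

lemma has_qdim_add:
  assumes S: "is_subfield S" and V: "subspace_over S V" and "W \<subseteq> V" "V \<subseteq> U"
    and "has_qdim S U V d1" "has_qdim S V W d2"
  shows "has_qdim S U W (d1 + d2)"
proof -
  obtain B1 B2 where B: "B1 \<subseteq> U" "indep_mod S V B1" "spans_mod S V B1 U" "card B1 = d1"
    "B2 \<subseteq> V" "indep_mod S W B2" "spans_mod S W B2 V" "card B2 = d2"
    using assms by (auto simp: has_qdim_def)
  have fin: "finite B1" "finite B2" using B by (auto simp: indep_mod_def)
  have disj: "B1 \<inter> B2 = {}"
  proof (rule ccontr)
    assume "B1 \<inter> B2 \<noteq> {}"
    then obtain b where b: "b \<in> B1" "b \<in> V" using B(5) by auto
    have "(\<Sum>a\<in>B1. (if a = b then 1 else 0) * a) = b"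
      using fin b by (simp add: if_distrib[of "\<lambda>c. c * _"] cong: if_cong)
    moreover have "\<And>a. (if a = b then 1 else 0) \<in> S" using is_subfieldD(1,2)[OF S] by auto
    ultimately show False
      using indep_modD[OF B(2), of "\<lambda>a. if a = b then 1 else 0" b] b by auto
  qed
  have "indep_mod S W (B1 \<union> B2)" unfolding indep_mod_def
  proof (intro conjI allI impI)
    fix c assume c: "\<forall>b\<in>B1 \<union> B2. c b \<in> S" and "(\<Sum>b\<in>B1 \<union> B2. c b * b) \<in> W"
    then have sW: "(\<Sum>b\<in>B1. c b * b) + (\<Sum>b\<in>B2. c b * b) \<in> W"
      using fin disj by (simp add: sum.union_disjoint)
    have "(\<Sum>b\<in>B2. c b * b) \<in> V" by (rule subspace_over_lincomb[OF V B(5)]) (use c in auto)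
    then have "(\<Sum>b\<in>B1. c b * b) \<in> V"
      using subspace_over_minus(2)[OF S V] sW \<open>W \<subseteq> V\<close> by (metis add_diff_cancel_right' subsetD)
    then have 1: "\<forall>b\<in>B1. c b = 0" using indep_modD[OF B(2)] c by blast
    then have "(\<Sum>b\<in>B2. c b * b) \<in> W" using sW by simp
    then have "\<forall>b\<in>B2. c b = 0" using indep_modD[OF B(6)] c by blast
    with 1 show "\<forall>b\<in>B1 \<union> B2. c b = 0" by auto
  qed (use fin in simp)
  moreover have "spans_mod S W (B1 \<union> B2) U" unfolding spans_mod_def
  proof
    fix v assume "v \<in> U"
    then obtain c1 where c1: "\<forall>b\<in>B1. c1 b \<in> S" "v - (\<Sum>b\<in>B1. c1 b * b) \<in> V"
      using B(3) unfolding spans_mod_def by blast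
    then obtain c2 where c2: "\<forall>b\<in>B2. c2 b \<in> S" "v - (\<Sum>b\<in>B1. c1 b * b) - (\<Sum>b\<in>B2. c2 b * b) \<in> W"
      using B(7) unfolding spans_mod_def by blast
    define c where "c = (\<lambda>b. if b \<in> B1 then c1 b else c2 b)"
    have "(\<Sum>b\<in>B1 \<union> B2. c b * b) = (\<Sum>b\<in>B1. c b * b) + (\<Sum>b\<in>B2. c b * b)"
      using fin disj by (simp add: sum.union_disjoint)
    also have "(\<Sum>b\<in>B1. c b * b) = (\<Sum>b\<in>B1. c1 b * b)" by (simp add: c_def)
    also have "(\<Sum>b\<in>B2. c b * b) = (\<Sum>b\<in>B2. c2 b * b)"
      by (rule sum.cong) (use disj in \<open>auto simp: c_def\<close>)
    finally have "v - (\<Sum>b\<in>B1 \<union> B2. c b * b) \<in> W" using c2(2) by (simp add: diff_diff_eq)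
    moreover have "\<forall>b\<in>B1 \<union> B2. c b \<in> S" using c1 c2 by (auto simp: c_def)
    ultimately show "\<exists>c. (\<forall>b\<in>B1 \<union> B2. c b \<in> S) \<and> v - (\<Sum>b\<in>B1 \<union> B2. c b * b) \<in> W" by blast
  qed
  moreover have "card (B1 \<union> B2) = d1 + d2" using B fin disj by (simp add: card_Un_disjoint)
  moreover have "B1 \<union> B2 \<subseteq> U" using B \<open>V \<subseteq> U\<close> by auto
  ultimately show ?thesis unfolding has_qdim_def by blast
qed

text \<open>
  The hypotheses make the map \<open>V/W \<rightarrow> V'/W'\<close> induced by the inclusion injective; the extra one of
  the second part makes it surjective.
\<close>

lemma has_qdim_inject:
  assumes S: "is_subfield S" and V: "subspace_over S V" and W: "subspace_over S W"
    and W': "subspace_over S W'"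
    and "V \<subseteq> V'" and WW': "\<And>v. v \<in> V \<Longrightarrow> v \<in> W' \<longleftrightarrow> v \<in> W"
    and d': "has_qdim S V' W' d'"
  shows "\<exists>d\<le>d'. has_qdim S V W d"
    and "(\<And>v'. v' \<in> V' \<Longrightarrow> \<exists>v\<in>V. v' - v \<in> W') \<Longrightarrow> has_qdim S V W d'"
proof -
  have lin: "(\<Sum>b\<in>B. c b * b) \<in> W' \<longleftrightarrow> (\<Sum>b\<in>B. c b * b) \<in> W" if "B \<subseteq> V" "\<forall>b\<in>B. c b \<in> S" for B c
    using subspace_over_lincomb[OF V that(1)] that(2) WW' by blast
  have indep: "indep_mod S W' B" if "B \<subseteq> V" "indep_mod S W B" for B
    using that lin unfolding indep_mod_def by blast
  have bound: "card B \<le> d'" if B: "B \<subseteq> V" "indep_mod S W B" for B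
  proof -
    obtain C where C: "indep_mod S W' C" "spans_mod S W' C V'" "card C = d'"
      using d' by (auto simp: has_qdim_def)
    show ?thesis
      using indep_mod_card_le_spanning[OF S W' _ indep[OF B] _ C(2)] B C \<open>V \<subseteq> V'\<close>
      by (auto simp: indep_mod_def)
  qed
  show 1: "\<exists>d\<le>d'. has_qdim S V W d" using has_qdim_exists[OF S W bound] by blast
  assume surj: "\<And>v'. v' \<in> V' \<Longrightarrow> \<exists>v\<in>V. v' - v \<in> W'"
  obtain d where d: "has_qdim S V W d" using 1 by blast
  obtain B where B: "B \<subseteq> V" "indep_mod S W B" "spans_mod S W B V" "card B = d"
    using d by (auto simp: has_qdim_def)
  have "spans_mod S W' B V'" unfolding spans_mod_def
  proof
    fix v' assume "v' \<in> V'"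
    then obtain v where v: "v \<in> V" "v' - v \<in> W'" using surj by blast
    then obtain c where c: "\<forall>b\<in>B. c b \<in> S" "v - (\<Sum>b\<in>B. c b * b) \<in> W"
      using B(3) unfolding spans_mod_def by blast
    have "v - (\<Sum>b\<in>B. c b * b) \<in> V"
      using v subspace_over_lincomb[OF V B(1)] c by (intro subspace_over_minus(2)[OF S V]) auto
    then have "v - (\<Sum>b\<in>B. c b * b) \<in> W'" using c WW' by blast
    then have "(v' - v) + (v - (\<Sum>b\<in>B. c b * b)) \<in> W'" using v subspace_overD(2)[OF W'] by blast
    then show "\<exists>c. (\<forall>b\<in>B. c b \<in> S) \<and> v' - (\<Sum>b\<in>B. c b * b) \<in> W'" using c by auto
  qed
  then have "has_qdim S V' W' d" unfolding has_qdim_def using B indep \<open>V \<subseteq> V'\<close> by blast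
  then show "has_qdim S V W d'" using has_qdim_unique[OF S W' _ d'] d by blast
qed

lemma has_qdim_scale:
  assumes "is_subfield S" "\<tau> \<noteq> 0" "has_qdim S V W d"
  shows "has_qdim S ((*) \<tau> ` V) ((*) \<tau> ` W) d"
proof -
  obtain B where B: "B \<subseteq> V" "indep_mod S W B" "spans_mod S W B V" "card B = d"
    using assms by (auto simp: has_qdim_def)
  have inj: "inj_on ((*) \<tau>) A" for A using assms(2) by (intro inj_onI) simp
  have sum_eq: "(\<Sum>b\<in>(*) \<tau> ` B. c b * b) = \<tau> * (\<Sum>b\<in>B. c (\<tau> * b) * b)" for c
    unfolding sum.reindex[OF inj] by (simp add: sum_distrib_left mult_ac o_def)
  have mem: "\<tau> * w \<in> (*) \<tau> ` W \<longleftrightarrow> w \<in> W" for w using inj_image_mem_iff[OF inj] by blast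
  have "indep_mod S ((*) \<tau> ` W) ((*) \<tau> ` B)" unfolding indep_mod_def sum_eq mem
  proof (intro conjI allI impI)
    fix c assume c: "\<forall>b\<in>(*) \<tau> ` B. c b \<in> S" "(\<Sum>b\<in>B. c (\<tau> * b) * b) \<in> W"
    have "c (\<tau> * b) = 0" if "b \<in> B" for b
      by (rule indep_modD[OF B(2) _ c(2) that]) (use c(1) in auto)
    then show "\<forall>b\<in>(*) \<tau> ` B. c b = 0" by auto
  qed (use B in \<open>auto simp: indep_mod_def\<close>)
  moreover have "spans_mod S ((*) \<tau> ` W) ((*) \<tau> ` B) ((*) \<tau> ` V)" unfolding spans_mod_def sum_eq
  proof
    fix u assume "u \<in> (*) \<tau> ` V"
    then obtain v where v: "v \<in> V" "u = \<tau> * v" by auto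
    then obtain c where c: "\<forall>b\<in>B. c b \<in> S" "v - (\<Sum>b\<in>B. c b * b) \<in> W"
      using B(3) unfolding spans_mod_def by blast
    have "u - \<tau> * (\<Sum>b\<in>B. c b * b) \<in> (*) \<tau> ` W"
      using imageI[OF c(2), of "(*) \<tau>"] by (simp add: v(2) right_diff_distrib)
    then show "\<exists>c. (\<forall>b\<in>(*) \<tau> ` B. c b \<in> S) \<and> u - \<tau> * (\<Sum>b\<in>B. c (\<tau> * b) * b) \<in> (*) \<tau> ` W"
      using c(1) assms(2) by (intro exI[of _ "\<lambda>b. c (b / \<tau>)"]) auto
  qed
  moreover have "card ((*) \<tau> ` B) = d" using B card_image[OF inj] by auto
  ultimately show ?thesis unfolding has_qdim_def using B(1) by blast
qed

lemma has_qdim_0D: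
  assumes "has_qdim S V W 0"
  shows "V \<subseteq> W"
proof -
  obtain B where B: "indep_mod S W B" "spans_mod S W B V" "card B = 0"
    using assms by (auto simp: has_qdim_def)
  then have "B = {}" by (simp add: indep_mod_def)
  with B(2) show ?thesis by (auto simp: spans_mod_def)
qed

text \<open>
  A repetition in the family would itself be a relation, so it suffices to know that there is none.
\<close>

lemma indep_family:
  assumes S: "is_subfield S" and I: "finite I"
    and f: "\<And>c. (\<forall>s\<in>I. c s \<in> S) \<Longrightarrow> (\<Sum>s\<in>I. c s * f s) = 0 \<Longrightarrow> \<forall>s\<in>I. c s = 0"
  shows "inj_on f I" "indep_mod S {0} (f ` I)"
proof -
  show inj: "inj_on f I"
  proof (rule inj_onI, rule ccontr)
    fix s t assume st: "s \<in> I" "t \<in> I" "f s = f t" "s \<noteq> t"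
    define c where "c = (\<lambda>r. if r = s then 1 else if r = t then - 1 else (0 :: 'a))"
    have S1: "(0::'a) \<in> S" "(1::'a) \<in> S" "- (1::'a) \<in> S"
      using is_subfieldD(1,2)[OF S] is_subfieldD(5)[OF S is_subfieldD(2)[OF S]] by auto
    have "\<forall>r\<in>I. c r \<in> S" using S1 by (simp add: c_def)
    moreover have "(\<Sum>r\<in>I. c r * f r) = (\<Sum>r\<in>{s, t}. c r * f r)"
      by (rule sum.mono_neutral_right) (use I st in \<open>auto simp: c_def\<close>)
    then have "(\<Sum>r\<in>I. c r * f r) = 0" using st by (simp add: c_def)
    ultimately have "\<forall>r\<in>I. c r = 0" by (rule f)
    then have "c s = 0" using st(1) by blast
    then show False by (simp add: c_def)
  qed
  show "indep_mod S {0} (f ` I)" unfolding indep_mod_def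
  proof (intro conjI allI impI)
    fix c assume c: "\<forall>b\<in>f ` I. c b \<in> S" "(\<Sum>b\<in>f ` I. c b * b) \<in> {0}"
    then have "(\<Sum>s\<in>I. c (f s) * f s) = 0" by (simp add: sum.reindex[OF inj])
    moreover have "\<forall>s\<in>I. c (f s) \<in> S" using c(1) by blast
    ultimately show "\<forall>b\<in>f ` I. c b = 0" using f[of "\<lambda>s. c (f s)"] by blast
  qed (use I in simp)
qed

section \<open>Valuation rings and discrete places\<close>

locale constant_field =
  fixes \<iota> :: "'q::field \<Rightarrow> 'a::field"
  assumes hom: "field_hom \<iota>"
begin

lemma iota_simps [simp]:
  "\<iota> 0 = 0" "\<iota> 1 = 1" "\<iota> (a + b) = \<iota> a + \<iota> b" "\<iota> (a * b) = \<iota> a * \<iota> b"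
  "\<iota> (- a) = - \<iota> a" "\<iota> (a - b) = \<iota> a - \<iota> b" "\<iota> a = 0 \<longleftrightarrow> a = 0" "\<iota> (inverse a) = inverse (\<iota> a)"
  "\<iota> a = \<iota> b \<longleftrightarrow> a = b"
proof -
  show 1: "\<iota> 1 = 1" and add: "\<And>a b. \<iota> (a + b) = \<iota> a + \<iota> b" and mult: "\<And>a b. \<iota> (a * b) = \<iota> a * \<iota> b"
    using hom by (auto simp: field_hom_def)
  have "\<iota> 0 + \<iota> 0 = \<iota> 0" using add[of 0 0] by simp
  then show 0: "\<iota> 0 = 0" by (metis add_cancel_right_right)
  show neg: "\<iota> (- a) = - \<iota> a" for a using add[of a "- a"] 0 by (simp add: add_eq_0_iff)
  show diff: "\<iota> (a - b) = \<iota> a - \<iota> b" for a b using add[of a "- b"] neg by simp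
  show zero: "\<iota> a = 0 \<longleftrightarrow> a = 0" for a
  proof
    assume "\<iota> a = 0"
    then show "a = 0" using mult[of a "inverse a"] 1 by (cases "a = 0") auto
  qed (use 0 in simp)
  show "\<iota> (inverse a) = inverse (\<iota> a)" for a
    by (cases "a = 0") (use mult[of a "inverse a"] 1 0 in \<open>auto intro!: inverse_unique[symmetric]\<close>)
  show "\<iota> a = \<iota> b \<longleftrightarrow> a = b" for a b using zero[of "a - b"] diff by simp
qed

lemma K_subfield: "is_subfield (range \<iota>)"
  unfolding is_subfield_def
proof (intro conjI ballI)
  show "0 \<in> range \<iota>" by (rule range_eqI[of _ _ 0]) simp
  show "1 \<in> range \<iota>" by (rule range_eqI[of _ _ 1]) simp
  fix u assume "u \<in> range \<iota>"
  then obtain a where a: "u = \<iota> a" by auto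
  show "- u \<in> range \<iota>" by (rule range_eqI[of _ _ "- a"]) (simp add: a)
  show "inverse u \<in> range \<iota>" by (rule range_eqI[of _ _ "inverse a"]) (simp add: a)
  fix w assume "w \<in> range \<iota>"
  then obtain b where b: "w = \<iota> b" by auto
  show "u + w \<in> range \<iota>" by (rule range_eqI[of _ _ "a + b"]) (simp add: a b)
  show "u * w \<in> range \<iota>" by (rule range_eqI[of _ _ "a * b"]) (simp add: a b)
qed

abbreviation ev :: "'q poly \<Rightarrow> 'a \<Rightarrow> 'a" where
  "ev p z \<equiv> poly (map_poly \<iota> p) z"

lemma ev_pCons [simp]: "ev (pCons c p) z = \<iota> c + z * ev p z"
  by (simp add: map_poly_pCons)

lemma ev_add [simp]: "ev (p + q) z = ev p z + ev q z"
  by (induction p q rule: poly_induct2) (simp_all add: algebra_simps)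

lemma ev_smult [simp]: "ev (smult c p) z = \<iota> c * ev p z"
  by (induction p) (simp_all add: algebra_simps)

lemma ev_mult [simp]: "ev (p * q) z = ev p z * ev q z"
  by (induction p) (simp_all add: algebra_simps)

lemma ev_minus [simp]: "ev (- p) z = - ev p z"
  by (induction p) (simp_all add: algebra_simps)

lemma ev_diff [simp]: "ev (p - q) z = ev p z - ev q z"
  using ev_add[of p "- q" z] by simp

lemma ev_1 [simp]: "ev 1 z = 1"
  by (simp add: one_pCons)

lemma ev_monom [simp]: "ev (monom c k) z = \<iota> c * z ^ k"
  by (simp add: map_poly_monom poly_monom)

lemma ev_power [simp]: "ev (p ^ k) z = ev p z ^ k"
  by (induction k) simp_all

lemma ev_sum: "ev (sum f I) z = (\<Sum>i\<in>I. ev (f i) z)"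
  by (induction I rule: infinite_finite_induct) simp_all

lemma ev_prod: "ev (prod f I) z = (\<Prod>i\<in>I. ev (f i) z)"
  by (induction I rule: infinite_finite_induct) simp_all

lemma ev_altdef:
  assumes "degree p \<le> L"
  shows "ev p z = (\<Sum>i\<le>L. \<iota> (coeff p i) * z ^ i)"
proof -
  have "p = (\<Sum>i\<le>L. monom (coeff p i) i)"
    by (rule poly_as_sum_of_monoms'[symmetric, OF assms])
  then have "ev p z = ev (\<Sum>i\<le>L. monom (coeff p i) i) z" by simp
  then show ?thesis by (simp add: ev_sum)
qed

lemma ev_in_subfield:
  assumes "is_subfield T" "range \<iota> \<subseteq> T" "z \<in> T"
  shows "ev p z \<in> T"
proof -
  have "\<iota> a \<in> T" for a using assms(2) by auto
  then show ?thesis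
    by (induction p) (auto intro!: is_subfieldD(1,3,4)[OF assms(1)] assms(3))
qed

text \<open>
  Divide the relation by the lowest power of \<open>w\<close> that occurs in it.
\<close>

lemma lowest_term_relation:
  assumes w: "w \<noteq> 0" and c: "\<exists>i\<le>M. c i \<noteq> 0" "(\<Sum>i\<le>M. ev (c i) z * w ^ i) = 0"
  shows "\<exists>p r. p \<noteq> 0 \<and> ev p z = w * (\<Sum>i\<le>M. ev (r i) z * w ^ i)"
proof -
  define l where "l = (LEAST i. c i \<noteq> 0)"
  obtain i0 where i0: "i0 \<le> M" "c i0 \<noteq> 0" using c(1) by blast
  have l: "c l \<noteq> 0" unfolding l_def by (rule LeastI) (rule i0(2))
  have l_min: "c i = 0" if "i < l" for i
    using not_less_Least[of i "\<lambda>i. c i \<noteq> 0"] that unfolding l_def by blast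
  have l_le: "l \<le> M" using Least_le[of "\<lambda>i. c i \<noteq> 0" i0] i0 unfolding l_def by linarith
  define r where "r = (\<lambda>i. if l + i + 1 \<le> M then - c (l + i + 1) else 0)"
  have "0 = (\<Sum>i\<in>{l..M}. ev (c i) z * w ^ i)"
    using c(2) by (subst sum.mono_neutral_left[of "{..M}"]) (auto simp: l_min)
  also have "\<dots> = ev (c l) z * w ^ l + (\<Sum>i\<in>{Suc l..M}. ev (c i) z * w ^ i)"
    using l_le by (simp add: sum.atLeast_Suc_atMost)
  also have "(\<Sum>i\<in>{Suc l..M}. ev (c i) z * w ^ i) = (\<Sum>i\<in>{i. i \<le> M \<and> l + i + 1 \<le> M}. ev (c (l + i + 1)) z * w ^ (l + i + 1))"
    by (rule sum.reindex_bij_witness[of _ "\<lambda>i. l + i + 1" "\<lambda>i. i - l - 1"]) auto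
  also have "\<dots> = (\<Sum>i\<le>M. - (ev (r i) z * w ^ (l + i + 1)))"
    by (rule sum.mono_neutral_cong_left) (auto simp: r_def)
  also have "\<dots> = - (w ^ l * (w * (\<Sum>i\<le>M. ev (r i) z * w ^ i)))"
    by (simp add: sum_distrib_left sum_negf power_add mult_ac)
  finally have "w ^ l * ev (c l) z = w ^ l * (w * (\<Sum>i\<le>M. ev (r i) z * w ^ i))" by (simp add: mult_ac)
  then have "ev (c l) z = w * (\<Sum>i\<le>M. ev (r i) z * w ^ i)" using w by simp
  with l show ?thesis by blast
qed

end

locale extension_field = constant_field \<iota> for \<iota> :: "'q::field \<Rightarrow> 'a::field" +
  fixes F :: "'a set"
  assumes F_subfield: "is_subfield F" and K_subset_F: "range \<iota> \<subseteq> F"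
begin

lemmas F_closed [simp, intro] = is_subfieldD[OF F_subfield]

lemma iota_in_F [simp, intro]: "\<iota> c \<in> F"
  using K_subset_F by auto

lemma ev_in_F [simp, intro]: "z \<in> F \<Longrightarrow> ev p z \<in> F"
  by (rule ev_in_subfield[OF F_subfield K_subset_F])

abbreviation loc :: "'a set \<Rightarrow> 'a set" where
  "loc P \<equiv> local_ring F P"

lemma valuation_ring_of_place:
  assumes "P \<in> places \<iota> F"
  shows "valuation_ring \<iota> F (loc P)" and "P = {z \<in> loc P. z = 0 \<or> inverse z \<notin> loc P}"
proof -
  obtain R where R: "valuation_ring \<iota> F R" "P = {z \<in> R. z = 0 \<or> inverse z \<notin> R}"
    using assms by (auto simp: places_def)
  have "0 \<in> R" using R by (auto simp: valuation_ring_def intro: range_eqI[of _ _ 0])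
  moreover have "R \<subseteq> F" "\<forall>z\<in>F. z \<noteq> 0 \<longrightarrow> z \<in> R \<or> inverse z \<in> R"
    using R by (auto simp: valuation_ring_def)
  ultimately have "loc P = R"
    unfolding local_ring_def R(2) by auto
  then show "valuation_ring \<iota> F (loc P)" "P = {z \<in> loc P. z = 0 \<or> inverse z \<notin> loc P}" using R by auto
qed

context
  fixes P assumes P: "P \<in> places \<iota> F"
begin

lemma loc_subset_F: "loc P \<subseteq> F" by (auto simp: local_ring_def)

lemma loc_iota [simp]: "\<iota> c \<in> loc P"
  using valuation_ring_of_place(1)[OF P] by (auto simp: valuation_ring_def)

lemma loc_0 [simp]: "0 \<in> loc P" using loc_iota[of 0] by simp
lemma loc_1 [simp]: "1 \<in> loc P" using loc_iota[of 1] by simp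

lemma loc_add: "a \<in> loc P \<Longrightarrow> b \<in> loc P \<Longrightarrow> a + b \<in> loc P"
  and loc_mult: "a \<in> loc P \<Longrightarrow> b \<in> loc P \<Longrightarrow> a * b \<in> loc P"
  using valuation_ring_of_place(1)[OF P] by (auto simp: valuation_ring_def)

lemma loc_minus: "a \<in> loc P \<Longrightarrow> - a \<in> loc P"
  using loc_mult[of "\<iota> (-1)" a] loc_iota[of "-1"] by simp

lemma loc_diff: "a \<in> loc P \<Longrightarrow> b \<in> loc P \<Longrightarrow> a - b \<in> loc P"
  using loc_add[of a "- b"] loc_minus[of b] by simp

lemma loc_power: "a \<in> loc P \<Longrightarrow> a ^ k \<in> loc P"
  by (induction k) (auto intro: loc_mult)

lemma loc_ev: "z \<in> loc P \<Longrightarrow> ev p z \<in> loc P"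
  by (induction p) (auto intro: loc_add loc_mult)

lemma loc_sum: "(\<And>i. i \<in> I \<Longrightarrow> f i \<in> loc P) \<Longrightarrow> sum f I \<in> loc P"
  by (induction I rule: infinite_finite_induct) (auto intro: loc_add)

lemma in_loc_or_inverse: "z \<in> F \<Longrightarrow> z \<in> loc P \<or> inverse z \<in> P"
  using P by (auto simp: local_ring_def)

lemma place_iff: "z \<in> P \<longleftrightarrow> z \<in> loc P \<and> (z = 0 \<or> inverse z \<notin> loc P)"
  using valuation_ring_of_place(2)[OF P] by blast

lemma place_subset_loc: "P \<subseteq> loc P" using place_iff by blast

lemma place_0 [simp]: "0 \<in> P" using place_iff by simp

lemma place_1 [simp]: "1 \<notin> P" using place_iff by simp

lemma place_iota: "\<iota> c \<in> P \<longleftrightarrow> c = 0"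
  using place_iff[of "\<iota> c"] loc_iota[of "inverse c"] by auto

lemma unit_inverse: "z \<in> loc P \<Longrightarrow> z \<notin> P \<Longrightarrow> inverse z \<in> loc P - P"
  using place_iff[of z] place_iff[of "inverse z"] by auto

lemma place_mult: assumes "a \<in> loc P" "b \<in> P" shows "a * b \<in> P"
proof (rule ccontr)
  assume n: "a * b \<notin> P"
  then have nz: "a * b \<noteq> 0" by auto
  have "inverse (a * b) \<in> loc P"
    using n assms place_iff[of "a * b"] loc_mult[of a b] place_subset_loc by auto
  then have "a * inverse (a * b) \<in> loc P" using assms(1) loc_mult by blast
  then have "inverse b \<in> loc P" using nz by (simp add: field_simps)
  then show False using assms(2) place_iff[of b] nz by auto
qed

lemma place_add: assumes "a \<in> P" "b \<in> P" shows "a + b \<in> P"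
proof (cases "a = 0 \<or> b = 0")
  case False
  have *: "a + b \<in> P" if ab: "a / b \<in> loc P" "b \<in> P" "b \<noteq> 0" for a b
  proof -
    have "(1 + a / b) * b \<in> P" using ab by (intro place_mult loc_add) auto
    moreover have "(1 + a / b) * b = a + b" using ab by (simp add: distrib_right)
    ultimately show ?thesis by simp
  qed
  have F: "a \<in> F" "b \<in> F" using assms place_subset_loc loc_subset_F by auto
  then have "a / b \<in> loc P \<or> inverse (a / b) \<in> loc P"
    using in_loc_or_inverse[of "a / b"] place_subset_loc by auto
  then show ?thesis
    using *[of a b] *[of b a] False assms by (auto simp: add.commute)
qed (use assms in auto)

lemma place_minus: "a \<in> P \<Longrightarrow> - a \<in> P"
  using place_mult[of "-1" a] loc_minus[of 1] by simp

lemma place_diff: "a \<in> P \<Longrightarrow> b \<in> P \<Longrightarrow> a - b \<in> P"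
  using place_add[of a "- b"] place_minus by simp

lemma place_sum: "(\<And>i. i \<in> I \<Longrightarrow> f i \<in> P) \<Longrightarrow> sum f I \<in> P"
  by (induction I rule: infinite_finite_induct) (auto intro: place_add)

lemma unit_mult: "u \<in> loc P - P \<Longrightarrow> w \<in> loc P - P \<Longrightarrow> u * w \<in> loc P - P"
proof -
  assume u: "u \<in> loc P - P" and w: "w \<in> loc P - P"
  have "u \<noteq> 0" using u by auto
  have "u * w \<notin> P"
  proof
    assume uw: "u * w \<in> P"
    have "inverse u * (u * w) \<in> P" by (rule place_mult[OF _ uw]) (use u unit_inverse in auto)
    moreover have "inverse u * (u * w) = w" using \<open>u \<noteq> 0\<close> by simp
    ultimately show False using w by simp
  qed
  then show ?thesis using u w loc_mult by auto
qed

lemma unit_power: "u \<in> loc P - P \<Longrightarrow> u ^ k \<in> loc P - P"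
  by (induction k) (use unit_mult in auto)

lemma unit_plus_place: "u \<in> loc P - P \<Longrightarrow> z \<in> P \<Longrightarrow> u + z \<in> loc P - P"
  using place_diff[of "u + z" z] loc_add[of u z] place_subset_loc by auto

lemma subspace_loc: "subspace_over (range \<iota>) (loc P)"
  unfolding subspace_over_def using loc_add loc_mult by auto

lemma subspace_place: "subspace_over (range \<iota>) P"
  unfolding subspace_over_def using place_add place_mult by auto

lemma place_nontrivial: "\<exists>w\<in>P. w \<noteq> 0"
proof -
  obtain z where "z \<in> F" "z \<notin> loc P"
    using valuation_ring_of_place(1)[OF P] by (auto simp: valuation_ring_def)
  then have "inverse z \<in> P" "z \<noteq> 0" using in_loc_or_inverse by auto
  then show ?thesis by (intro bexI[of _ "inverse z"]) auto
qed

end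

subsection \<open>Elements over which the field is finite\<close>

text \<open>\<open>[F : K(z)] \<le> M\<close>, with denominators cleared.\<close>

definition degree_over_le :: "'a \<Rightarrow> nat \<Rightarrow> bool" where
  "degree_over_le z M \<longleftrightarrow> (\<forall>w::nat \<Rightarrow> 'a. (\<forall>i\<le>M. w i \<in> F) \<longrightarrow>
     (\<exists>c. (\<exists>i\<le>M. c i \<noteq> 0) \<and> (\<Sum>i\<le>M. ev (c i) z * w i) = 0))"

lemma primitive_relation:
  assumes "z \<noteq> 0" "finite I" "i0 \<in> I" "c i0 \<noteq> 0" "(\<Sum>i\<in>I. ev (c i) z * w i) = 0"
  shows "\<exists>c'. (\<exists>i\<in>I. coeff (c' i) 0 \<noteq> 0) \<and> (\<Sum>i\<in>I. ev (c' i) z * w i) = 0"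
  using assms(4,5)
proof (induction "degree (c i0)" arbitrary: c rule: less_induct)
  case less
  show ?case
  proof (cases "\<exists>i\<in>I. coeff (c i) 0 \<noteq> 0")
    case False
    define c' where "c' = (\<lambda>i. poly_shift 1 (c i))"
    have c: "c i = pCons 0 (c' i)" if "i \<in> I" for i
      using False that by (intro poly_eqI) (auto simp: c'_def coeff_poly_shift coeff_pCons split: nat.split)
    have "z * (\<Sum>i\<in>I. ev (c' i) z * w i) = (\<Sum>i\<in>I. ev (c i) z * w i)"
      by (simp add: c sum_distrib_left mult_ac)
    then have "(\<Sum>i\<in>I. ev (c' i) z * w i) = 0" using less.prems assms(1) by auto
    moreover have "c' i0 \<noteq> 0" "degree (c' i0) < degree (c i0)"
      using less.prems c[OF assms(3)] by (auto simp: degree_pCons_eq)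
    ultimately show ?thesis using less.hyps[of c'] by auto
  qed (use less.prems in blast)
qed

text \<open>
  A \<open>K\<close>-linear relation modulo \<open>zV\<close> is what remains of a \<open>K[z]\<close>-linear relation that is not
  divisible by \<open>z\<close>; so independence modulo \<open>zV\<close> lifts to independence over \<open>K(z)\<close>.
\<close>

lemma indep_mod_multiples_card_le:
  assumes deg: "degree_over_le z M" and z: "z \<noteq> 0"
    and V: "subspace_over (range \<iota>) V" "V \<subseteq> F" "\<And>v. v \<in> V \<Longrightarrow> z * v \<in> V"
    and B: "B \<subseteq> V" "indep_mod (range \<iota>) ((*) z ` V) B"
  shows "card B \<le> M"
proof (rule ccontr)
  assume "\<not> card B \<le> M"
  have fB: "finite B" using B by (simp add: indep_mod_def)
  have "card {..M} \<le> card B" using \<open>\<not> card B \<le> M\<close> by simp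
  then obtain w where w: "w ` {..M} \<subseteq> B" "inj_on w {..M}"
    using card_le_inj[OF _ fB, of "{..M}"] by auto
  have "\<forall>i\<le>M. w i \<in> F" using w B V by auto
  then obtain c where c: "\<exists>i\<le>M. c i \<noteq> 0" "(\<Sum>i\<le>M. ev (c i) z * w i) = 0"
    using deg unfolding degree_over_le_def by blast
  then obtain i0 where i0: "i0 \<in> {..M}" "c i0 \<noteq> 0" by auto
  obtain c' where c': "\<exists>i\<in>{..M}. coeff (c' i) 0 \<noteq> 0" "(\<Sum>i\<le>M. ev (c' i) z * w i) = 0"
    using primitive_relation[OF z finite_atMost i0 c(2)] by blast
  have evV: "ev p z * v \<in> V" if "v \<in> V" for p v
  proof (induction p)
    case 0
    then show ?case using subspace_overD(1)[OF V(1)] by simp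
  next
    case (pCons a p)
    have "\<iota> a * v + z * (ev p z * v) \<in> V"
      using pCons that V(3) by (intro subspace_overD(2)[OF V(1)] subspace_overD(3)[OF V(1), of "\<iota> a"]) auto
    then show ?case by (simp add: algebra_simps)
  qed
  define r where "r = (\<lambda>i. poly_shift 1 (c' i))"
  have c'_eq: "c' i = pCons (coeff (c' i) 0) (r i)" for i
    by (intro poly_eqI) (auto simp: r_def coeff_poly_shift coeff_pCons split: nat.split)
  have ev_c': "ev (c' i) z = \<iota> (coeff (c' i) 0) + z * ev (r i) z" for i
    by (subst c'_eq) simp
  have "(\<Sum>i\<le>M. \<iota> (coeff (c' i) 0) * w i) + z * (\<Sum>i\<le>M. ev (r i) z * w i) = 0"
    using c'(2) by (simp add: ev_c' algebra_simps sum.distrib sum_distrib_left)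
  then have "(\<Sum>i\<le>M. \<iota> (coeff (c' i) 0) * w i) = z * (\<Sum>i\<le>M. ev (- r i) z * w i)"
    by (simp add: sum_negf eq_neg_iff_add_eq_0)
  also have "\<dots> \<in> (*) z ` V"
    using w B by (intro imageI subspace_over_sum[OF V(1)] evV) auto
  finally have mem: "(\<Sum>i\<le>M. \<iota> (coeff (c' i) 0) * w i) \<in> (*) z ` V" .
  define d where "d = (\<lambda>b. if b \<in> w ` {..M} then \<iota> (coeff (c' (the_inv_into {..M} w b)) 0) else 0)"
  have dw: "d (w i) = \<iota> (coeff (c' i) 0)" if "i \<le> M" for i
    using that w by (auto simp: d_def the_inv_into_f_f)
  have "(\<Sum>b\<in>B. d b * b) = (\<Sum>b\<in>w ` {..M}. d b * b)"
    by (rule sum.mono_neutral_right) (use fB w in \<open>auto simp: d_def\<close>)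
  also have "\<dots> = (\<Sum>i\<le>M. \<iota> (coeff (c' i) 0) * w i)"
    by (simp add: sum.reindex[OF w(2)] dw)
  finally have "(\<Sum>b\<in>B. d b * b) \<in> (*) z ` V" using mem by simp
  moreover have "d b \<in> range \<iota>" for b using is_subfieldD(1)[OF K_subfield] by (auto simp: d_def)
  ultimately have "\<forall>b\<in>B. d b = 0" using indep_modD[OF B(2), of d] by blast
  then have "\<forall>i\<le>M. coeff (c' i) 0 = 0" using dw w(1) by fastforce
  then show False using c'(1) by auto
qed

lemma powers_relation:
  assumes "degree_over_le z M" "w \<in> F" "w \<noteq> 0"
  shows "\<exists>p r. p \<noteq> 0 \<and> ev p z = w * (\<Sum>i\<le>M. ev (r i) z * w ^ i)"
proof -
  have "\<forall>i\<le>M. w ^ i \<in> F" using assms by auto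
  then obtain c where "\<exists>i\<le>M. c i \<noteq> 0" "(\<Sum>i\<le>M. ev (c i) z * w ^ i) = 0"
    using assms(1)[unfolded degree_over_le_def, rule_format, of "\<lambda>i. w ^ i"] by blast
  then show ?thesis by (rule lowest_term_relation[OF assms(3)])
qed

end

context extension_field begin

subsection \<open>Discreteness\<close>

definition discrete_place :: "'a set \<Rightarrow> bool" where
  "discrete_place P \<longleftrightarrow> P \<in> places \<iota> F \<and> (\<exists>t. t \<noteq> 0 \<and> P = (\<lambda>w. t * w) ` loc P \<and>
     (\<forall>z\<in>F. z \<noteq> 0 \<longrightarrow> (\<exists>k u. u \<in> loc P - P \<and> z = t powi k * u)))"

lemma common_divisor:
  assumes P: "P \<in> places \<iota> F" and "finite C" "C \<noteq> {}" "C \<subseteq> F - {0}"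
  shows "\<exists>t\<in>C. \<forall>c\<in>C. c / t \<in> loc P"
  using assms(2-)
proof (induction C rule: finite_ne_induct)
  case (singleton c)
  then show ?case using loc_1[OF P] by simp
next
  case (insert b C)
  then obtain t where t: "t \<in> C" "\<forall>c\<in>C. c / t \<in> loc P" by auto
  have nz: "b \<noteq> 0" "t \<noteq> 0" "b \<in> F" "t \<in> F" using insert t by auto
  have "b / t \<in> loc P \<or> inverse (b / t) \<in> loc P"
    using in_loc_or_inverse[OF P, of "b / t"] nz place_subset_loc[OF P] by blast
  then show ?case
  proof
    assume *: "inverse (b / t) \<in> loc P"
    have "c / b \<in> loc P" if "c \<in> insert b C" for c
    proof (cases "c = b")
      case False
      then have "c / t * inverse (b / t) \<in> loc P" using that t by (intro loc_mult[OF P] *) auto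
      then show ?thesis using nz by simp
    qed (use nz loc_1[OF P] in simp)
    then show ?thesis by blast
  qed (use t in blast)
qed

text \<open>
  Modulo \<open>z\<close> the place is spanned by finitely many elements.  As divisibility in a valuation ring is
  total, one of these elements and \<open>z\<close> divides all the others, and so generates the place.
\<close>

lemma place_principal:
  assumes P: "P \<in> places \<iota> F" and z: "z \<in> P" "z \<noteq> 0" and deg: "degree_over_le z M"
  shows "\<exists>t. t \<noteq> 0 \<and> P = (\<lambda>w. t * w) ` loc P"
proof -
  let ?zO = "(*) z ` loc P"
  have zloc: "z \<in> loc P" using z place_subset_loc[OF P] by auto
  have sub: "subspace_over (range \<iota>) ?zO"
    unfolding subspace_over_def
  proof (intro conjI ballI)
    show "0 \<in> ?zO" using loc_0[OF P] by (intro image_eqI[of _ _ 0]) auto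
    fix v assume "v \<in> ?zO"
    then obtain a where a: "v = z * a" "a \<in> loc P" by auto
    show "c * v \<in> ?zO" if "c \<in> range \<iota>" for c
      using that a loc_mult[OF P] loc_iota[OF P] by (intro image_eqI[of _ _ "c * a"]) auto
    fix w assume "w \<in> ?zO"
    then obtain b where b: "w = z * b" "b \<in> loc P" by auto
    show "v + w \<in> ?zO" using a b loc_add[OF P]
      by (intro image_eqI[of _ _ "a + b"]) (auto simp: distrib_left)
  qed
  have bound: "card B \<le> M" if "B \<subseteq> P" "indep_mod (range \<iota>) ?zO B" for B
    using indep_mod_multiples_card_le[OF deg z(2) subspace_loc[OF P] loc_subset_F[OF P]
        loc_mult[OF P zloc] _ that(2)] that(1) place_subset_loc[OF P] by blast
  obtain d where "has_qdim (range \<iota>) P ?zO d"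
    using has_qdim_exists[OF K_subfield sub bound] by blast
  then obtain B where B: "B \<subseteq> P" "indep_mod (range \<iota>) ?zO B" "spans_mod (range \<iota>) ?zO B P"
    by (auto simp: has_qdim_def)
  define C where "C = insert z (B - {0})"
  have C: "finite C" "C \<noteq> {}" "C \<subseteq> P" "C \<subseteq> F - {0}"
    using B z place_subset_loc[OF P] loc_subset_F[OF P] by (auto simp: C_def indep_mod_def)
  obtain t where t: "t \<in> C" "\<forall>c\<in>C. c / t \<in> loc P" using common_divisor[OF P C(1,2,4)] by blast
  have tnz: "t \<noteq> 0" and tP: "t \<in> P" using t C by auto
  have "P \<subseteq> (\<lambda>w. t * w) ` loc P"
  proof
    fix w assume "w \<in> P"
    then obtain c where c: "\<forall>b\<in>B. c b \<in> range \<iota>" "w - (\<Sum>b\<in>B. c b * b) \<in> ?zO"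
      using B(3) unfolding spans_mod_def by blast
    then obtain r where r: "r \<in> loc P" "w - (\<Sum>b\<in>B. c b * b) = z * r" by auto
    have Bt: "b / t \<in> loc P" if "b \<in> B" for b
      using that t(2) loc_0[OF P] by (cases "b = 0") (auto simp: C_def)
    have "w / t = (\<Sum>b\<in>B. c b * (b / t)) + z / t * r"
    proof -
      have "w = (\<Sum>b\<in>B. c b * b) + z * r" using r(2) by (simp add: algebra_simps)
      then show ?thesis by (simp add: add_divide_distrib sum_divide_distrib)
    qed
    also have "\<dots> \<in> loc P"
    proof (intro loc_add[OF P] loc_sum[OF P])
      show "c b * (b / t) \<in> loc P" if "b \<in> B" for b
        using c(1) that loc_iota[OF P] by (intro loc_mult[OF P _ Bt[OF that]]) auto
      have "z / t \<in> loc P" using t(2) by (auto simp: C_def)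
      then show "z / t * r \<in> loc P" using r(1) loc_mult[OF P] by blast
    qed
    finally show "w \<in> (\<lambda>w. t * w) ` loc P" using tnz by (intro image_eqI[of _ _ "w / t"]) auto
  qed
  moreover have "(\<lambda>w. t * w) ` loc P \<subseteq> P"
    using place_mult[OF P _ tP] by (auto simp: mult.commute)
  ultimately show ?thesis using tnz by blast
qed

lemma powi_unit: "P \<in> places \<iota> F \<Longrightarrow> u \<in> loc P - P \<Longrightarrow> u powi k \<in> loc P - P"
  using unit_power[of P u] unit_inverse[of P] unit_power[of P "inverse u"]
  by (auto simp: power_int_def)

lemma factor_out_power:
  assumes P: "P \<in> places \<iota> F" and t: "t \<noteq> 0" "P = (\<lambda>w. t * w) ` loc P"
    and w: "w \<in> loc P" "w / t ^ k \<notin> loc P"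
  shows "\<exists>e u. u \<in> loc P - P \<and> w = t ^ e * u"
  using w(2)
proof (induction k)
  case (Suc k)
  show ?case
  proof (cases "w / t ^ k \<in> loc P")
    case True
    have "w / t ^ k \<notin> P"
    proof
      assume "w / t ^ k \<in> P"
      then obtain v where v: "v \<in> loc P" "w / t ^ k = t * v" using t(2) by blast
      then have "v = w / t ^ Suc k" using t(1) by (auto simp: field_simps)
      then show False using Suc.prems v by simp
    qed
    then show ?thesis using True t(1) by (intro exI[of _ k] exI[of _ "w / t ^ k"]) auto
  qed (use Suc.IH in blast)
qed (use w(1) in simp)

lemma poly_factor_power: "p \<noteq> 0 \<Longrightarrow> \<exists>j p'. p = monom 1 j * p' \<and> coeff p' 0 \<noteq> (0::'q)"
proof (induction p)
  case (pCons a p)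
  show ?case
  proof (cases "a = 0")
    case True
    then obtain j p' where jp: "p = monom 1 j * p'" "coeff p' 0 \<noteq> 0" using pCons by auto
    have "pCons a p = monom 1 (Suc j) * p'" by (simp add: True jp(1) monom_Suc)
    then show ?thesis using jp by blast
  next
    case False
    then show ?thesis by (intro exI[of _ 0] exI[of _ "pCons a p"]) (simp add: monom_0 one_pCons[symmetric])
  qed
qed simp

lemma ev_unit:
  assumes P: "P \<in> places \<iota> F" and z: "z \<in> P" and p: "coeff p 0 \<noteq> 0"
  shows "ev p z \<in> loc P - P"
proof -
  obtain a r where ar: "p = pCons a r" by (cases p)
  then have "\<iota> a \<in> loc P - P" using p place_iota[OF P] loc_iota[OF P] by auto
  moreover have "z * ev r z \<in> P"
    using z place_subset_loc[OF P] loc_ev[OF P, of z r] place_mult[OF P, of "ev r z" z] by (auto simp: mult.commute)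
  ultimately show ?thesis using unit_plus_place[OF P] ar by auto
qed

text \<open>
  In a linear relation between the powers of a generator \<open>t\<close> of \<open>P\<close> with coefficients in \<open>K[z]\<close>,
  the first unit coefficient would be divisible by \<open>t\<close> if \<open>z\<close> was divisible by every power of \<open>t\<close>.
\<close>

lemma generator_power_not_dividing:
  assumes P: "P \<in> places \<iota> F" and t: "t \<noteq> 0" "P = (\<lambda>w. t * w) ` loc P"
    and z: "z \<in> P" "z \<noteq> 0" and deg: "degree_over_le z M"
  shows "\<exists>k. z / t ^ k \<notin> loc P"
proof (rule ccontr)
  assume "\<nexists>k. z / t ^ k \<notin> loc P"
  then have zt: "z / t ^ k \<in> loc P" for k by blast
  have tP: "t \<in> P" using loc_1[OF P] by (subst t(2)) (auto intro!: image_eqI[of _ _ 1])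
  have tloc: "t \<in> loc P" using tP place_subset_loc[OF P] by auto
  have "t \<in> F" using tloc loc_subset_F[OF P] by auto
  then have "\<forall>i\<le>M. t ^ i \<in> F" by auto
  then obtain c where c: "\<exists>i\<le>M. c i \<noteq> 0" "(\<Sum>i\<le>M. ev (c i) z * t ^ i) = 0"
    using deg[unfolded degree_over_le_def, rule_format, of "\<lambda>i. t ^ i"] by blast
  then obtain i0 where i0: "i0 \<in> {..M}" "c i0 \<noteq> 0" by auto
  obtain c' where c': "\<exists>i\<in>{..M}. coeff (c' i) 0 \<noteq> 0" "(\<Sum>i\<le>M. ev (c' i) z * t ^ i) = 0"
    using primitive_relation[OF z(2) finite_atMost i0 c(2)] by blast
  define l where "l = (LEAST i. coeff (c' i) 0 \<noteq> 0)"
  obtain i1 where i1: "i1 \<le> M" "coeff (c' i1) 0 \<noteq> 0" using c' by auto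
  have l: "coeff (c' l) 0 \<noteq> 0" unfolding l_def by (rule LeastI) (rule i1(2))
  have l_min: "coeff (c' i) 0 = 0" if "i < l" for i
    using not_less_Least[of i "\<lambda>i. coeff (c' i) 0 \<noteq> 0"] that unfolding l_def by blast
  have l_le: "l \<le> M"
    using Least_le[of "\<lambda>i. coeff (c' i) 0 \<noteq> 0" i1] i1 unfolding l_def by linarith
  have zloc: "z \<in> loc P" using z place_subset_loc[OF P] by auto
  have summand: "ev (c' i) z * t ^ i / t ^ l \<in> P" if "i \<noteq> l" for i
  proof (cases "i < l")
    case True
    obtain a r where ar: "c' i = pCons a r" by (cases "c' i")
    then have a: "a = 0" using l_min[OF True] by simp
    have "ev (c' i) z * t ^ i / t ^ l = (ev r z * t ^ i * (z / t ^ Suc l)) * t"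
      using t(1) by (simp add: ar a field_simps)
    also have "\<dots> \<in> P"
      by (intro place_mult[OF P _ tP] loc_mult[OF P] loc_ev[OF P] loc_power[OF P] zloc zt tloc)
    finally show ?thesis .
  next
    case False
    then obtain j where j: "i = l + Suc j" using \<open>i \<noteq> l\<close> by (metis less_imp_Suc_add linorder_neqE_nat add_Suc_right)
    have "ev (c' i) z * t ^ i / t ^ l = (ev (c' i) z * t ^ j) * t"
      using t(1) by (simp add: j power_add field_simps)
    also have "\<dots> \<in> P"
      by (intro place_mult[OF P _ tP] loc_mult[OF P] loc_ev[OF P] loc_power[OF P] zloc tloc)
    finally show ?thesis .
  qed
  have "0 = (\<Sum>i\<le>M. ev (c' i) z * t ^ i) / t ^ l" using c' by simp
  also have "\<dots> = (\<Sum>i\<le>M. ev (c' i) z * t ^ i / t ^ l)" by (simp add: sum_divide_distrib)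
  also have "\<dots> = ev (c' l) z * t ^ l / t ^ l + (\<Sum>i\<in>{..M} - {l}. ev (c' i) z * t ^ i / t ^ l)"
    using l_le by (subst sum.remove[of _ l]) auto
  finally have "ev (c' l) z = - (\<Sum>i\<in>{..M} - {l}. ev (c' i) z * t ^ i / t ^ l)"
    using t(1) by (simp add: eq_neg_iff_add_eq_0)
  also have "\<dots> \<in> P" by (intro place_minus[OF P] place_sum[OF P] summand) auto
  finally show False using ev_unit[OF P z(1) l] by blast
qed

text \<open>
  It remains to exclude a nonzero \<open>w\<close> divisible by all powers of the generator \<open>t\<close>.  Being algebraic
  over \<open>K(z)\<close>, such a \<open>w\<close> divides a nonzero polynomial in \<open>z\<close>, which is a power of \<open>t\<close> up to a unit.
\<close>

lemma discrete_placeI: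
  assumes P: "P \<in> places \<iota> F" and z: "z \<in> P" "z \<noteq> 0" and deg: "degree_over_le z M"
  shows "discrete_place P"
proof -
  obtain t where t: "t \<noteq> 0" "P = (\<lambda>w. t * w) ` loc P" using place_principal[OF assms] by blast
  have zloc: "z \<in> loc P" using z place_subset_loc[OF P] by auto
  obtain k where "z / t ^ k \<notin> loc P" using generator_power_not_dividing[OF P t z deg] by blast
  then obtain e u where e: "u \<in> loc P - P" "z = t ^ e * u"
    using factor_out_power[OF P t zloc] by blast
  have tP: "t \<in> P" using loc_1[OF P] by (subst t(2)) (auto intro!: image_eqI[of _ _ 1])
  have *: "\<exists>k. w / t ^ k \<notin> loc P" if w: "w \<in> loc P" "w \<noteq> 0" for w
  proof (rule ccontr)
    assume "\<nexists>k. w / t ^ k \<notin> loc P"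
    then have wt: "w / t ^ k \<in> loc P" for k by blast
    have "w \<in> F" using w loc_subset_F[OF P] by auto
    then obtain p r where p: "p \<noteq> 0" "ev p z = w * (\<Sum>i\<le>M. ev (r i) z * w ^ i)"
      using powers_relation[OF deg _ w(2)] by blast
    obtain j p' where j: "p = monom 1 j * p'" "coeff p' 0 \<noteq> 0" using poly_factor_power[OF p(1)] by blast
    define v where "v = u ^ j * ev p' z"
    have v: "v \<in> loc P - P" unfolding v_def
      by (intro unit_mult[OF P] unit_power[OF P] e ev_unit[OF P z(1) j(2)])
    have "ev p z = t ^ (e * j) * v"
      by (simp add: j(1) v_def) (simp add: e(2) power_mult_distrib power_mult)
    then have "v = ((\<Sum>i\<le>M. ev (r i) z * w ^ i) * (w / t ^ Suc (e * j))) * t"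
      using p(2) t(1) by (simp add: field_simps)
    also have "\<dots> \<in> P"
      by (intro place_mult[OF P _ tP] loc_mult[OF P] loc_sum[OF P] loc_ev[OF P] loc_power[OF P] zloc wt w)
    finally show False using v by blast
  qed
  have "\<exists>k u. u \<in> loc P - P \<and> w = t powi k * u" if w: "w \<in> F" "w \<noteq> 0" for w
  proof (cases "w \<in> loc P")
    case True
    then obtain k where "w / t ^ k \<notin> loc P" using * w by blast
    then obtain e u where "u \<in> loc P - P" "w = t ^ e * u" using factor_out_power[OF P t True] by blast
    then show ?thesis by (intro exI[of _ "int e"] exI[of _ u]) auto
  next
    case False
    then have iw: "inverse w \<in> loc P" using in_loc_or_inverse[OF P w(1)] place_subset_loc[OF P] by blast
    then obtain k where "inverse w / t ^ k \<notin> loc P" using * w by force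
    then obtain e u where e: "u \<in> loc P - P" "inverse w = t ^ e * u" using factor_out_power[OF P t iw] by blast
    have "w = inverse (t ^ e * u)" using e(2) by (metis inverse_inverse_eq)
    then have "w = t powi (- int e) * inverse u" by (simp add: power_int_minus)
    then show ?thesis using unit_inverse[OF P, of u] e(1) by blast
  qed
  then show ?thesis unfolding discrete_place_def using P t by blast
qed

subsection \<open>The valuation of a discrete place\<close>

text \<open>
  Two generators of \<open>P\<close> differ by a unit, and no nonzero power of a generator is a unit.
\<close>

lemma val_eqI:
  assumes P: "P \<in> places \<iota> F" and t: "P = (\<lambda>w. t * w) ` loc P" and u: "u \<in> loc P - P"
    and z: "z = t powi k * u"
  shows "val F P z = k"
  unfolding val_def
proof (rule the_equality)
  show "\<exists>t u. P = (\<lambda>w. t * w) ` local_ring F P \<and> u \<in> local_ring F P - P \<and> z = t powi k * u"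
    by (intro exI conjI) (rule t, rule u, rule z)
  fix k' assume "\<exists>t u. P = (\<lambda>w. t * w) ` local_ring F P \<and> u \<in> local_ring F P - P \<and> z = t powi k' * u"
  then obtain t' u' where *: "P = (\<lambda>w. t' * w) ` loc P" "u' \<in> loc P - P" "z = t' powi k' * u'" by blast
  have gen: "s \<in> P \<and> s \<noteq> 0" if "P = (\<lambda>w. s * w) ` loc P" for s
  proof
    show "s \<in> P" using loc_1[OF P] by (subst that) (auto intro!: image_eqI[of _ _ 1])
    show "s \<noteq> 0" using that place_nontrivial[OF P] by auto
  qed
  obtain a where a: "t' = t * a" "a \<in> loc P" using gen[OF *(1)] t by blast
  obtain b where b: "t = t' * b" "b \<in> loc P" using gen[OF t] *(1) by blast
  have nz: "t \<noteq> 0" "t' \<noteq> 0" using gen t * by auto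
  have tP: "t \<in> P" using gen[OF t] by simp
  have "t * (a * b) = t" using a(1) b(1) by (metis mult.assoc)
  then have "a * b = 1" using nz by simp
  then have "inverse a = b" by (rule inverse_unique)
  then have aU: "a \<in> loc P - P" using a b place_iff[OF P, of a] nz by auto
  define v where "v = a powi k' * u' * inverse u"
  have vU: "v \<in> loc P - P"
    unfolding v_def by (intro unit_mult[OF P] powi_unit[OF P] aU * unit_inverse[OF P]) (use u in auto)
  have "t powi k * u = t powi k' * a powi k' * u'"
    using z *(3) by (simp add: a(1) power_int_mult_distrib)
  moreover have "u \<noteq> 0" using u place_0[OF P] by auto
  ultimately have eq: "t powi k = t powi k' * v" unfolding v_def by (simp add: field_simps)
  have eq1: "t powi (k - k') = v" using eq nz by (simp add: power_int_diff field_simps)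
  have eq2: "t powi (k' - k) = inverse v" using eq nz by (simp add: power_int_diff field_simps)
  have npos: "\<not> t powi i \<in> loc P - P" if "i > 0" for i
  proof -
    define m where "m = nat i - 1"
    have m: "i = int (Suc m)" using that by (simp add: m_def)
    have "t \<in> loc P" using tP place_subset_loc[OF P] by blast
    then have "t ^ m * t \<in> P" using place_mult[OF P loc_power[OF P] tP] by blast
    then show ?thesis by (simp add: m power_int_def nat_add_distrib mult.commute)
  qed
  have "inverse v \<in> loc P - P" using vU unit_inverse[OF P] by blast
  then have "\<not> k' - k > 0" using npos[of "k' - k"] unfolding eq2 by blast
  moreover have "\<not> k - k' > 0" using npos[of "k - k'"] vU unfolding eq1 by blast
  ultimately show "k' = k" by simp
qed

context
  fixes P assumes discrete: "discrete_place P"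
begin

lemma discrete_place_is_place: "P \<in> places \<iota> F"
  using discrete by (simp add: discrete_place_def)

lemmas P_place = discrete_place_is_place

lemma val_decomposition:
  "\<exists>t. t \<in> P \<and> t \<noteq> 0 \<and> P = (\<lambda>w. t * w) ` loc P \<and>
    (\<forall>z\<in>F. z \<noteq> 0 \<longrightarrow> (\<exists>u. u \<in> loc P - P \<and> z = t powi (val F P z) * u))"
proof -
  obtain t where t: "t \<noteq> 0" "P = (\<lambda>w. t * w) ` loc P"
    "\<forall>z\<in>F. z \<noteq> 0 \<longrightarrow> (\<exists>k u. u \<in> loc P - P \<and> z = t powi k * u)"
    using discrete unfolding discrete_place_def by blast
  have "t \<in> P" using loc_1[OF P_place] by (subst t(2)) (auto intro!: image_eqI[of _ _ 1])
  moreover have "\<exists>u. u \<in> loc P - P \<and> z = t powi (val F P z) * u" if z: "z \<in> F" "z \<noteq> 0" for z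
  proof -
    obtain k u where ku: "u \<in> loc P - P" "z = t powi k * u" using t(3) z by blast
    then have "val F P z = k" by (rule val_eqI[OF P_place t(2)])
    then show ?thesis using ku by blast
  qed
  ultimately show ?thesis using t by blast
qed

lemma val_mult [simp]:
  assumes "z \<in> F" "w \<in> F" "z \<noteq> 0" "w \<noteq> 0"
  shows "val F P (z * w) = val F P z + val F P w"
proof -
  obtain t where t: "t \<noteq> 0" "P = (\<lambda>w. t * w) ` loc P"
    "\<forall>z\<in>F. z \<noteq> 0 \<longrightarrow> (\<exists>u. u \<in> loc P - P \<and> z = t powi (val F P z) * u)"
    using val_decomposition by blast
  obtain u1 where u1: "u1 \<in> loc P - P" "z = t powi (val F P z) * u1" using t(3) assms by blast
  obtain u2 where u2: "u2 \<in> loc P - P" "w = t powi (val F P w) * u2" using t(3) assms by blast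
  show ?thesis
  proof (rule val_eqI[OF P_place t(2)])
    show "u1 * u2 \<in> loc P - P" using u1 u2 unit_mult[OF P_place] by blast
    have "z * w = (t powi (val F P z) * u1) * (t powi (val F P w) * u2)" using u1 u2 by simp
    then show "z * w = t powi (val F P z + val F P w) * (u1 * u2)"
      using t(1) by (simp add: power_int_add mult_ac)
  qed
qed

lemma val_unit: "u \<in> loc P - P \<Longrightarrow> val F P u = 0"
proof -
  assume u: "u \<in> loc P - P"
  obtain t where "P = (\<lambda>w. t * w) ` loc P" using val_decomposition by blast
  then show ?thesis by (rule val_eqI[OF P_place _ u]) simp
qed

lemma uniformizer: "\<exists>t. t \<in> F \<and> t \<noteq> 0 \<and> val F P t = 1"
proof -
  obtain t where t: "t \<in> P" "t \<noteq> 0" "P = (\<lambda>w. t * w) ` loc P" using val_decomposition by blast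
  have "val F P t = 1"
    by (rule val_eqI[OF P_place t(3), where u = 1]) (use loc_1[OF P_place] place_1[OF P_place] in auto)
  moreover have "t \<in> F" using t(1) place_subset_loc[OF P_place] loc_subset_F[OF P_place] by blast
  ultimately show ?thesis using t(2) by blast
qed

lemma val_1 [simp]: "val F P 1 = 0"
  by (rule val_unit) (use loc_1[OF P_place] place_1[OF P_place] in auto)

lemma val_inverse [simp]: "z \<in> F \<Longrightarrow> z \<noteq> 0 \<Longrightarrow> val F P (inverse z) = - val F P z"
  using val_mult[of z "inverse z"] by (simp add: is_subfieldD[OF F_subfield])

lemma val_divide [simp]:
  "z \<in> F \<Longrightarrow> w \<in> F \<Longrightarrow> z \<noteq> 0 \<Longrightarrow> w \<noteq> 0 \<Longrightarrow> val F P (z / w) = val F P z - val F P w"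
  using val_mult[of z "inverse w"] by (simp add: divide_inverse)

lemma val_power [simp]: "z \<in> F \<Longrightarrow> z \<noteq> 0 \<Longrightarrow> val F P (z ^ k) = int k * val F P z"
  by (induction k) (auto simp: algebra_simps)

lemma val_powi [simp]: "z \<in> F \<Longrightarrow> z \<noteq> 0 \<Longrightarrow> val F P (z powi k) = k * val F P z"
  by (auto simp: power_int_def)

lemma val_prod:
  "finite I \<Longrightarrow> (\<And>i. i \<in> I \<Longrightarrow> f i \<in> F \<and> f i \<noteq> 0) \<Longrightarrow> val F P (prod f I) = (\<Sum>i\<in>I. val F P (f i))"
proof (induction I rule: finite_induct)
  case (insert i I)
  have "prod f I \<in> F" using insert by (intro is_subfield_prod[OF F_subfield]) auto
  moreover have "prod f I \<noteq> 0" using insert by auto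
  ultimately show ?case using insert by auto
qed simp

lemma place_iff_val: assumes "z \<in> F" "z \<noteq> 0" shows "z \<in> P \<longleftrightarrow> 0 < val F P z"
proof -
  obtain t where t: "t \<in> P" "t \<noteq> 0"
    "\<forall>z\<in>F. z \<noteq> 0 \<longrightarrow> (\<exists>u. u \<in> loc P - P \<and> z = t powi (val F P z) * u)"
    using val_decomposition by blast
  have pos: "z \<in> P" if z: "z \<in> F" "z \<noteq> 0" "0 < val F P z" for z
  proof -
    obtain u where u: "u \<in> loc P - P" "z = t powi (val F P z) * u" using t(3) z by blast
    define m where "m = nat (val F P z) - 1"
    have m: "val F P z = int (Suc m)" using z(3) by (simp add: m_def)
    have "t \<in> loc P" using t(1) place_subset_loc[OF P_place] by blast
    then have "(t ^ m * u) * t \<in> P"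
      using u(1) by (intro place_mult[OF P_place _ t(1)] loc_mult[OF P_place] loc_power[OF P_place]) auto
    then show ?thesis using u(2) by (simp add: m power_int_def nat_add_distrib mult_ac)
  qed
  show ?thesis
  proof
    assume z: "z \<in> P"
    show "0 < val F P z"
    proof (rule ccontr)
      assume "\<not> 0 < val F P z"
      then consider "val F P z = 0" | "0 < val F P (inverse z)" using assms by fastforce
      then show False
      proof cases
        case 1
        then obtain u where "u \<in> loc P - P" "z = t powi 0 * u" using t(3) assms by metis
          then show False using z by simp
      next
        case 2
        then have "inverse z \<in> P" using pos[of "inverse z"] assms by auto
        then have "inverse z * z \<in> P" using place_mult[OF P_place] z place_subset_loc[OF P_place] by blast
        then show False using assms place_1[OF P_place] by simp
      qed
    qed
  qed (use pos assms in blast)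
qed

lemma loc_iff_val: assumes "z \<in> F" "z \<noteq> 0" shows "z \<in> loc P \<longleftrightarrow> 0 \<le> val F P z"
proof -
  have "z \<in> loc P \<longleftrightarrow> inverse z \<notin> P" using assms by (auto simp: local_ring_def)
  then show ?thesis using place_iff_val[of "inverse z"] assms by auto
qed

end

text \<open>
  The fractional ideal \<open>P\<^sup>k\<close>.  It contains 0, at which \<^const>\<open>val\<close> has an unspecified value.
\<close>

definition val_ge :: "'a set \<Rightarrow> int \<Rightarrow> 'a set" where
  "val_ge P k = {z \<in> F. z = 0 \<or> k \<le> val F P z}"

context
  fixes P assumes discrete: "discrete_place P"
begin

lemma loc_eq_val_ge: "loc P = val_ge P 0"
  using loc_iff_val[OF discrete] loc_0[OF P_place[OF discrete]] loc_subset_F[OF P_place[OF discrete]]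
  by (auto simp: val_ge_def)

lemma place_eq_val_ge: "P = val_ge P 1"
proof -
  have PF: "P \<subseteq> F" using place_subset_loc[OF P_place[OF discrete]] loc_subset_F[OF P_place[OF discrete]] by blast
  have "z \<in> P \<longleftrightarrow> z \<in> val_ge P 1" for z
  proof (cases "z \<in> F \<and> z \<noteq> 0")
    case True
    then show ?thesis using place_iff_val[OF discrete, of z] by (auto simp: val_ge_def)
  next
    case False
    then show ?thesis using PF place_0[OF P_place[OF discrete]] by (auto simp: val_ge_def)
  qed
  then show ?thesis by (rule set_eqI)
qed

lemma val_ge_mult: "z \<in> val_ge P k \<Longrightarrow> w \<in> val_ge P l \<Longrightarrow> z * w \<in> val_ge P (k + l)"
  using val_mult[OF discrete, of z w] by (cases "z = 0 \<or> w = 0") (auto simp: val_ge_def)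

lemma val_ge_mult_iff:
  assumes "t \<in> F" "t \<noteq> 0"
  shows "t * z \<in> val_ge P (k + val F P t) \<longleftrightarrow> z \<in> val_ge P k"
proof
  assume *: "t * z \<in> val_ge P (k + val F P t)"
  have "inverse t \<in> val_ge P (- val F P t)" using assms discrete by (auto simp: val_ge_def)
  from val_ge_mult[OF this *] show "z \<in> val_ge P k" using assms by (simp add: mult.assoc[symmetric])
next
  assume *: "z \<in> val_ge P k"
  have "t \<in> val_ge P (val F P t)" using assms by (auto simp: val_ge_def)
  from val_ge_mult[OF this *] show "t * z \<in> val_ge P (k + val F P t)" by (simp add: add.commute)
qed

lemma val_ge_add: assumes "z \<in> val_ge P k" "w \<in> val_ge P k" shows "z + w \<in> val_ge P k"
proof -
  obtain t where t: "t \<in> F" "t \<noteq> 0" "val F P t = 1" using uniformizer[OF discrete] by blast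
  define s where "s = t powi (- k)"
  have s: "s \<in> F" "s \<noteq> 0" "val F P s = - k" using t discrete by (auto simp: s_def)
  have *: "s * v \<in> loc P \<longleftrightarrow> v \<in> val_ge P k" for v
    using val_ge_mult_iff[OF s(1,2), of v k] s(3) by (simp add: loc_eq_val_ge)
  have "s * z + s * w \<in> loc P"
    using assms by (intro loc_add[OF P_place[OF discrete]]) (simp_all add: *)
  then show ?thesis using *[of "z + w"] by (simp add: distrib_left)
qed

lemma val_ge_0 [simp]: "0 \<in> val_ge P k" by (auto simp: val_ge_def)

lemma val_ge_sum: "(\<And>i. i \<in> I \<Longrightarrow> f i \<in> val_ge P k) \<Longrightarrow> sum f I \<in> val_ge P k"
  by (induction I rule: infinite_finite_induct) (auto intro: val_ge_add)

lemma val_ge_iota: "z \<in> val_ge P k \<Longrightarrow> \<iota> c * z \<in> val_ge P k"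
  using val_ge_mult[of "\<iota> c" 0 z k] loc_iota[OF P_place[OF discrete], of c] by (simp add: loc_eq_val_ge)

lemma val_ge_minus: "z \<in> val_ge P k \<Longrightarrow> - z \<in> val_ge P k"
  using val_ge_iota[of z k "-1"] by simp

lemma val_ge_diff: "z \<in> val_ge P k \<Longrightarrow> w \<in> val_ge P k \<Longrightarrow> z - w \<in> val_ge P k"
  using val_ge_add[of z k "- w"] val_ge_minus by simp

lemma val_ge_mono: "z \<in> val_ge P k \<Longrightarrow> l \<le> k \<Longrightarrow> z \<in> val_ge P l"
  by (auto simp: val_ge_def)

lemma val_add_eq:
  assumes "z \<in> F" "z \<noteq> 0" "w \<in> val_ge P (val F P z + 1)"
  shows "z + w \<noteq> 0" "val F P (z + w) = val F P z"
proof -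
  have w: "w \<in> val_ge P (val F P z)" using assms(3) by (rule val_ge_mono) simp
  have n: "z \<notin> val_ge P (val F P z + 1)" using assms by (simp add: val_ge_def)
  have zw: "z + w \<notin> val_ge P (val F P z + 1)"
  proof
    assume "z + w \<in> val_ge P (val F P z + 1)"
    from val_ge_diff[OF this assms(3)] show False using n by simp
  qed
  then show "z + w \<noteq> 0" by auto
  have "z + w \<in> val_ge P (val F P z)" using assms w by (intro val_ge_add) (auto simp: val_ge_def)
  then show "val F P (z + w) = val F P z" using zw \<open>z + w \<noteq> 0\<close> by (auto simp: val_ge_def)
qed

text \<open>
  When the valuations of the nonzero terms differ, the term of least valuation dominates.
\<close>

lemma val_sum_ge_iff_distinct:
  assumes J: "finite J" and f: "\<And>j. j \<in> J \<Longrightarrow> f j \<in> F"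
    and inj: "\<And>i j. i \<in> J \<Longrightarrow> j \<in> J \<Longrightarrow> i \<noteq> j \<Longrightarrow> f i \<noteq> 0 \<Longrightarrow> f j \<noteq> 0 \<Longrightarrow> val F P (f i) \<noteq> val F P (f j)"
  shows "sum f J \<in> val_ge P k \<longleftrightarrow> (\<forall>j\<in>J. f j \<in> val_ge P k)"
    and "sum f J = 0 \<longleftrightarrow> (\<forall>j\<in>J. f j = 0)"
    and "sum f J \<noteq> 0 \<Longrightarrow> \<exists>j\<in>J. f j \<noteq> 0 \<and> val F P (sum f J) = val F P (f j)"
proof -
  define J' where "J' = {j \<in> J. f j \<noteq> 0}"
  have sumJ': "sum f J = sum f J'" unfolding J'_def by (rule sum.mono_neutral_right) (use J in auto)
  have main: "\<exists>j\<in>J'. sum f J \<noteq> 0 \<and> val F P (sum f J) = val F P (f j) \<and>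
      (\<forall>i\<in>J'. val F P (f j) \<le> val F P (f i))" if ne: "J' \<noteq> {}"
  proof -
    have fin: "finite J'" using J by (simp add: J'_def)
    obtain j where j: "j \<in> J'" "\<forall>i\<in>J'. val F P (f j) \<le> val F P (f i)"
      using ex_min_if_finite[of "(\<lambda>j. val F P (f j)) ` J'"] fin ne by (metis (mono_tags, lifting)
        arg_min_if_finite(1) arg_min_least)
    have "f i \<in> val_ge P (val F P (f j) + 1)" if "i \<in> J' - {j}" for i
      using that j inj[of i j] f by (fastforce simp: J'_def val_ge_def)
    then have "sum f (J' - {j}) \<in> val_ge P (val F P (f j) + 1)" by (rule val_ge_sum)
    moreover have "sum f J = f j + sum f (J' - {j})" unfolding sumJ' by (rule sum.remove[OF fin j(1)])
    moreover have "f j \<in> F" "f j \<noteq> 0" using j f by (auto simp: J'_def)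
    ultimately show ?thesis using val_add_eq[of "f j" "sum f (J' - {j})"] j by (intro bexI[of _ j]) simp_all
  qed
  show 0: "sum f J = 0 \<longleftrightarrow> (\<forall>j\<in>J. f j = 0)" using main unfolding J'_def by fastforce
  show "sum f J \<noteq> 0 \<Longrightarrow> \<exists>j\<in>J. f j \<noteq> 0 \<and> val F P (sum f J) = val F P (f j)"
    using main unfolding J'_def by fastforce
  show "sum f J \<in> val_ge P k \<longleftrightarrow> (\<forall>j\<in>J. f j \<in> val_ge P k)"
  proof
    assume s: "sum f J \<in> val_ge P k"
    show "\<forall>j\<in>J. f j \<in> val_ge P k"
    proof (cases "J' = {}")
      case False
      then obtain j where "j \<in> J'" "sum f J \<noteq> 0" "val F P (sum f J) = val F P (f j)"
        "\<forall>i\<in>J'. val F P (f j) \<le> val F P (f i)" using main by blast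
      then show ?thesis using s f by (force simp: val_ge_def J'_def)
    qed (auto simp: J'_def)
  qed (auto intro: val_ge_sum)
qed

end

end

section \<open>Function fields of one variable\<close>

context constant_field begin

text \<open>
  Membership in the \<open>K(x)\<close>-span of the \<open>b\<^sub>j\<close>; denominators are cleared, so that linear algebra over the
  constant field applies to the coefficients of the polynomials.
\<close>

definition spanned :: "'a \<Rightarrow> (nat \<Rightarrow> 'a) \<Rightarrow> nat \<Rightarrow> 'a \<Rightarrow> bool" where
  "spanned x b m w \<longleftrightarrow> (\<exists>q u. q \<noteq> 0 \<and> ev q x * w = (\<Sum>j<m. ev (u j) x * b j))"

lemma transcendental_ev_eq_0: "transcendental_over \<iota> x \<Longrightarrow> ev p x = 0 \<longleftrightarrow> p = 0"
  by (cases "p = 0") (simp_all add: transcendental_over_def)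

text \<open>
  The relation \<open>\<Sum>\<^sub>i c\<^sub>i(p(x)) w\<^sub>i = 0\<close> with \<open>deg c\<^sub>i \<le> L\<close> is a homogeneous linear system over the
  constant field: the number of unknown coefficients of the \<open>c\<^sub>i\<close> grows like \<open>(m deg p + 1) L\<close>,
  the number of equations only like \<open>m deg p L\<close>.
\<close>

lemma spanned_relation:
  fixes w :: "nat \<Rightarrow> 'a"
  assumes x: "transcendental_over \<iota> x" and w: "\<And>i. i \<le> M \<Longrightarrow> spanned x b m (w i)"
    and M: "M = m * degree p"
  shows "\<exists>c. (\<exists>i\<le>M. c i \<noteq> 0) \<and> (\<Sum>i\<le>M. ev (c i) (ev p x) * w i) = 0"
proof -
  define d where "d = degree p"
  have "\<forall>i\<in>{..M}. \<exists>q u. q \<noteq> 0 \<and> ev q x * w i = (\<Sum>j<m. ev (u j) x * b j)"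
    using w by (auto simp: spanned_def)
  then obtain q u where qu: "\<And>i. i \<le> M \<Longrightarrow> q i \<noteq> 0"
    "\<And>i. i \<le> M \<Longrightarrow> ev (q i) x * w i = (\<Sum>j<m. ev (u i j) x * b j)"
    by (metis atMost_iff)
  define Q where "Q = (\<Prod>i\<le>M. q i)"
  have Q: "ev Q x \<noteq> 0" unfolding transcendental_ev_eq_0[OF x] Q_def using qu(1) by simp
  define U where "U = (\<lambda>i j. (\<Prod>k\<in>{..M} - {i}. q k) * u i j)"
  have QU: "ev Q x * w i = (\<Sum>j<m. ev (U i j) x * b j)" if "i \<le> M" for i
  proof -
    have "Q = (\<Prod>k\<in>{..M} - {i}. q k) * q i"
      unfolding Q_def using that by (subst prod.remove[of _ i]) (auto simp: mult.commute)
    then have "ev Q x * w i = ev (\<Prod>k\<in>{..M} - {i}. q k) x * (ev (q i) x * w i)"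
      by (simp add: mult_ac)
    also have "\<dots> = (\<Sum>j<m. ev (U i j) x * b j)"
      unfolding qu(2)[OF that] U_def by (simp add: sum_distrib_left mult_ac)
    finally show ?thesis .
  qed
  define B where "B = (\<Sum>i\<le>M. \<Sum>j<m. degree (U i j))"
  have degU: "degree (U i j) \<le> B" if "i \<le> M" "j < m" for i j
  proof -
    have "degree (U i j) \<le> (\<Sum>j<m. degree (U i j))" using that by (intro member_le_sum) auto
    also have "\<dots> \<le> B" unfolding B_def using that
      by (intro member_le_sum[where f = "\<lambda>i. \<Sum>j<m. degree (U i j)"]) auto
    finally show ?thesis .
  qed
  \<comment> \<open>large enough for \<open>m (B + d L + 1) < (m d + 1) (L + 1)\<close>, the excess of unknowns over equations\<close>
  define L where "L = m * (B + 1)"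
  define I where "I = {..<m} \<times> {..B + d * L}"
  define J where "J = {..M} \<times> {..L}"
  have "card I = m * (B + d * L + 1)" by (simp add: I_def)
  also have "\<dots> = m * (B + 1) + m * d * L" by (simp add: algebra_simps)
  also have "\<dots> < m * d * L + m * d + L + 1" by (simp add: L_def)
  also have "\<dots> = card J" by (simp add: J_def M d_def algebra_simps)
  finally have less: "card I < card J" .
  define A where "A = (\<lambda>(j, l) (i, k). coeff (p ^ k * U i j) l)"
  have U: "is_subfield (UNIV :: 'q set)" by (simp add: is_subfield_def)
  have "finite I" "finite J" by (simp_all add: I_def J_def)
  from homogeneous_system_nontrivial[OF U this less, of A]
  obtain c where c: "\<exists>s\<in>J. c s \<noteq> 0" "\<forall>r\<in>I. (\<Sum>s\<in>J. A r s * c s) = 0" by auto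
  define e where "e = (\<lambda>i. \<Sum>k\<le>L. monom (c (i, k)) k)"
  have coeff_e: "coeff (e i) k = (if k \<le> L then c (i, k) else 0)" for i k
    by (auto simp: e_def coeff_sum)
  have e_nz: "\<exists>i\<le>M. e i \<noteq> 0"
  proof -
    obtain i k where "i \<le> M" "k \<le> L" "c (i, k) \<noteq> 0" using c(1) by (auto simp: J_def)
    then have "coeff (e i) k \<noteq> 0" by (simp add: coeff_e)
    then show ?thesis using \<open>i \<le> M\<close> by force
  qed
  have zero: "(\<Sum>(i, k)\<in>J. smult (c (i, k)) (p ^ k * U i j)) = 0" if "j < m" for j
  proof (rule poly_eqI)
    fix l
    have "coeff (\<Sum>(i, k)\<in>J. smult (c (i, k)) (p ^ k * U i j)) l
        = (\<Sum>s\<in>J. A (j, l) s * c s)"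
      by (simp add: coeff_sum A_def case_prod_beta mult.commute)
    also have "\<dots> = 0"
    proof (cases "l \<le> B + d * L")
      case True
      then show ?thesis using c(2) that by (auto simp: I_def)
    next
      case False
      have "A (j, l) (i, k) = 0" if "i \<le> M" "k \<le> L" for i k
      proof -
        have "degree (p ^ k * U i j) \<le> degree (p ^ k) + degree (U i j)" by (rule degree_mult_le)
        also have "\<dots> \<le> d * k + B"
          using degree_power_le[of p k] degU[OF that(1) \<open>j < m\<close>] by (simp add: d_def)
        also have "\<dots> \<le> d * L + B" using that(2) by simp
        finally show ?thesis using False by (auto simp: A_def intro!: coeff_eq_0)
      qed
      then show ?thesis by (intro sum.neutral) (auto simp: J_def)
    qed
    finally show "coeff (\<Sum>(i, k)\<in>J. smult (c (i, k)) (p ^ k * U i j)) l = coeff 0 l" by simp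
  qed
  have "ev Q x * (\<Sum>i\<le>M. ev (e i) (ev p x) * w i) = (\<Sum>i\<le>M. ev (e i) (ev p x) * (ev Q x * w i))"
    by (simp add: sum_distrib_left mult_ac)
  also have "\<dots> = (\<Sum>i\<le>M. ev (e i) (ev p x) * (\<Sum>j<m. ev (U i j) x * b j))"
    by (intro sum.cong) (auto simp: QU)
  also have "\<dots> = (\<Sum>i\<le>M. \<Sum>k\<le>L. \<Sum>j<m. \<iota> (c (i, k)) * ev p x ^ k * ev (U i j) x * b j)"
    by (simp add: e_def ev_sum sum_distrib_left sum_distrib_right mult_ac sum.swap[of _ "{..<m}"])
  also have "\<dots> = (\<Sum>(i, k)\<in>J. \<Sum>j<m. \<iota> (c (i, k)) * ev p x ^ k * ev (U i j) x * b j)"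
    unfolding J_def by (rule sum.cartesian_product)
  also have "\<dots> = (\<Sum>j<m. (\<Sum>(i, k)\<in>J. \<iota> (c (i, k)) * ev p x ^ k * ev (U i j) x) * b j)"
    unfolding case_prod_beta by (subst sum.swap) (simp add: sum_distrib_right)
  also have "\<dots> = (\<Sum>j<m. ev (\<Sum>(i, k)\<in>J. smult (c (i, k)) (p ^ k * U i j)) x * b j)"
    by (simp add: ev_sum case_prod_beta mult_ac)
  also have "\<dots> = 0" using zero by simp
  finally have "(\<Sum>i\<le>M. ev (e i) (ev p x) * w i) = 0" using Q by simp
  with e_nz show ?thesis by blast
qed

end

locale function_field = extension_field \<iota> F
  for \<iota> :: "'q::field \<Rightarrow> 'a::field" and F :: "'a set" +
  fixes x :: 'a and b :: "nat \<Rightarrow> 'a" and m :: nat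
  assumes transcendental: "transcendental_over \<iota> x" and x_in_F: "x \<in> F"
    and spanned: "\<And>w. w \<in> F \<Longrightarrow> spanned x b m w"
begin

lemmas ev_eq_0_iff [simp] = transcendental_ev_eq_0[OF transcendental]

lemma x_nonzero [simp]: "x \<noteq> 0"
  using ev_eq_0_iff[of "[:0, 1:]"] by auto

lemma degree_over_poly: "degree_over_le (ev p x) (m * degree p)"
  unfolding degree_over_le_def
  by (intro allI impI spanned_relation[OF transcendental _ refl, where b = b] spanned) simp

lemma degree_over_x: "degree_over_le x m"
  using degree_over_poly[of "[:0, 1:]"] by simp

lemma degree_over_inverse:
  assumes "degree_over_le z M" "z \<noteq> 0"
  shows "degree_over_le (inverse z) M"
  unfolding degree_over_le_def
proof (intro allI impI)
  fix w :: "nat \<Rightarrow> 'a" assume "\<forall>i\<le>M. w i \<in> F"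
  then obtain c where c: "\<exists>i\<le>M. c i \<noteq> 0" "(\<Sum>i\<le>M. ev (c i) z * w i) = 0"
    using assms(1)[unfolded degree_over_le_def, rule_format, of w] by blast
  define L where "L = (\<Sum>i\<le>M. degree (c i))"
  have L: "degree (c i) \<le> L" if "i \<le> M" for i
    unfolding L_def using that by (intro member_le_sum) auto
  define c' where "c' = (\<lambda>i. \<Sum>k\<le>L. monom (coeff (c i) k) (L - k))"
  have ev: "ev (c' i) (inverse z) = ev (c i) z / z ^ L" if "i \<le> M" for i
  proof -
    have "ev (c' i) (inverse z) = (\<Sum>k\<le>L. \<iota> (coeff (c i) k) * inverse z ^ (L - k))"
      by (simp add: c'_def ev_sum)
    also have "\<dots> = (\<Sum>k\<le>L. \<iota> (coeff (c i) k) * z ^ k / z ^ L)"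
    proof (intro sum.cong refl)
      fix k assume "k \<in> {..L}"
      then have "z ^ L = z ^ k * z ^ (L - k)" by (simp add: power_add[symmetric])
      then show "\<iota> (coeff (c i) k) * inverse z ^ (L - k) = \<iota> (coeff (c i) k) * z ^ k / z ^ L"
        using assms(2) by (simp add: field_simps power_inverse)
    qed
    also have "\<dots> = ev (c i) z / z ^ L"
      by (simp add: ev_altdef[OF L[OF that]] sum_divide_distrib)
    finally show ?thesis .
  qed
  have "(\<Sum>i\<le>M. ev (c' i) (inverse z) * w i) = (\<Sum>i\<le>M. ev (c i) z * w i) / z ^ L"
    by (simp add: ev sum_divide_distrib)
  then have 1: "(\<Sum>i\<le>M. ev (c' i) (inverse z) * w i) = 0" using c by simp
  obtain i where i: "i \<le> M" "c i \<noteq> 0" using c(1) by blast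
  have "coeff (c' i) (L - degree (c i)) = (\<Sum>k\<le>L. if k = degree (c i) then coeff (c i) k else 0)"
    unfolding c'_def coeff_sum using L[OF i(1)] by (intro sum.cong) auto
  also have "\<dots> = lead_coeff (c i)" using L[OF i(1)] by simp
  finally have "c' i \<noteq> 0" using i by auto
  with i 1 show "\<exists>c. (\<exists>i\<le>M. c i \<noteq> 0) \<and> (\<Sum>i\<le>M. ev (c i) (inverse z) * w i) = 0" by blast
qed

text \<open>
  Any \<open>w \<in> P\<close> is algebraic over \<open>K(x)\<close>, and so divides a nonzero polynomial in \<open>x\<close>.
\<close>

lemma finite_place_has_poly:
  assumes P: "P \<in> places \<iota> F" and x: "x \<in> loc P"
  shows "\<exists>p. p \<noteq> 0 \<and> ev p x \<in> P"
proof -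
  obtain w where w: "w \<in> P" "w \<noteq> 0" using place_nontrivial[OF P] by blast
  have wl: "w \<in> loc P" using w place_subset_loc[OF P] by blast
  then have "w \<in> F" using loc_subset_F[OF P] by blast
  then obtain p r where p: "p \<noteq> 0" "ev p x = w * (\<Sum>i\<le>m. ev (r i) x * w ^ i)"
    using powers_relation[OF degree_over_x _ w(2)] by blast
  have "(\<Sum>i\<le>m. ev (r i) x * w ^ i) * w \<in> P"
    by (intro place_mult[OF P _ w(1)] loc_sum[OF P] loc_mult[OF P] loc_ev[OF P] loc_power[OF P] x wl)
  then show ?thesis using p by (auto simp: mult.commute)
qed

text \<open>
  A place contains a nonzero polynomial in \<open>x\<close>, or \<open>1/x\<close>, and \<open>F\<close> is finite over the field generated by it.
\<close>

lemma place_has_element: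
  assumes P: "P \<in> places \<iota> F"
  shows "\<exists>z M. z \<in> P \<and> z \<noteq> 0 \<and> degree_over_le z M"
proof (cases "x \<in> loc P")
  case True
  then show ?thesis using finite_place_has_poly[OF P] degree_over_poly ev_eq_0_iff by blast
next
  case False
  then show ?thesis
    using in_loc_or_inverse[OF P x_in_F] degree_over_inverse[OF degree_over_x] x_nonzero
    by (intro exI[of _ "inverse x"]) auto
qed

lemma all_places_discrete: "P \<in> places \<iota> F \<Longrightarrow> discrete_place P"
  using place_has_element discrete_placeI by blast

lemma has_qdim_place_degree:
  assumes P: "P \<in> places \<iota> F"
  shows "has_qdim (range \<iota>) (loc P) P (place_degree \<iota> F P)"
proof -
  obtain z M where z: "z \<in> P" "z \<noteq> 0" "degree_over_le z M" using place_has_element[OF P] by blast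
  have zl: "z \<in> loc P" using z place_subset_loc[OF P] by blast
  have sub: "(*) z ` loc P \<subseteq> P" using place_mult[OF P _ z(1)] by (auto simp: mult.commute)
  have "card B \<le> M" if B: "B \<subseteq> loc P" "indep_mod (range \<iota>) P B" for B
  proof -
    have "indep_mod (range \<iota>) ((*) z ` loc P) B" using B(2) sub unfolding indep_mod_def by blast
    then show ?thesis
      using indep_mod_multiples_card_le[OF z(3,2) subspace_loc[OF P] loc_subset_F[OF P]
          loc_mult[OF P zl] B(1)] by blast
  qed
  then obtain d where d: "has_qdim (range \<iota>) (loc P) P d"
    using has_qdim_exists[OF K_subfield subspace_place[OF P]] by blast
  then show ?thesis
    unfolding place_degree_def
    using quotient_dim_eq[OF K_subfield subspace_loc[OF P] subspace_place[OF P]] by simp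
qed

lemma place_degree_pos:
  assumes P: "P \<in> places \<iota> F"
  shows "place_degree \<iota> F P > 0"
proof (rule ccontr)
  assume "\<not> place_degree \<iota> F P > 0"
  then have "has_qdim (range \<iota>) (loc P) P 0" using has_qdim_place_degree[OF P] by simp
  then have "loc P \<subseteq> P" by (rule has_qdim_0D)
  then show False using loc_1[OF P] place_1[OF P] by blast
qed

subsection \<open>Weak approximation\<close>

text \<open>
  The ring of a discrete place is a maximal proper subring: together with an element of negative
  valuation it generates the field.
\<close>

lemma loc_not_subset:
  assumes P: "P1 \<in> places \<iota> F" "P2 \<in> places \<iota> F" "P1 \<noteq> P2"
  shows "\<exists>w\<in>loc P1. w \<notin> loc P2"
proof (rule ccontr)
  assume "\<not> (\<exists>w\<in>loc P1. w \<notin> loc P2)"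
  then have sub: "loc P1 \<subseteq> loc P2" by blast
  have "loc P2 \<subseteq> loc P1"
  proof (rule subsetI, rule ccontr)
    fix w assume w: "w \<in> loc P2" "w \<notin> loc P1"
    have d: "discrete_place P1" by (rule all_places_discrete[OF P(1)])
    have wF: "w \<in> F" "w \<noteq> 0" using w loc_subset_F[OF P(2)] loc_0[OF P(1)] by auto
    then have neg: "val F P1 w < 0" using w loc_iff_val[OF d] by auto
    have "c \<in> loc P2" if c: "c \<in> F" "c \<noteq> 0" for c
    proof -
      define k where "k = nat \<bar>val F P1 c\<bar>"
      have "int k * (- val F P1 w) \<ge> int k * 1" using neg by (intro mult_left_mono) auto
      then have "val F P1 (c / w ^ k) \<ge> 0" using c wF d by (simp add: k_def)
      then have "c / w ^ k \<in> loc P2" using loc_iff_val[OF d, of "c / w ^ k"] c wF sub by auto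
      then have "c / w ^ k * w ^ k \<in> loc P2" using w by (intro loc_mult[OF P(2)] loc_power[OF P(2)]) auto
      then show ?thesis using wF by simp
    qed
    moreover obtain z where "z \<in> P2" "z \<noteq> 0" using place_nontrivial[OF P(2)] by blast
    moreover have "z \<in> F" using \<open>z \<in> P2\<close> place_subset_loc[OF P(2)] loc_subset_F[OF P(2)] by blast
    ultimately show False using place_iff[OF P(2), of z] by auto
  qed
  with sub have "loc P1 = loc P2" by blast
  then have "z \<in> P1 \<longleftrightarrow> z \<in> P2" for z using place_iff[OF P(1)] place_iff[OF P(2)] by simp
  then show False using P(3) by blast
qed

text \<open>
  The induction combines \<open>u\<close>, good for the old places, with \<open>u'\<close>, good for the new one, as
  \<open>u + u'\<^sup>k\<close>, where \<open>k\<close> avoids the finitely many exponents for which the two values agree.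
\<close>

lemma separating_element:
  assumes "finite T" "T \<subseteq> places \<iota> F" and P: "P \<in> places \<iota> F" and "P \<notin> T" "T \<noteq> {}"
  shows "\<exists>u\<in>F. u \<noteq> 0 \<and> val F P u > 0 \<and> (\<forall>P'\<in>T. val F P' u < 0)"
proof -
  have dP: "discrete_place P" by (rule all_places_discrete[OF P])
  have pair: "\<exists>u\<in>F. u \<noteq> 0 \<and> val F P u > 0 \<and> val F P' u < 0" if P': "P' \<in> places \<iota> F" "P' \<noteq> P" for P'
  proof -
    have dP': "discrete_place P'" by (rule all_places_discrete[OF P'(1)])
    obtain u1 where u1: "u1 \<in> loc P" "u1 \<notin> loc P'" using loc_not_subset[OF P P'(1)] P'(2) by blast
    obtain u2 where u2: "u2 \<in> loc P'" "u2 \<notin> loc P" using loc_not_subset[OF P'(1) P] P'(2) by blast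
    have F: "u1 \<in> F" "u2 \<in> F" using u1 u2 loc_subset_F[OF P] loc_subset_F[OF P'(1)] by auto
    have nz: "u1 \<noteq> 0" "u2 \<noteq> 0" using u1 u2 loc_0[OF P] loc_0[OF P'(1)] by auto
    have "val F P u1 \<ge> 0" "val F P u2 < 0" "val F P' u1 < 0" "val F P' u2 \<ge> 0"
      using u1 u2 loc_iff_val[OF dP] loc_iff_val[OF dP'] F nz by auto
    then show ?thesis using F nz dP dP' by (intro bexI[of _ "u1 / u2"]) auto
  qed
  show ?thesis using assms(1,5,2,4)
  proof (induction T rule: finite_ne_induct)
    case (singleton P')
    then show ?case using pair[of P'] by auto
  next
    case (insert P' T)
    then obtain u where u: "u \<in> F" "u \<noteq> 0" "val F P u > 0" "\<forall>P'\<in>T. val F P' u < 0" by auto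
    have dT: "discrete_place P''" if "P'' \<in> insert P' T" for P''
      using that insert.prems by (intro all_places_discrete) auto
    obtain u' where u': "u' \<in> F" "u' \<noteq> 0" "val F P u' > 0" "val F P' u' < 0"
      using pair[of P'] insert.prems by auto
    show ?case
    proof (cases "val F P' u < 0")
      case True
      then show ?thesis using u by auto
    next
      case False
      have "finite (\<Union>P''\<in>T. {k. int k * val F P'' u' = val F P'' u})"
      proof (intro finite_UN_I insert.hyps)
        fix P'' assume P'': "P'' \<in> T"
        show "finite {k. int k * val F P'' u' = val F P'' u}"
        proof (rule finite_subset)
          show "{k. int k * val F P'' u' = val F P'' u} \<subseteq> {nat (val F P'' u div val F P'' u')}"
          proof
            fix k assume "k \<in> {k. int k * val F P'' u' = val F P'' u}"
            then have k: "val F P'' u = int k * val F P'' u'" by simp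
            then have "val F P'' u' \<noteq> 0" using u(4) P'' by auto
            then show "k \<in> {nat (val F P'' u div val F P'' u')}" by (simp add: k)
          qed
        qed simp
      qed
      from finite_nat_set_iff_bounded[THEN iffD1, OF this]
      obtain k0 where k0: "\<And>k P''. P'' \<in> T \<Longrightarrow> int k * val F P'' u' = val F P'' u \<Longrightarrow> k < k0" by blast
      define k where "k = Suc k0"
      define v where "v = u + u' ^ k"
      have ge: "val F P'' v < 0 \<and> v \<noteq> 0"
        if "P'' \<in> insert P' T" "val F P'' u < 0 \<or> val F P'' u' < 0" "val F P'' u \<noteq> int k * val F P'' u'" for P''
      proof -
        note d = dT[OF that(1)]
        have vk: "val F P'' (u' ^ k) = int k * val F P'' u'" using d u' by simp
        show ?thesis
        proof (cases "val F P'' u < int k * val F P'' u'")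
          case True
          then have "u' ^ k \<in> val_ge P'' (val F P'' u + 1)" using u' vk by (auto simp: val_ge_def)
          note * = val_add_eq[OF d u(1,2) this]
          have "val F P'' u < 0"
          proof (rule ccontr)
            assume "\<not> val F P'' u < 0"
            then have "val F P'' u' < 0" using that(2) by blast
            then have "int k * val F P'' u' < 0" by (simp add: k_def mult_pos_neg)
            then show False using True \<open>\<not> val F P'' u < 0\<close> by linarith
          qed
          then show ?thesis using * unfolding v_def by simp
        next
          case False
          then have "u \<in> val_ge P'' (val F P'' (u' ^ k) + 1)" using u vk that(3) by (auto simp: val_ge_def)
          have "u' ^ k \<in> F" "u' ^ k \<noteq> 0" using u' by auto
          note val_add_eq[OF d this \<open>u \<in> val_ge P'' (val F P'' (u' ^ k) + 1)\<close>]
          then have *: "v \<noteq> 0" "val F P'' v = int k * val F P'' u'"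
            unfolding v_def vk by (simp_all add: add.commute)
          have "int k * val F P'' u' < 0"
          proof (cases "val F P'' u' < 0")
            case True
            then show ?thesis by (simp add: k_def mult_pos_neg)
          next
            case False
            then show ?thesis using that(2) \<open>\<not> val F P'' u < int k * val F P'' u'\<close> that(3) by linarith
          qed
          with * show ?thesis by simp
        qed
      qed
      have "val F P'' v < 0 \<and> v \<noteq> 0" if P'': "P'' \<in> insert P' T" for P''
      proof (rule ge[OF P''])
        show "val F P'' u < 0 \<or> val F P'' u' < 0" using P'' u u' by auto
        show "val F P'' u \<noteq> int k * val F P'' u'"
        proof (cases "P'' = P'")
          case True
          have "int k * val F P' u' < 0" using u'(4) by (simp add: k_def mult_pos_neg)
          then show ?thesis using True False by simp
        next
          case False
          then show ?thesis using P'' k0[of P'' k] by (auto simp: k_def)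
        qed
      qed
      moreover have "v \<in> P"
      proof -
        have "u \<in> P" "u' \<in> P" using u u' place_iff_val[OF dP] by auto
        moreover have "u' ^ k0 * u' \<in> P"
          using \<open>u' \<in> P\<close> place_subset_loc[OF P] by (intro place_mult[OF P loc_power[OF P]]) auto
        ultimately show ?thesis unfolding v_def k_def by (auto intro: place_add[OF P] simp: mult.commute)
      qed
      moreover have "v \<in> F" using u u' by (simp add: v_def)
      ultimately show ?thesis using place_iff_val[OF dP, of v] by blast
    qed
  qed
qed

text \<open>
  Take \<open>s = 1/(1 + u)\<close>, where \<open>u\<close> has a zero at \<open>P\<close> and poles at the other places.
\<close>

lemma approximate_idempotent:
  assumes T: "finite T" "T \<subseteq> places \<iota> F" and P: "P \<in> places \<iota> F"
  shows "\<exists>s\<in>F. s - 1 \<in> val_ge P 1 \<and> (\<forall>P'\<in>T - {P}. s \<in> val_ge P' 1)"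
proof (cases "T - {P} = {}")
  case True
  then show ?thesis by (intro bexI[of _ 1]) (auto simp: val_ge_def)
next
  case False
  then obtain u where u: "u \<in> F" "u \<noteq> 0" "val F P u > 0" "\<forall>P'\<in>T - {P}. val F P' u < 0"
    using separating_element[of "T - {P}" P] T P by auto
  have dP: "discrete_place P" by (rule all_places_discrete[OF P])
  have "u \<in> val_ge P 1" using u by (auto simp: val_ge_def)
  then have 1: "1 + u \<noteq> 0" "val F P (1 + u) = 0"
    using val_add_eq[OF dP, of 1 u] val_1[OF dP] by auto
  define s where "s = inverse (1 + u)"
  have "s - 1 = - u * s" using 1 by (simp add: s_def field_simps)
  moreover have "- u * s \<in> val_ge P 1"
    using val_ge_mult[OF dP val_ge_minus[OF dP \<open>u \<in> val_ge P 1\<close>], of s 0] u 1 dP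
    by (auto simp: s_def val_ge_def)
  moreover have "s \<in> val_ge P' 1" if P': "P' \<in> T - {P}" for P'
  proof -
    have d: "discrete_place P'" using P' T by (intro all_places_discrete) auto
    have neg: "val F P' u < 0" using u(4) P' by blast
    then have "1 \<in> val_ge P' (val F P' u + 1)" using d by (simp add: val_ge_def)
    then have "val F P' (u + 1) = val F P' u" using val_add_eq[OF d u(1,2)] by auto
    then have "val F P' (1 + u) < 0" using neg by (simp add: add.commute)
    then show ?thesis using u(1) 1 d by (auto simp: s_def val_ge_def)
  qed
  moreover have "s \<in> F" using u by (simp add: s_def)
  ultimately show ?thesis by (intro bexI[of _ s]) auto
qed

end

lemma has_qdim_refl:
  assumes "subspace_over S V"
  shows "has_qdim S V V 0"
  unfolding has_qdim_def
proof (intro exI conjI)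
  show "indep_mod S V {}" by (simp add: indep_mod_def)
  show "spans_mod S V {} V" by (simp add: spans_mod_def)
qed simp_all

context function_field begin

section \<open>Riemann--Roch spaces\<close>

text \<open>
  The conditions are imposed at the places of \<open>T\<close> only: for the set of all places this is a
  Riemann--Roch space, for a finite set it is a fractional ideal of a semilocal ring.
\<close>

definition bounded_poles :: "'a set set \<Rightarrow> ('a set \<Rightarrow> int) \<Rightarrow> 'a set" where
  "bounded_poles T A = {z \<in> F. \<forall>P\<in>T. z \<in> val_ge P (- A P)}"

lemma subspace_val_ge:
  assumes "P \<in> places \<iota> F"
  shows "subspace_over (range \<iota>) (val_ge P k)"
proof -
  have d: "discrete_place P" by (rule all_places_discrete[OF assms])
  show ?thesis
    unfolding subspace_over_def
  proof (intro conjI ballI)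
    show "v + w \<in> val_ge P k" if "v \<in> val_ge P k" "w \<in> val_ge P k" for v w
      using val_ge_add[OF d that] .
    show "c * w \<in> val_ge P k" if "c \<in> range \<iota>" "w \<in> val_ge P k" for c w
      using that(1) val_ge_iota[OF d that(2)] by (elim imageE) simp
  qed (rule val_ge_0[OF d])
qed

lemma subspace_bounded_poles:
  assumes "T \<subseteq> places \<iota> F"
  shows "subspace_over (range \<iota>) (bounded_poles T A)"
  unfolding subspace_over_def
proof (intro conjI ballI)
  have sub: "subspace_over (range \<iota>) (val_ge P k)" if "P \<in> T" for P k
    using that assms subspace_val_ge by (meson subsetD)
  show "0 \<in> bounded_poles T A"
    using subspace_overD(1)[OF sub] by (simp add: bounded_poles_def)
  show "v + w \<in> bounded_poles T A" if "v \<in> bounded_poles T A" "w \<in> bounded_poles T A" for v w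
    using that subspace_overD(2)[OF sub] by (simp add: bounded_poles_def)
  show "c * w \<in> bounded_poles T A" if "c \<in> range \<iota>" "w \<in> bounded_poles T A" for c w
  proof -
    have "c \<in> F" using that(1) K_subset_F by blast
    then show ?thesis
      using that(2) subspace_overD(3)[OF sub that(1)] by (simp add: bounded_poles_def)
  qed
qed

lemma bounded_poles_mono:
  assumes "\<And>P. P \<in> T \<Longrightarrow> A P \<le> B P" "T \<subseteq> places \<iota> F"
  shows "bounded_poles T A \<subseteq> bounded_poles T B"
proof
  fix z assume z: "z \<in> bounded_poles T A"
  have "z \<in> val_ge P (- B P)" if P: "P \<in> T" for P
  proof (rule val_ge_mono)
    show "discrete_place P" using P assms(2) by (intro all_places_discrete) (rule subsetD)
    show "z \<in> val_ge P (- A P)" using z P by (simp add: bounded_poles_def)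
    show "- B P \<le> - A P" using assms(1)[OF P] by simp
  qed
  then show "z \<in> bounded_poles T B" using z by (simp add: bounded_poles_def)
qed

lemma has_qdim_val_ge:
  assumes P: "P \<in> places \<iota> F"
  shows "has_qdim (range \<iota>) (val_ge P k) (val_ge P (k + 1)) (place_degree \<iota> F P)"
proof -
  have d: "discrete_place P" by (rule all_places_discrete[OF P])
  obtain t where t: "t \<in> F" "t \<noteq> 0" "val F P t = 1" using uniformizer[OF d] by blast
  define s where "s = t powi k"
  have s: "s \<in> F" "s \<noteq> 0" "val F P s = k" using t d by (auto simp: s_def)
  have im: "(*) s ` val_ge P l = val_ge P (l + k)" for l
  proof (intro subset_antisym subsetI)
    fix z assume "z \<in> (*) s ` val_ge P l"
    then show "z \<in> val_ge P (l + k)" using val_ge_mult_iff[OF d s(1,2), of _ l] s(3) by auto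
  next
    fix z assume z: "z \<in> val_ge P (l + k)"
    have "s * (z / s) \<in> val_ge P (l + k)" using z s by simp
    then have "z / s \<in> val_ge P l" using val_ge_mult_iff[OF d s(1,2), of "z / s" l] s(3) by simp
    then show "z \<in> (*) s ` val_ge P l" using s by (intro image_eqI[of _ _ "z / s"]) auto
  qed
  have "has_qdim (range \<iota>) (val_ge P 0) (val_ge P 1) (place_degree \<iota> F P)"
    using has_qdim_place_degree[OF P] unfolding loc_eq_val_ge[OF d]
    unfolding place_eq_val_ge[OF d, symmetric] .
  from has_qdim_scale[OF K_subfield s(2) this] show ?thesis by (simp add: im add.commute)
qed

text \<open>
  Allowing one more pole at \<open>P\<close> embeds the quotient into a one-step quotient of fractional ideals
  at \<open>P\<close>; weak approximation at the places of a finite \<open>T\<close> makes the embedding surjective.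
\<close>

lemma has_qdim_bounded_poles_step:
  assumes T: "T \<subseteq> places \<iota> F" and P: "P \<in> T"
  shows "\<exists>d\<le>place_degree \<iota> F P. (finite T \<longrightarrow> d = place_degree \<iota> F P) \<and>
    has_qdim (range \<iota>) (bounded_poles T (A(P := A P + 1))) (bounded_poles T A) d"
proof -
  let ?B = "A(P := A P + 1)" and ?K = "range \<iota>"
  have PP: "P \<in> places \<iota> F" using T P by blast
  have d: "discrete_place P" by (rule all_places_discrete[OF PP])
  have q: "has_qdim ?K (val_ge P (- A P - 1)) (val_ge P (- A P)) (place_degree \<iota> F P)"
    using has_qdim_val_ge[OF PP, of "- A P - 1"] by simp
  have sub: "bounded_poles T ?B \<subseteq> val_ge P (- A P - 1)"
    using P by (auto simp: bounded_poles_def)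
  have iff: "v \<in> val_ge P (- A P) \<longleftrightarrow> v \<in> bounded_poles T A" if v: "v \<in> bounded_poles T ?B" for v
  proof
    assume "v \<in> val_ge P (- A P)"
    then show "v \<in> bounded_poles T A" using v by (auto simp: bounded_poles_def split: if_splits)
  qed (use P in \<open>auto simp: bounded_poles_def\<close>)
  note inject = has_qdim_inject[OF K_subfield subspace_bounded_poles[OF T] subspace_bounded_poles[OF T]
      subspace_val_ge[OF PP] sub iff q]
  show ?thesis
  proof (cases "finite T")
    case False
    then show ?thesis using inject(1) by blast
  next
    case True
    obtain s where s: "s \<in> F" "s - 1 \<in> val_ge P 1" "\<forall>P'\<in>T - {P}. s \<in> val_ge P' 1"
      using approximate_idempotent[OF True T PP] by blast
    have "\<exists>v\<in>bounded_poles T ?B. v' - v \<in> val_ge P (- A P)" if v': "v' \<in> val_ge P (- A P - 1)" for v'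
    proof (cases "v' = 0")
      case True
      then show ?thesis using subspace_overD(1)[OF subspace_bounded_poles[OF T]]
        subspace_overD(1)[OF subspace_val_ge[OF PP]] by (intro bexI[of _ 0]) auto
    next
      case nz: False
      have v'F: "v' \<in> F" using v' by (simp add: val_ge_def)
      \<comment> \<open>an exponent that makes up for the poles of \<open>v'\<close> at all places of \<open>T\<close> at once\<close>
      define k where "k = (\<Sum>P'\<in>T. nat \<bar>A P' + val F P' v'\<bar>)"
      define v where "v = v' * s ^ k"
      have sk: "s ^ k \<in> val_ge P' (int k)" if "P' \<in> T - {P}" for P'
      proof (induction k)
        case 0
        then show ?case using that T val_1[OF all_places_discrete] by (auto simp: val_ge_def)
      next
        case (Suc k)
        then show ?case
          using val_ge_mult[OF all_places_discrete, of P' s 1 "s ^ k" "int k"] that T s(3) by auto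
      qed
      have s1: "s ^ k - 1 \<in> val_ge P 1" for k
      proof (induction k)
        case (Suc k)
        have "(s - 1) * (s ^ k - 1) \<in> val_ge P 1"
          using val_ge_mult[OF d s(2) Suc] by (rule val_ge_mono[OF d]) simp
        then have "(s - 1) * (s ^ k - 1) + (s - 1) + (s ^ k - 1) \<in> val_ge P 1"
          using s(2) Suc by (intro val_ge_add[OF d])
        then show ?case by (simp add: algebra_simps)
      qed (simp add: val_ge_0[OF d])
      have "v \<in> val_ge P' (- A P')" if P': "P' \<in> T - {P}" for P'
      proof -
        have d': "discrete_place P'" using P' T by (intro all_places_discrete) auto
        have "nat \<bar>A P' + val F P' v'\<bar> \<le> k"
          unfolding k_def using P' True
          by (intro member_le_sum[where f = "\<lambda>P'. nat \<bar>A P' + val F P' v'\<bar>"]) auto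
        then have "- A P' \<le> val F P' v' + int k" by linarith
        moreover have "v \<in> val_ge P' (val F P' v' + int k)"
          unfolding v_def using v'F by (intro val_ge_mult[OF d'] sk[OF P']) (simp add: val_ge_def)
        ultimately show ?thesis using val_ge_mono[OF d'] by blast
      qed
      moreover have diff: "v' - v \<in> val_ge P (- A P)"
      proof -
        have "v' * (s ^ k - 1) \<in> val_ge P (- A P - 1 + 1)" by (rule val_ge_mult[OF d v' s1])
        then have "- (v' * (s ^ k - 1)) \<in> val_ge P (- A P)" by (intro val_ge_minus[OF d]) simp
        then show ?thesis by (simp add: v_def algebra_simps)
      qed
      moreover have "v \<in> val_ge P (- A P - 1)"
      proof -
        have "v' - v \<in> val_ge P (- A P - 1)" using diff by (rule val_ge_mono[OF d]) simp
        from val_ge_diff[OF d v' this] show ?thesis by simp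
      qed
      moreover have "v \<in> F" using v'F s by (simp add: v_def)
      ultimately have "v \<in> bounded_poles T ?B" by (auto simp: bounded_poles_def)
      then show ?thesis using diff by blast
    qed
    then show ?thesis using inject(2) by blast
  qed
qed

lemma has_qdim_bounded_poles_at:
  assumes T: "T \<subseteq> places \<iota> F" and P: "P \<in> T"
  shows "\<exists>d\<le>k * place_degree \<iota> F P. (finite T \<longrightarrow> d = k * place_degree \<iota> F P) \<and>
    has_qdim (range \<iota>) (bounded_poles T (A(P := A P + int k))) (bounded_poles T A) d"
proof (induction k)
  case 0
  have "has_qdim (range \<iota>) (bounded_poles T A) (bounded_poles T A) 0"
    by (rule has_qdim_refl[OF subspace_bounded_poles[OF T]])
  then show ?case by simp
next
  case (Suc k)
  let ?A = "A(P := A P + int k)" and ?K = "range \<iota>"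
  obtain d1 where d1: "d1 \<le> k * place_degree \<iota> F P" "finite T \<longrightarrow> d1 = k * place_degree \<iota> F P"
    "has_qdim ?K (bounded_poles T ?A) (bounded_poles T A) d1" using Suc by blast
  obtain d2 where d2: "d2 \<le> place_degree \<iota> F P" "finite T \<longrightarrow> d2 = place_degree \<iota> F P"
    "has_qdim ?K (bounded_poles T (?A(P := ?A P + 1))) (bounded_poles T ?A) d2"
    using has_qdim_bounded_poles_step[OF T P, of ?A] by blast
  have eq: "?A(P := ?A P + 1) = A(P := A P + int (Suc k))" by (auto simp: fun_eq_iff)
  have "has_qdim ?K (bounded_poles T (?A(P := ?A P + 1))) (bounded_poles T A) (d2 + d1)"
    by (rule has_qdim_add[OF K_subfield subspace_bounded_poles[OF T] _ _ d2(3) d1(3)];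
        rule bounded_poles_mono[OF _ T]) auto
  then have "has_qdim ?K (bounded_poles T (A(P := A P + int (Suc k)))) (bounded_poles T A) (d2 + d1)"
    by (simp only: eq)
  moreover have "d2 + d1 \<le> Suc k * place_degree \<iota> F P"
    "finite T \<longrightarrow> d2 + d1 = Suc k * place_degree \<iota> F P" using d1(1,2) d2(1,2) by auto
  ultimately show ?case by blast
qed

lemma has_qdim_bounded_poles:
  assumes T: "T \<subseteq> places \<iota> F" and X: "finite X" "X \<subseteq> T"
    and AB: "\<And>P. P \<in> X \<Longrightarrow> A P \<le> B P"
  shows "\<exists>d. int d \<le> (\<Sum>P\<in>X. (B P - A P) * int (place_degree \<iota> F P)) \<and>
    (finite T \<longrightarrow> int d = (\<Sum>P\<in>X. (B P - A P) * int (place_degree \<iota> F P))) \<and>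
    has_qdim (range \<iota>) (bounded_poles T (\<lambda>P. if P \<in> X then B P else A P)) (bounded_poles T A) d"
  using X AB
proof (induction X rule: finite_induct)
  case empty
  have "has_qdim (range \<iota>) (bounded_poles T A) (bounded_poles T A) 0"
    by (rule has_qdim_refl[OF subspace_bounded_poles[OF T]])
  then have "has_qdim (range \<iota>) (bounded_poles T (\<lambda>P. if P \<in> {} then B P else A P)) (bounded_poles T A) 0"
    by (simp only: empty_iff if_False)
  then show ?case by (intro exI[of _ 0] conjI impI) simp_all
next
  case (insert P X)
  let ?C = "\<lambda>P. if P \<in> X then B P else A P" and ?K = "range \<iota>"
  define k where "k = nat (B P - A P)"
  have k: "int k = B P - A P" using insert.prems(2)[of P] by (simp add: k_def)
  obtain d1 where d1: "int d1 \<le> (\<Sum>P\<in>X. (B P - A P) * int (place_degree \<iota> F P))"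
    "finite T \<longrightarrow> int d1 = (\<Sum>P\<in>X. (B P - A P) * int (place_degree \<iota> F P))"
    "has_qdim ?K (bounded_poles T ?C) (bounded_poles T A) d1"
    using insert.IH insert.prems by auto
  obtain d2 where d2: "d2 \<le> k * place_degree \<iota> F P" "finite T \<longrightarrow> d2 = k * place_degree \<iota> F P"
    "has_qdim ?K (bounded_poles T (?C(P := ?C P + int k))) (bounded_poles T ?C) d2"
    using has_qdim_bounded_poles_at[OF T, of P k ?C] insert.prems by blast
  have eq: "?C(P := ?C P + int k) = (\<lambda>P'. if P' \<in> insert P X then B P' else A P')"
    using insert.hyps k by (auto simp: fun_eq_iff)
  have "has_qdim ?K (bounded_poles T (?C(P := ?C P + int k))) (bounded_poles T A) (d2 + d1)"
    by (rule has_qdim_add[OF K_subfield subspace_bounded_poles[OF T] _ _ d2(3) d1(3)];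
        rule bounded_poles_mono[OF _ T]) (use insert.prems in auto)
  then have H: "has_qdim ?K (bounded_poles T (\<lambda>P'. if P' \<in> insert P X then B P' else A P')) (bounded_poles T A) (d2 + d1)"
    by (simp only: eq)
  have "int d2 \<le> (B P - A P) * int (place_degree \<iota> F P)"
    "finite T \<longrightarrow> int d2 = (B P - A P) * int (place_degree \<iota> F P)"
    using d2 unfolding k[symmetric] of_nat_mult[symmetric] of_nat_le_iff of_nat_eq_iff by auto
  then have "int (d2 + d1) \<le> (\<Sum>P\<in>insert P X. (B P - A P) * int (place_degree \<iota> F P))"
    "finite T \<longrightarrow> int (d2 + d1) = (\<Sum>P\<in>insert P X. (B P - A P) * int (place_degree \<iota> F P))"
    using d1(1,2) insert.hyps by auto
  with H show ?case by blast
qed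

text \<open>
  On the semilocal ring of a finite set \<open>T\<close> of zeros of \<open>z\<close>, the quotient modulo \<open>z\<close> has dimension
  \<open>\<Sum>\<^sub>P v\<^sub>P(z) deg P\<close>, and independence modulo \<open>z\<close> lifts to independence over \<open>K(z)\<close>.
\<close>

lemma degree_of_zeros_le:
  assumes T: "finite T" "T \<subseteq> places \<iota> F" and z: "z \<in> F" "z \<noteq> 0" "\<And>P. P \<in> T \<Longrightarrow> z \<in> P"
    and deg: "degree_over_le z M"
  shows "(\<Sum>P\<in>T. val F P z * int (place_degree \<iota> F P)) \<le> int M"
proof -
  let ?K = "range \<iota>" and ?V = "bounded_poles T (\<lambda>_. 0)" and ?W = "bounded_poles T (\<lambda>P. - val F P z)"
  have dT: "discrete_place P" if "P \<in> T" for P using that T(2) by (blast intro: all_places_discrete)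
  have pos: "0 < val F P z" if "P \<in> T" for P using place_iff_val[OF dT[OF that] z(1,2)] z(3)[OF that] by simp
  have le: "- val F P z \<le> 0" if "P \<in> T" for P using pos[OF that] by simp
  obtain d where d: "int d = (\<Sum>P\<in>T. (0 - - val F P z) * int (place_degree \<iota> F P))"
    "has_qdim ?K (bounded_poles T (\<lambda>P. if P \<in> T then 0 else - val F P z)) ?W d"
    using has_qdim_bounded_poles[OF T(2,1) subset_refl, of "\<lambda>P. - val F P z" "\<lambda>_. 0", OF le] T(1) by blast
  have "bounded_poles T (\<lambda>P. if P \<in> T then 0 else - val F P z) = ?V"
    by (auto simp: bounded_poles_def)
  with d have q: "has_qdim ?K ?V ?W d" by simp
  have W: "(*) z ` ?V = ?W"
  proof (intro subset_antisym subsetI)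
    fix w assume "w \<in> (*) z ` ?V"
    then obtain v where v: "v \<in> ?V" "w = z * v" by blast
    then have "z * v \<in> val_ge P (0 + val F P z)" if "P \<in> T" for P
      using val_ge_mult_iff[OF dT[OF that] z(1,2), of v 0] that by (simp add: bounded_poles_def)
    then show "w \<in> ?W" using v z by (auto simp: bounded_poles_def)
  next
    fix w assume w: "w \<in> ?W"
    have "z * (w / z) \<in> val_ge P (0 + val F P z)" if "P \<in> T" for P
      using w that z(2) by (simp add: bounded_poles_def)
    then have "w / z \<in> val_ge P 0" if "P \<in> T" for P
      using val_ge_mult_iff[OF dT[OF that] z(1,2)] that by blast
    then have "w / z \<in> ?V" using w z by (auto simp: bounded_poles_def)
    then show "w \<in> (*) z ` ?V" using z by (intro image_eqI[of _ _ "w / z"]) auto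
  qed
  obtain B where B: "B \<subseteq> ?V" "indep_mod ?K ?W B" "card B = d" using q unfolding has_qdim_def by blast
  have "card B \<le> M"
  proof (rule indep_mod_multiples_card_le[OF deg z(2) subspace_bounded_poles[OF T(2)] _ _ B(1)])
    show "?V \<subseteq> F" by (auto simp: bounded_poles_def)
    show "indep_mod ?K ((*) z ` ?V) B" using B(2) by (simp only: W)
    fix v assume v: "v \<in> ?V"
    then have "z * v \<in> ?W" using W by blast
    moreover have "?W \<subseteq> ?V" using pos by (intro bounded_poles_mono[OF _ T(2)]) (simp add: less_imp_le)
    ultimately show "z * v \<in> ?V" by blast
  qed
  then show ?thesis using d(1) B(3) by simp
qed

text \<open>
  Every zero contributes at least 1 to a sum that is bounded by \<open>M\<close>.
\<close>

lemma zeros_finite: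
  assumes z: "z \<in> F" "z \<noteq> 0" and deg: "degree_over_le z M"
  shows "finite {P \<in> places \<iota> F. z \<in> P}"
proof (rule ccontr)
  assume "infinite {P \<in> places \<iota> F. z \<in> P}"
  then obtain T where T: "finite T" "card T = Suc M" "T \<subseteq> {P \<in> places \<iota> F. z \<in> P}"
    using infinite_arbitrarily_large by blast
  have "int (Suc M) = (\<Sum>P\<in>T. 1)" using T by simp
  also have "\<dots> \<le> (\<Sum>P\<in>T. val F P z * int (place_degree \<iota> F P))"
  proof (rule sum_mono)
    fix P assume "P \<in> T"
    then have P: "P \<in> places \<iota> F" "z \<in> P" using T by auto
    have "0 < val F P z" using place_iff_val[OF all_places_discrete[OF P(1)] z] P by simp
    moreover have "0 < int (place_degree \<iota> F P)" using place_degree_pos[OF P(1)] by simp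
    ultimately have "0 < val F P z * int (place_degree \<iota> F P)" by (rule mult_pos_pos)
    then show "1 \<le> val F P z * int (place_degree \<iota> F P)" by simp
  qed
  also have "\<dots> \<le> int M" using T by (intro degree_of_zeros_le[OF _ _ z _ deg]) auto
  finally show False by simp
qed

end

section \<open>Existence of places\<close>

context extension_field begin

definition polys_over :: "'a set \<Rightarrow> 'a poly set" where
  "polys_over R = {p. \<forall>i. coeff p i \<in> R}"

lemma polys_overD: "p \<in> polys_over R \<Longrightarrow> coeff p i \<in> R"
  by (simp add: polys_over_def)

text \<open>
  If \<open>1\<close> is a multiple of \<open>w\<close> both in \<open>R[u]\<close> and in \<open>R[u\<^sup>-\<^sup>1]\<close>, the relation of smaller degree can be
  used to lower the degree of the other one, until \<open>1\<close> is a multiple of \<open>w\<close> in \<open>R\<close>.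
\<close>

lemma no_opposite_relations:
  assumes R: "0 \<in> R" "1 \<in> R" "\<And>a b. a \<in> R \<Longrightarrow> b \<in> R \<Longrightarrow> a + b \<in> R"
      "\<And>a b. a \<in> R \<Longrightarrow> b \<in> R \<Longrightarrow> a * b \<in> R" "\<And>a. a \<in> R \<Longrightarrow> - a \<in> R"
    and w: "w \<in> R" "\<And>r. r \<in> R \<Longrightarrow> w * r \<noteq> 1"
  shows "\<lbrakk>u \<noteq> 0; p \<in> polys_over R; q \<in> polys_over R; w * poly p u = 1; w * poly q (inverse u) = 1\<rbrakk> \<Longrightarrow> False"
proof (induction "degree p + degree q" arbitrary: u p q rule: less_induct)
  case less
  have diff: "a - b \<in> R" if "a \<in> R" "b \<in> R" for a b using R(3)[OF that(1) R(5)[OF that(2)]] by simp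
  have sumR: "sum f I \<in> R" if "\<And>i. i \<in> I \<Longrightarrow> f i \<in> R" for f and I :: "nat set"
    using that by (induction I rule: infinite_finite_induct) (auto intro: R)
  have main: False
    if u: "u \<noteq> 0" and p: "p \<in> polys_over R" and q: "q \<in> polys_over R"
      and rel: "w * poly p u = 1" "w * poly q (inverse u) = 1" and le: "degree q \<le> degree p"
      and IH: "\<And>p'. p' \<in> polys_over R \<Longrightarrow> degree p' < degree p \<Longrightarrow> w * poly p' u = 1 \<Longrightarrow> False"
    for u p q
  proof -
    define n where "n = degree p"
    define k where "k = degree q"
    have n: "n > 0"
    proof (rule ccontr)
      assume "\<not> n > 0"
      then obtain a where a: "p = [:a:]" unfolding n_def by (auto elim: degree_eq_zeroE)
      then have "a \<in> R" using polys_overD[OF p, of 0] by simp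
      then show False using w(2)[of a] rel(1) a by simp
    qed
    define b0 where "b0 = coeff q 0"
    define an where "an = coeff p n"
    define S where "S = (\<Sum>j\<in>{1..k}. monom (w * an * coeff q j) (n - j))"
    define p0 where "p0 = p - monom an n"
    \<comment> \<open>\<open>1 = w b\<^sub>0 + (1 - w b\<^sub>0) w p(u)\<close>; the leading term of \<open>p\<close>, multiplied by \<open>1 - w b\<^sub>0\<close>, is\<close>
    \<comment> \<open>rewritten by \<open>1 - w b\<^sub>0 = w \<Sum>\<^sub>j b\<^sub>j u\<^sup>-\<^sup>j\<close> (sum over \<open>j \<ge> 1\<close>) as the terms of \<open>S\<close>, of degree below \<open>n\<close>\<close>
    define p' where "p' = [:b0:] + smult (1 - w * b0) p0 + S"
    have mem: "b0 \<in> R" "an \<in> R" using polys_overD p q by (auto simp: b0_def an_def)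
    have p0R: "coeff p0 i \<in> R" for i
      using polys_overD[OF p] mem R(1) diff by (auto simp: p0_def)
    have SR: "coeff S i \<in> R" for i
      unfolding S_def coeff_sum using polys_overD[OF q] mem w(1) R(1,4)
      by (intro sumR) auto
    have "coeff p' i \<in> R" for i
    proof -
      have "coeff [:b0:] i \<in> R" using mem R(1) by (auto simp: coeff_pCons split: nat.split)
      moreover have "(1 - w * b0) * coeff p0 i \<in> R"
        using mem w(1) R(2) p0R by (intro R(4) diff) auto
      ultimately show ?thesis using SR unfolding p'_def by (auto intro!: R(3))
    qed
    then have p'R: "p' \<in> polys_over R" by (simp add: polys_over_def)
    have "coeff p' i = 0" if i: "i \<ge> n" for i
    proof -
      have "coeff p0 i = 0"
        using i by (cases "i = n") (auto simp: p0_def an_def n_def coeff_eq_0)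
      moreover have "coeff S i = 0" unfolding S_def coeff_sum using i n by (intro sum.neutral) auto
      moreover have "coeff [:b0:] i = 0" using i n by (cases i) auto
      ultimately show ?thesis by (simp add: p'_def)
    qed
    then have deg: "degree p' < n" using n
      by (metis leading_coeff_0_iff degree_0 not_le_imp_less)
    have "poly q (inverse u) = (\<Sum>j\<le>k. coeff q j * inverse u ^ j)"
      by (simp add: poly_altdef k_def)
    also have "\<dots> = b0 + (\<Sum>j\<in>{1..k}. coeff q j * inverse u ^ j)"
      by (simp add: b0_def atMost_atLeast0 sum.atLeast_Suc_atMost)
    finally have qeq: "1 - w * b0 = w * (\<Sum>j\<in>{1..k}. coeff q j * inverse u ^ j)"
      using rel(2) by (simp add: algebra_simps)
    have "poly S u = (\<Sum>j\<in>{1..k}. w * an * coeff q j * u ^ (n - j))"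
      by (simp add: S_def poly_sum poly_monom)
    also have "\<dots> = (\<Sum>j\<in>{1..k}. an * u ^ n * (w * (coeff q j * inverse u ^ j)))"
    proof (intro sum.cong refl)
      fix j assume "j \<in> {1..k}"
      then have "j \<le> n" using le by (simp add: n_def k_def)
      then have "u ^ n = u ^ (n - j) * u ^ j" by (simp add: power_add[symmetric])
      then show "w * an * coeff q j * u ^ (n - j) = an * u ^ n * (w * (coeff q j * inverse u ^ j))"
        using u by (simp add: field_simps power_inverse)
    qed
    also have "\<dots> = an * u ^ n * (1 - w * b0)"
      by (simp add: qeq sum_distrib_left)
    finally have S: "poly S u = an * u ^ n * (1 - w * b0)" .
    have "poly p' u = b0 + (1 - w * b0) * (poly p u - an * u ^ n) + an * u ^ n * (1 - w * b0)"
      by (simp add: p'_def p0_def S poly_monom)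
    also have "\<dots> = b0 + (1 - w * b0) * poly p u" by (simp add: algebra_simps)
    finally have p'u: "poly p' u = b0 + (1 - w * b0) * poly p u" .
    have "w * poly p' u = w * b0 + (1 - w * b0) * (w * poly p u)"
      unfolding p'u by (simp add: algebra_simps)
    then have "w * poly p' u = 1" using rel(1) by simp
    then show False using IH[OF p'R] deg by (simp add: n_def)
  qed
  show False
  proof (cases "degree q \<le> degree p")
    case True
    show False
    proof (rule main[OF less.prems True])
      fix p' assume "p' \<in> polys_over R" "degree p' < degree p" "w * poly p' u = 1"
      then show False using less.hyps[of p' q u] less.prems by simp
    qed
  next
    case False
    have inv: "inverse u \<noteq> 0" "w * poly p (inverse (inverse u)) = 1" using less.prems by simp_all
    show False
    proof (rule main[OF inv(1) less.prems(3,2,5) inv(2)])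
      show "degree p \<le> degree q" using False by simp
      fix q' assume "q' \<in> polys_over R" "degree q' < degree q" "w * poly q' (inverse u) = 1"
      then show False using less.hyps[of p q' u] less.prems by simp
    qed
  qed
qed

text \<open>
  A subring that is maximal among those containing \<open>K[w]\<close> in which \<open>w\<close> is not a unit is a
  valuation ring.
\<close>

lemma place_containing_exists:
  assumes wF: "w \<in> F" "w \<noteq> 0" and w: "\<And>p. w * ev p w \<noteq> 1"
  shows "\<exists>P\<in>places \<iota> F. w \<in> P"
proof -
  define \<A> where "\<A> = {R. range \<iota> \<subseteq> R \<and> w \<in> R \<and> R \<subseteq> F \<and>
    (\<forall>a\<in>R. \<forall>b\<in>R. a + b \<in> R \<and> a * b \<in> R) \<and> (\<forall>r\<in>R. w * r \<noteq> 1)}"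
  have ne: "\<A> \<noteq> {}"
  proof -
    have "range (\<lambda>p. ev p w) \<in> \<A>" unfolding \<A>_def mem_Collect_eq
    proof (intro conjI ballI)
      show "range \<iota> \<subseteq> range (\<lambda>p. ev p w)" 
      proof
        fix v assume "v \<in> range \<iota>"
        then obtain c where c: "v = \<iota> c" by blast
        show "v \<in> range (\<lambda>p. ev p w)" by (rule range_eqI[of _ _ "[:c:]"]) (simp add: c)
      qed
      show "w \<in> range (\<lambda>p. ev p w)" by (rule range_eqI[of _ _ "[:0, 1:]"]) simp
      show "range (\<lambda>p. ev p w) \<subseteq> F" by (rule image_subsetI) (rule ev_in_F[OF wF(1)])
      fix a assume "a \<in> range (\<lambda>p. ev p w)"
      then obtain p where p: "a = ev p w" by blast
      show "w * a \<noteq> 1" using w p by simp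
      fix b assume "b \<in> range (\<lambda>p. ev p w)"
      then obtain q where q: "b = ev q w" by blast
      show "a + b \<in> range (\<lambda>p. ev p w)" by (rule range_eqI[of _ _ "p + q"]) (simp add: p q)
      show "a * b \<in> range (\<lambda>p. ev p w)" by (rule range_eqI[of _ _ "p * q"]) (simp add: p q)
    qed
    then show ?thesis by blast
  qed
  have chain: "\<Union>\<C> \<in> \<A>" if \<C>: "\<C> \<noteq> {}" "subset.chain \<A> \<C>" for \<C>
  proof -
    have sub: "C \<in> \<A>" if "C \<in> \<C>" for C using \<C>(2) that by (auto simp: subset.chain_def)
    have two: "\<exists>C\<in>\<C>. a \<in> C \<and> b \<in> C" if ab: "a \<in> \<Union>\<C>" "b \<in> \<Union>\<C>" for a b
    proof -
      obtain A B where A: "A \<in> \<C>" "a \<in> A" and B: "B \<in> \<C>" "b \<in> B" using ab by blast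
      have "A \<subseteq> B \<or> B \<subseteq> A" using \<C>(2) A(1) B(1) unfolding subset_chain_def by blast
      then show ?thesis using A B by blast
    qed
    obtain C0 where C0: "C0 \<in> \<C>" using \<C>(1) by blast
    show ?thesis unfolding \<A>_def mem_Collect_eq
    proof (intro conjI ballI)
      show "range \<iota> \<subseteq> \<Union>\<C>" "w \<in> \<Union>\<C>" using sub[OF C0] C0 by (auto simp: \<A>_def)
      show "\<Union>\<C> \<subseteq> F" using sub by (force simp: \<A>_def)
      fix a assume a: "a \<in> \<Union>\<C>"
      show "w * a \<noteq> 1" using a sub by (force simp: \<A>_def)
      fix b assume b: "b \<in> \<Union>\<C>"
      obtain C where C: "C \<in> \<C>" "a \<in> C" "b \<in> C" using two[OF a b] by blast
      have "a + b \<in> C" "a * b \<in> C" using sub[OF C(1)] C by (auto simp: \<A>_def)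
      then show "a + b \<in> \<Union>\<C>" "a * b \<in> \<Union>\<C>" using C(1) by blast+
    qed
  qed
  obtain R where "R \<in> \<A>" and max: "\<And>X. X \<in> \<A> \<Longrightarrow> R \<subseteq> X \<Longrightarrow> X = R"
    using subset_Zorn_nonempty[OF ne chain] by blast
  then have R: "range \<iota> \<subseteq> R" "w \<in> R" "R \<subseteq> F" "\<And>a b. a \<in> R \<Longrightarrow> b \<in> R \<Longrightarrow> a + b \<in> R"
    "\<And>a b. a \<in> R \<Longrightarrow> b \<in> R \<Longrightarrow> a * b \<in> R" "\<And>r. r \<in> R \<Longrightarrow> w * r \<noteq> 1"
    unfolding \<A>_def by blast+
  have iR: "\<iota> c \<in> R" for c using R(1) by blast
  have R01: "0 \<in> R" "1 \<in> R" using iR[of 0] iR[of 1] by simp_all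
  have Rm: "- a \<in> R" if "a \<in> R" for a using R(5)[OF iR[of "-1"] that] by simp
  have sumR: "sum f I \<in> R" if "\<And>i. i \<in> I \<Longrightarrow> f i \<in> R" for f and I :: "nat set"
    using that by (induction I rule: infinite_finite_induct) (auto intro: R(4) R01)
  have relation: "\<exists>p\<in>polys_over R. w * poly p u = 1" if u: "u \<in> F" "u \<notin> R" for u
  proof -
    define X where "X = (\<lambda>p. poly p u) ` polys_over R"
    have closed: "p + q \<in> polys_over R" "p * q \<in> polys_over R"
      if "p \<in> polys_over R" "q \<in> polys_over R" for p q
    proof -
      show "p + q \<in> polys_over R"
        using R(4)[OF polys_overD[OF that(1)] polys_overD[OF that(2)]] by (simp add: polys_over_def)
      have "(\<Sum>i\<le>k. coeff p i * coeff q (k - i)) \<in> R" for k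
        by (rule sumR) (rule R(5)[OF polys_overD[OF that(1)] polys_overD[OF that(2)]])
      then show "p * q \<in> polys_over R" by (simp add: polys_over_def coeff_mult)
    qed
    have const: "[:a:] \<in> polys_over R" if "a \<in> R" for a
      using that R01 by (auto simp: polys_over_def coeff_pCons split: nat.split)
    have RX: "R \<subseteq> X"
    proof
      fix a assume "a \<in> R"
      from const[OF this] show "a \<in> X" unfolding X_def by (intro image_eqI[of _ _ "[:a:]"]) simp_all
    qed
    have uX: "u \<in> X" unfolding X_def
      by (rule image_eqI[of _ _ "[:0, 1:]"]) (use R01 in \<open>auto simp: polys_over_def coeff_pCons split: nat.split\<close>)
    have XF: "X \<subseteq> F"
    proof
      fix v assume "v \<in> X"
      then obtain p where p: "p \<in> polys_over R" "v = poly p u" unfolding X_def by blast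
      have "coeff p i * u ^ i \<in> F" for i using polys_overD[OF p(1)] R(3) u(1) by blast
      then show "v \<in> F" unfolding p(2) poly_altdef by (rule is_subfield_sum[OF F_subfield])
    qed
    have "X \<notin> \<A>" using max[of X] RX uX u(2) by blast
    moreover have "range \<iota> \<subseteq> X" "w \<in> X" using RX R(1,2) by blast+
    moreover have "a + b \<in> X \<and> a * b \<in> X" if ab: "a \<in> X" "b \<in> X" for a b
    proof -
      obtain p where p: "p \<in> polys_over R" "a = poly p u" using ab(1) unfolding X_def by blast
      obtain q where q: "q \<in> polys_over R" "b = poly q u" using ab(2) unfolding X_def by blast
      have "poly (p + q) u \<in> X" unfolding X_def by (rule imageI[OF closed(1)[OF p(1) q(1)]])
      moreover have "poly (p * q) u \<in> X" unfolding X_def by (rule imageI[OF closed(2)[OF p(1) q(1)]])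
      ultimately show ?thesis by (simp add: p(2) q(2))
    qed
    moreover note XF
    ultimately have "\<not> (\<forall>v\<in>X. w * v \<noteq> 1)" unfolding \<A>_def mem_Collect_eq by blast
    then obtain v where "v \<in> X" "w * v = 1" by blast
    then show ?thesis unfolding X_def by blast
  qed
  have val: "u \<in> R \<or> inverse u \<in> R" if u: "u \<in> F" "u \<noteq> 0" for u
  proof (rule ccontr)
    assume "\<not> (u \<in> R \<or> inverse u \<in> R)"
    then obtain p q where "p \<in> polys_over R" "w * poly p u = 1" "q \<in> polys_over R" "w * poly q (inverse u) = 1"
      using relation[of u] relation[of "inverse u"] u by blast
    then show False using no_opposite_relations[OF R01 R(4,5) Rm R(2,6) u(2)] by blast
  qed
  have iw: "inverse w \<notin> R" using R(6)[of "inverse w"] wF(2) by auto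
  have "w \<notin> range \<iota>"
  proof
    assume "w \<in> range \<iota>"
    then obtain c where c: "w = \<iota> c" by blast
    then have "inverse w = \<iota> (inverse c)" by simp
    then show False using iw iR by metis
  qed
  then have "range \<iota> \<subset> R" using R(1,2) by blast
  moreover have "inverse w \<in> F" using wF(1) by (rule F_closed(6))
  then have "R \<subset> F" using R(3) iw by blast
  ultimately have "valuation_ring \<iota> F R"
    unfolding valuation_ring_def using R(4,5) val by (intro conjI ballI impI) simp_all
  then have "{z \<in> R. z = 0 \<or> inverse z \<notin> R} \<in> places \<iota> F"
    unfolding places_def mem_Collect_eq by (intro exI[of _ R] conjI refl)
  moreover have "w \<in> {z \<in> R. z = 0 \<or> inverse z \<notin> R}" using R(2) iw by blast
  ultimately show ?thesis by (rule bexI[rotated])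
qed

lemma ev_reflect_poly: "z \<noteq> 0 \<Longrightarrow> ev (reflect_poly p) z = z ^ degree p * ev p (inverse z)"
proof -
  assume z: "z \<noteq> 0"
  have "ev (reflect_poly p) z = (\<Sum>i\<le>degree p. \<iota> (coeff (reflect_poly p) i) * z ^ i)"
    by (rule ev_altdef[OF degree_reflect_poly_le])
  also have "\<dots> = (\<Sum>i\<le>degree p. \<iota> (coeff p i) * z ^ (degree p - i))"
    by (rule sum.reindex_bij_witness[of _ "\<lambda>i. degree p - i" "\<lambda>i. degree p - i"])
      (auto simp: coeff_reflect_poly)
  also have "\<dots> = (\<Sum>i\<le>degree p. z ^ degree p * (\<iota> (coeff p i) * inverse z ^ i))"
  proof (intro sum.cong refl)
    fix i assume "i \<in> {..degree p}"
    then have "z ^ degree p = z ^ (degree p - i) * z ^ i" by (simp add: power_add[symmetric])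
    then show "\<iota> (coeff p i) * z ^ (degree p - i) = z ^ degree p * (\<iota> (coeff p i) * inverse z ^ i)"
      using z by (simp add: field_simps power_inverse)
  qed
  also have "\<dots> = z ^ degree p * ev p (inverse z)"
    by (simp add: ev_altdef[OF order_refl] sum_distrib_left)
  finally show ?thesis .
qed

text \<open>
  Otherwise \<open>1/z\<close> is not a unit of \<open>K[1/z]\<close>, because \<open>z\<close> is not a polynomial in \<open>1/z\<close>: at the zero \<open>P\<close>
  such a polynomial is a constant or has a pole.  Then \<open>1/z\<close> lies in some place, where \<open>z\<close> has a pole.
\<close>

lemma no_zero_without_pole:
  assumes z: "z \<in> F" "\<And>P. P \<in> places \<iota> F \<Longrightarrow> z \<in> loc P" and P: "P \<in> places \<iota> F" "z \<in> P"
  shows "z = 0"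
proof (rule ccontr)
  assume nz: "z \<noteq> 0"
  have "inverse z * ev p (inverse z) \<noteq> 1" for p
  proof
    assume *: "inverse z * ev p (inverse z) = 1"
    have p: "p \<noteq> 0" using * by auto
    have "ev (reflect_poly p) z \<in> loc P - P" using p by (intro ev_unit[OF P]) simp
    moreover have "ev (reflect_poly p) z = z ^ degree p * z"
      using * nz by (simp add: ev_reflect_poly field_simps)
    moreover have "z ^ degree p * z \<in> P"
      by (intro place_mult[OF P(1) _ P(2)] loc_power[OF P(1)] z(2) P(1))
    ultimately show False by simp
  qed
  then obtain P' where P': "P' \<in> places \<iota> F" "inverse z \<in> P'"
    using place_containing_exists[of "inverse z"] z(1) nz by auto
  then show False using z(2)[OF P'(1)] nz place_iff[OF P'(1), of "inverse z"] by simp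
qed

end

section \<open>Riemann's inequality\<close>

lemma (in constant_field) vector_space_iota: "vector_space (\<lambda>c z. \<iota> c * z)"
  by unfold_locales (simp_all add: distrib_left distrib_right mult.assoc)

lemma (in constant_field) dim_eq_has_qdim:
  assumes V: "subspace_over (range \<iota>) V" and d: "has_qdim (range \<iota>) V {0} d"
  shows "vector_space.dim (\<lambda>c z. \<iota> c * z) V = d"
proof -
  interpret vs: vector_space "\<lambda>c z. \<iota> c * z" by (rule vector_space_iota)
  obtain B where B: "B \<subseteq> V" "indep_mod (range \<iota>) {0} B" "spans_mod (range \<iota>) {0} B V" "card B = d"
    using d unfolding has_qdim_def by blast
  have fin: "finite B" using B(2) by (simp add: indep_mod_def)
  have "vs.independent B"
  proof
    assume "vs.dependent B"
    then obtain u where u: "\<exists>v\<in>B. u v \<noteq> 0" "(\<Sum>v\<in>B. \<iota> (u v) * v) = 0"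
      unfolding vs.dependent_finite[OF fin] by blast
    have "\<iota> (u v) = 0" if "v \<in> B" for v
    proof (rule indep_modD[OF B(2) _ _ that, of "\<lambda>v. \<iota> (u v)"])
      show "(\<Sum>v\<in>B. \<iota> (u v) * v) \<in> {0}" using u(2) by simp
    qed (rule rangeI)
    then show False using u(1) iota_simps(7) by blast
  qed
  moreover have "V \<subseteq> vs.span B"
  proof
    fix v assume "v \<in> V"
    then obtain c where c: "\<forall>b\<in>B. c b \<in> range \<iota>" "v - (\<Sum>b\<in>B. c b * b) \<in> {0}"
      using B(3) unfolding spans_mod_def by blast
    define e where "e = (\<lambda>b. inv \<iota> (c b))"
    have e: "c b = \<iota> (e b)" if "b \<in> B" for b
      using c(1) that by (simp add: e_def f_inv_into_f)
    have "v = (\<Sum>b\<in>B. c b * b)" using c(2) by simp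
    also have "\<dots> = (\<Sum>b\<in>B. \<iota> (e b) * b)" by (intro sum.cong) (simp_all add: e)
    finally have v: "v = (\<Sum>b\<in>B. \<iota> (e b) * b)" .
    show "v \<in> vs.span B" unfolding vs.span_finite[OF fin]
      by (rule image_eqI[of v _ e], rule v, rule UNIV_I)
  qed
  ultimately show ?thesis using vs.basis_card_eq_dim[OF B(1)] B(4) by metis
qed

context function_field begin

lemma RR_space_eq: "RR_space \<iota> F A = bounded_poles (places \<iota> F) (Poly_Mapping.lookup A)"
  by (auto simp: RR_space_def bounded_poles_def val_ge_def)

lemma subspace_RR_space: "subspace_over (range \<iota>) (RR_space \<iota> F A)"
  unfolding RR_space_eq by (rule subspace_bounded_poles[OF subset_refl])

lemma places_nonempty: "\<exists>P. P \<in> places \<iota> F"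
proof -
  have "x * ev p x \<noteq> 1" for p
  proof
    assume "x * ev p x = 1"
    then have "ev (pCons 0 p - 1) x = 0" by simp
    then have "pCons 0 p - 1 = 0" by (simp only: ev_eq_0_iff)
    then have "coeff (pCons 0 p - 1) 0 = 0" by simp
    then show False by simp
  qed
  then show ?thesis using place_containing_exists[OF x_in_F x_nonzero] by blast
qed

text \<open>
  Lower the coefficients of \<open>A\<close> to nonpositive ones, with a negative one at some place \<open>P\<^sub>0\<close>.  The
  smaller space is zero, since its elements have no poles but a zero at \<open>P\<^sub>0\<close>, and the finitely many
  changed coefficients account for a quotient of finite dimension.
\<close>

lemma has_qdim_ell: "has_qdim (range \<iota>) (RR_space \<iota> F A) {0} (ell \<iota> F A)"
proof -
  obtain P0 where P0: "P0 \<in> places \<iota> F" using places_nonempty by blast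
  let ?T = "places \<iota> F"
  define A' where "A' = (\<lambda>P. min (Poly_Mapping.lookup A P) 0 - (if P = P0 then 1 else 0))"
  define X where "X = (Poly_Mapping.keys A \<inter> ?T) \<union> {P0}"
  have X: "finite X" "X \<subseteq> ?T" using P0 by (auto simp: X_def)
  have A'_le: "A' P \<le> Poly_Mapping.lookup A P" for P by (auto simp: A'_def min_def)
  obtain d where d: "has_qdim (range \<iota>)
      (bounded_poles ?T (\<lambda>P. if P \<in> X then Poly_Mapping.lookup A P else A' P)) (bounded_poles ?T A') d"
    using has_qdim_bounded_poles[OF subset_refl X, of A' "Poly_Mapping.lookup A", OF A'_le] by blast
  have "bounded_poles ?T (\<lambda>P. if P \<in> X then Poly_Mapping.lookup A P else A' P) = RR_space \<iota> F A"
  proof -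
    have "(if P \<in> X then Poly_Mapping.lookup A P else A' P) = Poly_Mapping.lookup A P" if "P \<in> ?T" for P
      using that by (auto simp: X_def A'_def in_keys_iff)
    then show ?thesis unfolding RR_space_eq bounded_poles_def by (intro Collect_cong) auto
  qed
  moreover have "bounded_poles ?T A' = {0}"
  proof (intro subset_antisym subsetI)
    fix z assume z: "z \<in> bounded_poles ?T A'"
    then have zge: "z \<in> val_ge P (- A' P)" if "P \<in> ?T" for P using that by (auto simp: bounded_poles_def)
    have "z = 0"
    proof (rule no_zero_without_pole[OF _ _ P0])
      show "z \<in> F" using z by (simp add: bounded_poles_def)
      show "z \<in> loc P" if "P \<in> ?T" for P
        unfolding loc_eq_val_ge[OF all_places_discrete[OF that]]
        by (rule val_ge_mono[OF all_places_discrete[OF that] zge[OF that]]) (simp add: A'_def min_def)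
      have "z \<in> val_ge P0 1"
        by (rule val_ge_mono[OF all_places_discrete[OF P0] zge[OF P0]]) (simp add: A'_def min_def)
      then show "z \<in> P0" using place_eq_val_ge[OF all_places_discrete[OF P0]] by blast
    qed
    then show "z \<in> {0}" by simp
  qed (use subspace_overD(1)[OF subspace_bounded_poles[OF subset_refl]] in simp)
  ultimately have d': "has_qdim (range \<iota>) (RR_space \<iota> F A) {0} d" using d by simp
  then show ?thesis unfolding ell_def using dim_eq_has_qdim[OF subspace_RR_space d'] by simp
qed

lemma div_degree_eq_sum:
  assumes "finite X" "Poly_Mapping.keys A \<subseteq> X"
  shows "div_degree \<iota> F A = (\<Sum>P\<in>X. Poly_Mapping.lookup A P * int (place_degree \<iota> F P))"
  unfolding div_degree_def
proof (rule sum.mono_neutral_left[OF assms])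
  show "\<forall>P\<in>X - Poly_Mapping.keys A. Poly_Mapping.lookup A P * int (place_degree \<iota> F P) = 0"
    by (simp add: in_keys_iff)
qed

lemma div_degree_add: "div_degree \<iota> F (A + B) = div_degree \<iota> F A + div_degree \<iota> F B"
proof -
  let ?X = "Poly_Mapping.keys A \<union> Poly_Mapping.keys B"
  have "Poly_Mapping.keys (A + B) \<subseteq> ?X" by (rule keys_add)
  then show ?thesis
    by (simp add: div_degree_eq_sum[of ?X] lookup_add distrib_right sum.distrib)
qed

lemma div_degree_diff: "div_degree \<iota> F (A - B) = div_degree \<iota> F A - div_degree \<iota> F B"
  using div_degree_add[of "A - B" B] by simp

lemma div_degree_0 [simp]: "div_degree \<iota> F 0 = 0"
  by (simp add: div_degree_def)

lemma div_degree_sum: "div_degree \<iota> F (\<Sum>i\<in>I. A i) = (\<Sum>i\<in>I. div_degree \<iota> F (A i))"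
  by (induction I rule: infinite_finite_induct) (simp_all add: div_degree_add)

lemma div_degree_single: "div_degree \<iota> F (frag_cmul k (frag_of P)) = k * int (place_degree \<iota> F P)"
  by (subst div_degree_eq_sum[of "{P}"]) (auto simp: keys_cmul keys_frag_of)

text \<open>
  Each of the finitely many steps from \<open>A\<close> to \<open>B\<close> raises the degree by some \<open>deg P\<close>, and the dimension
  by at most that.
\<close>

lemma deg_minus_ell_mono:
  assumes A: "A \<in> divisors \<iota> F" and B: "B \<in> divisors \<iota> F"
    and le: "\<And>P. P \<in> places \<iota> F \<Longrightarrow> Poly_Mapping.lookup A P \<le> Poly_Mapping.lookup B P"
  shows "div_degree \<iota> F A - int (ell \<iota> F A) \<le> div_degree \<iota> F B - int (ell \<iota> F B)"
proof -
  let ?T = "places \<iota> F" and ?K = "range \<iota>"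
  let ?X = "Poly_Mapping.keys A \<union> Poly_Mapping.keys B"
  have X: "finite ?X" "?X \<subseteq> ?T" using A B by (auto simp: divisors_def)
  obtain d where d: "int d \<le> (\<Sum>P\<in>?X. (Poly_Mapping.lookup B P - Poly_Mapping.lookup A P) * int (place_degree \<iota> F P))"
    "has_qdim ?K (bounded_poles ?T (\<lambda>P. if P \<in> ?X then Poly_Mapping.lookup B P else Poly_Mapping.lookup A P))
      (bounded_poles ?T (Poly_Mapping.lookup A)) d"
    using has_qdim_bounded_poles[OF subset_refl X, of "Poly_Mapping.lookup A" "Poly_Mapping.lookup B"] le X(2)
    by blast
  have "(\<lambda>P. if P \<in> ?X then Poly_Mapping.lookup B P else Poly_Mapping.lookup A P) = Poly_Mapping.lookup B"
    by (auto simp: fun_eq_iff in_keys_iff)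
  then have q: "has_qdim ?K (RR_space \<iota> F B) (RR_space \<iota> F A) d" using d(2) unfolding RR_space_eq by simp
  have sub: "RR_space \<iota> F A \<subseteq> RR_space \<iota> F B"
    unfolding RR_space_eq by (rule bounded_poles_mono[OF le]) auto
  have "has_qdim ?K (RR_space \<iota> F B) {0} (d + ell \<iota> F A)"
    by (rule has_qdim_add[OF K_subfield subspace_RR_space _ sub q has_qdim_ell])
      (use subspace_overD(1)[OF subspace_RR_space] in simp)
  moreover have "subspace_over ?K {0}" by (simp add: subspace_over_def)
  ultimately have "ell \<iota> F B = d + ell \<iota> F A"
    using has_qdim_unique[OF K_subfield] has_qdim_ell by blast
  moreover have "int d \<le> div_degree \<iota> F B - div_degree \<iota> F A"
    using d(1) by (simp add: div_degree_eq_sum[OF X(1)] left_diff_distrib sum_subtractf)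
  ultimately show ?thesis by simp
qed

lemma RR_space_mult:
  assumes z: "z \<in> F" "z \<noteq> 0"
    and B: "\<And>P. P \<in> places \<iota> F \<Longrightarrow> Poly_Mapping.lookup B P = Poly_Mapping.lookup A P - val F P z"
  shows "z * u \<in> RR_space \<iota> F B \<longleftrightarrow> u \<in> RR_space \<iota> F A"
proof -
  have "z * u \<in> val_ge P (- Poly_Mapping.lookup B P) \<longleftrightarrow> u \<in> val_ge P (- Poly_Mapping.lookup A P)"
    if P: "P \<in> places \<iota> F" for P
    using val_ge_mult_iff[OF all_places_discrete[OF P] z, of u "- Poly_Mapping.lookup A P"] B[OF P] by simp
  moreover have "z * u \<in> F \<longleftrightarrow> u \<in> F"
  proof
    assume "z * u \<in> F"
    then have "z * u / z \<in> F" using z by blast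
    then show "u \<in> F" using z by simp
  qed (use z in auto)
  ultimately show ?thesis unfolding RR_space_eq bounded_poles_def by simp
qed

lemma ell_linearly_equivalent:
  assumes z: "z \<in> F" "z \<noteq> 0"
    and B: "\<And>P. P \<in> places \<iota> F \<Longrightarrow> Poly_Mapping.lookup B P = Poly_Mapping.lookup A P - val F P z"
  shows "ell \<iota> F B = ell \<iota> F A"
proof -
  have "(*) z ` RR_space \<iota> F A = RR_space \<iota> F B"
  proof (intro subset_antisym subsetI)
    fix v assume "v \<in> RR_space \<iota> F B"
    moreover have v: "v = z * (v / z)" using z by simp
    ultimately have "v / z \<in> RR_space \<iota> F A" using RR_space_mult[OF z B] by metis
    then show "v \<in> (*) z ` RR_space \<iota> F A" using v by (rule image_eqI[rotated])
  qed (use RR_space_mult[OF z B] in blast)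
  moreover have "(*) z ` {0} = {0}" by simp
  ultimately have "has_qdim (range \<iota>) (RR_space \<iota> F B) {0} (ell \<iota> F A)"
    using has_qdim_scale[OF K_subfield z(2) has_qdim_ell[of A]] by simp
  moreover have "subspace_over (range \<iota>) {0}" by (simp add: subspace_over_def)
  ultimately show ?thesis using has_qdim_unique[OF K_subfield] has_qdim_ell by blast
qed

end

context function_field begin

text \<open>
  \<open>x\<^sup>-\<^sup>d p(x)\<close> is the reversed polynomial at \<open>1/x\<close>, whose constant term is nonzero.
\<close>

lemma val_poly_at_pole:
  assumes Q: "Q \<in> places \<iota> F" and x: "inverse x \<in> Q" and p: "p \<noteq> 0"
  shows "val F Q (ev p x) = int (degree p) * val F Q x"
proof -
  have d: "discrete_place Q" by (rule all_places_discrete[OF Q])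
  have "ev (reflect_poly p) (inverse x) \<in> loc Q - Q"
    by (rule ev_unit[OF Q x]) (use p in simp)
  then have "val F Q (ev (reflect_poly p) (inverse x)) = 0" by (rule val_unit[OF d])
  moreover have "ev (reflect_poly p) (inverse x) = inverse x ^ degree p * ev p x"
    using ev_reflect_poly[of "inverse x" p] by simp
  moreover have "val F Q (inverse x ^ degree p * ev p x) = int (degree p) * (- val F Q x) + val F Q (ev p x)"
    using p x_in_F by (simp add: val_mult[OF d] val_power[OF d] val_inverse[OF d])
  ultimately show ?thesis by simp
qed

text \<open>
  A divisor \<open>A\<close> is linearly equivalent to a divisor of at least the same degree that is bounded by
  a multiple of \<open>Q\<close>: subtract the divisor of a polynomial in \<open>x\<close> with sufficiently many zeros.
  The degree does not drop because \<open>[F : K(p(x))] \<le> m deg p\<close> bounds the zeros of \<open>p(x)\<close>.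
\<close>

lemma deg_minus_ell_bounded:
  assumes Q: "Q \<in> places \<iota> F" "place_degree \<iota> F Q = 1" and xQ: "inverse x \<in> Q"
    and m: "m > 0" "val F Q x = - int m"
    and only: "\<And>P. P \<in> places \<iota> F \<Longrightarrow> P \<noteq> Q \<Longrightarrow> x \<in> loc P"
    and C: "\<And>l. int (l * m) - int (ell \<iota> F (frag_cmul (int (l * m)) (frag_of Q))) \<le> C"
    and A: "A \<in> divisors \<iota> F"
  shows "div_degree \<iota> F A - int (ell \<iota> F A) \<le> C"
proof -
  let ?T = "places \<iota> F"
  define X where "X = Poly_Mapping.keys A - {Q}"
  have X: "finite X" "X \<subseteq> ?T" using A by (auto simp: X_def divisors_def)
  have "\<forall>P\<in>X. \<exists>p. p \<noteq> 0 \<and> ev p x \<in> P"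
  proof
    fix P assume P: "P \<in> X"
    then have "P \<in> ?T" "P \<noteq> Q" using X(2) by (auto simp: X_def)
    then show "\<exists>p. p \<noteq> 0 \<and> ev p x \<in> P" by (intro finite_place_has_poly only)
  qed
  from bchoice[OF this] obtain pp where pp: "\<forall>P\<in>X. pp P \<noteq> 0 \<and> ev (pp P) x \<in> P" ..
  \<comment> \<open>the coefficient of \<open>A\<close> at any place except \<open>Q\<close> is at most the valuation of \<open>p(x)\<close>\<close>
  define p where "p = (\<Prod>P\<in>X. pp P ^ nat \<bar>Poly_Mapping.lookup A P\<bar>)"
  define z where "z = ev p x"
  have p: "p \<noteq> 0" unfolding p_def using pp X(1) by simp
  have z: "z \<in> F" "z \<noteq> 0" using p x_in_F by (auto simp: z_def)
  have zl: "z \<in> loc P" if "P \<in> ?T" "P \<noteq> Q" for P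
    unfolding z_def by (rule loc_ev[OF that(1) only[OF that]])
  have valX: "val F P z \<ge> Poly_Mapping.lookup A P" if P: "P \<in> X" for P
  proof -
    have PT: "P \<in> ?T" using P X by blast
    have PQ: "P \<noteq> Q" using P by (simp add: X_def)
    have d: "discrete_place P" by (rule all_places_discrete[OF PT])
    have nz: "ev (pp P') x \<noteq> 0" "ev (pp P') x \<in> F" if "P' \<in> X" for P'
      using pp that x_in_F by auto
    have ge: "val F P (ev (pp P') x) \<ge> 0" if "P' \<in> X" for P'
      using loc_iff_val[OF d nz(2,1)[OF that]] loc_ev[OF PT only[OF PT PQ]] by blast
    have 1: "val F P (ev (pp P) x) \<ge> 1"
      using place_iff_val[OF d nz(2,1)[OF P]] pp P by simp
    have z_eq: "z = (\<Prod>P'\<in>X. ev (pp P') x ^ nat \<bar>Poly_Mapping.lookup A P'\<bar>)"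
      by (simp add: z_def p_def ev_prod)
    have "val F P z = (\<Sum>P'\<in>X. val F P (ev (pp P') x ^ nat \<bar>Poly_Mapping.lookup A P'\<bar>))"
      unfolding z_eq by (rule val_prod[OF d X(1)]) (use nz in auto)
    also have "\<dots> \<ge> val F P (ev (pp P) x ^ nat \<bar>Poly_Mapping.lookup A P\<bar>)"
      by (rule member_le_sum[OF P _ X(1), of "\<lambda>P'. val F P (ev (pp P') x ^ nat \<bar>Poly_Mapping.lookup A P'\<bar>)"])
        (use nz ge in \<open>simp add: val_power[OF d]\<close>)
    finally have "val F P z \<ge> \<bar>Poly_Mapping.lookup A P\<bar> * val F P (ev (pp P) x)"
      using nz[OF P] by (simp add: val_power[OF d])
    moreover have "\<bar>Poly_Mapping.lookup A P\<bar> * val F P (ev (pp P) x) \<ge> \<bar>Poly_Mapping.lookup A P\<bar> * 1"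
      using 1 by (intro mult_left_mono) auto
    ultimately show ?thesis by linarith
  qed
  have valQ: "val F Q z = - int (m * degree p)"
    using val_poly_at_pole[OF Q(1) xQ p] m by (simp add: z_def)
  define Z where "Z = {P \<in> ?T. z \<in> P}"
  have deg_z: "degree_over_le z (m * degree p)" unfolding z_def by (rule degree_over_poly)
  have Z: "finite Z" unfolding Z_def by (rule zeros_finite[OF z deg_z])
  have QZ: "Q \<notin> Z"
  proof -
    have "\<not> 0 < val F Q z" unfolding valQ by linarith
    then show ?thesis using place_iff_val[OF all_places_discrete[OF Q(1)] z] by (simp add: Z_def)
  qed
  define W where "W = (\<Sum>P\<in>Z. frag_cmul (val F P z) (frag_of P)) + frag_cmul (val F Q z) (frag_of Q)"
  have lookupW: "Poly_Mapping.lookup W P = val F P z" if P: "P \<in> ?T" for P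
  proof -
    have "Poly_Mapping.lookup W P = (\<Sum>P'\<in>Z. if P' = P then val F P' z else 0) + (if P = Q then val F Q z else 0)"
      unfolding W_def lookup_add lookup_sum lookup_frag_cmul lookup_frag_of
      by (intro arg_cong2[of _ _ _ _ "(+)"] sum.cong) auto
    also have "\<dots> = val F P z"
    proof (cases "P = Q \<or> P \<in> Z")
      case True
      then show ?thesis using Z QZ by auto
    next
      case False
      then have "\<not> val F P z > 0" "val F P z \<ge> 0"
        using place_iff_val[OF all_places_discrete[OF P] z] loc_iff_val[OF all_places_discrete[OF P] z]
          zl[OF P] P by (auto simp: Z_def)
      then show ?thesis using False Z by auto
    qed
    finally show ?thesis .
  qed
  have keysW: "Poly_Mapping.keys W \<subseteq> ?T"
  proof
    fix P assume "P \<in> Poly_Mapping.keys W"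
    then have "Poly_Mapping.lookup W P \<noteq> 0" by (simp add: in_keys_iff)
    moreover have "Poly_Mapping.lookup W P = 0" if "P \<notin> Z" "P \<noteq> Q"
    proof -
      have "(\<Sum>P'\<in>Z. Poly_Mapping.lookup (frag_cmul (val F P' z) (frag_of P')) P) = 0"
      proof (intro sum.neutral ballI)
        fix P' assume "P' \<in> Z"
        then have "P' \<noteq> P" using that(1) by blast
        then show "Poly_Mapping.lookup (frag_cmul (val F P' z) (frag_of P')) P = 0" by simp
      qed
      then show ?thesis using that(2) by (simp add: W_def lookup_add lookup_sum)
    qed
    ultimately show "P \<in> ?T" using Q(1) by (auto simp: Z_def)
  qed
  have "div_degree \<iota> F W = (\<Sum>P\<in>Z. val F P z * int (place_degree \<iota> F P)) + val F Q z"
    by (simp add: W_def div_degree_add div_degree_sum div_degree_single Q(2))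
  also have "\<dots> \<le> 0"
  proof -
    have "Z \<subseteq> ?T" unfolding Z_def by blast
    moreover have "z \<in> P" if "P \<in> Z" for P using that unfolding Z_def by blast
    ultimately have "(\<Sum>P\<in>Z. val F P z * int (place_degree \<iota> F P)) \<le> int (m * degree p)"
      by (rule degree_of_zeros_le[OF Z _ z _ deg_z])
    then show ?thesis unfolding valQ by linarith
  qed
  finally have degW: "div_degree \<iota> F W \<le> 0" .
  define B where "B = A - W"
  have B: "B \<in> divisors \<iota> F"
    using keysW A keys_diff[of A W] unfolding B_def divisors_def mem_Collect_eq by blast
  have lookupB: "Poly_Mapping.lookup B P = Poly_Mapping.lookup A P - val F P z" if "P \<in> ?T" for P
    using lookupW[OF that] by (simp add: B_def lookup_minus)
  have ellB: "ell \<iota> F B = ell \<iota> F A" by (rule ell_linearly_equivalent[OF z lookupB])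
  define l where "l = nat (Poly_Mapping.lookup B Q)"
  define L where "L = frag_cmul (int (l * m)) (frag_of Q)"
  have L: "L \<in> divisors \<iota> F" using Q(1) by (auto simp: L_def divisors_def keys_frag_of dest: keys_cmul[THEN subsetD])
  have le: "Poly_Mapping.lookup B P \<le> Poly_Mapping.lookup L P" if P: "P \<in> ?T" for P
  proof (cases "P = Q")
    case True
    have "l * 1 \<le> l * m" using m(1) by (intro mult_le_mono) auto
    then have "Poly_Mapping.lookup B Q \<le> int (l * m)" unfolding l_def by linarith
    then show ?thesis by (simp add: True L_def)
  next
    case False
    have "Poly_Mapping.lookup A P \<le> val F P z"
    proof (cases "P \<in> X")
      case nX: False
      then have "Poly_Mapping.lookup A P = 0" using False by (simp add: X_def in_keys_iff)
      then show ?thesis using loc_iff_val[OF all_places_discrete[OF P] z] zl[OF P False] by simp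
    qed (rule valX)
    then show ?thesis using False lookupB[OF P] by (simp add: L_def)
  qed
  have "div_degree \<iota> F A - int (ell \<iota> F A) \<le> div_degree \<iota> F B - int (ell \<iota> F B)"
    using degW ellB by (simp add: B_def div_degree_diff)
  also have "\<dots> \<le> div_degree \<iota> F L - int (ell \<iota> F L)"
    by (rule deg_minus_ell_mono[OF B L le])
  also have "\<dots> \<le> C" using C[of l] by (simp add: L_def div_degree_single Q(2))
  finally show ?thesis .
qed

text \<open>The genus is a supremum of integers, which has a meaning only by Riemann's theorem.\<close>

lemma deg_minus_ell_le_genus:
  assumes C: "\<And>A. A \<in> divisors \<iota> F \<Longrightarrow> div_degree \<iota> F A - int (ell \<iota> F A) \<le> C"
    and A: "A \<in> divisors \<iota> F"
  shows "div_degree \<iota> F A - int (ell \<iota> F A) + 1 \<le> genus \<iota> F"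
  unfolding genus_def
proof (rule cSup_upper)
  show "bdd_above {div_degree \<iota> F A - int (ell \<iota> F A) + 1 | A. A \<in> divisors \<iota> F}"
    by (rule bdd_aboveI[of _ "C + 1"]) (use C in fastforce)
qed (use A in blast)

end

section \<open>Kummer extensions of the rational function field\<close>

context constant_field begin

lemma is_subfield_Inter:
  assumes "\<And>T. T \<in> \<T> \<Longrightarrow> is_subfield T"
  shows "is_subfield (\<Inter>\<T>)"
  unfolding is_subfield_def
  by (intro conjI ballI InterI) (simp_all add: is_subfieldD[OF assms])

lemma adjoin_subfield: "is_subfield (adjoin \<iota> S)"
  unfolding adjoin_def by (rule hull_in) (rule is_subfield_Inter, blast)

lemma adjoin_superset: "range \<iota> \<union> S \<subseteq> adjoin \<iota> S"
  unfolding adjoin_def by (rule hull_subset)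

lemma adjoin_minimal: "is_subfield T \<Longrightarrow> range \<iota> \<union> S \<subseteq> T \<Longrightarrow> adjoin \<iota> S \<subseteq> T"
  unfolding adjoin_def by (rule hull_minimal)

text \<open>
  By the relation between the powers of \<open>w\<close>, some \<open>p(x) \<noteq> 0\<close> is \<open>w\<close> times a combination of
  powers of \<open>w\<close>; so \<open>w\<^sup>-\<^sup>1\<close> is that combination divided by \<open>p(x)\<close>.
\<close>

lemma spanned_inverse:
  assumes x: "transcendental_over \<iota> x" and w: "\<And>i. spanned x b m (w ^ i)" "w \<noteq> 0"
    and add: "\<And>v v'. spanned x b m v \<Longrightarrow> spanned x b m v' \<Longrightarrow> spanned x b m (v + v')"
    and mult: "\<And>p v. spanned x b m v \<Longrightarrow> spanned x b m (ev p x * v)"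
    and zero: "spanned x b m 0"
  shows "spanned x b m (inverse w)"
proof -
  obtain c where c: "\<exists>i\<le>m. c i \<noteq> 0" "(\<Sum>i\<le>m. ev (c i) x * w ^ i) = 0"
    using spanned_relation[OF x, of m b m "\<lambda>i. w ^ i" "[:0, 1:]"] w(1) by auto
  obtain p r where p: "p \<noteq> 0" "ev p x = w * (\<Sum>i\<le>m. ev (r i) x * w ^ i)"
    using lowest_term_relation[OF w(2) c] by blast
  have px: "ev p x \<noteq> 0" using p(1) transcendental_ev_eq_0[OF x] by blast
  have sums: "spanned x b m (sum f I)" if "\<And>i. i \<in> I \<Longrightarrow> spanned x b m (f i)" for f and I :: "nat set"
    using that by (induction I rule: infinite_finite_induct) (simp_all add: add zero)
  have "spanned x b m (\<Sum>i\<le>m. ev (r i) x * w ^ i)" by (rule sums) (rule mult[OF w(1)])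
  then obtain q u where q: "q \<noteq> 0" "ev q x * (\<Sum>i\<le>m. ev (r i) x * w ^ i) = (\<Sum>j<m. ev (u j) x * b j)"
    unfolding spanned_def by blast
  have "ev (q * p) x * inverse w = ev q x * (\<Sum>i\<le>m. ev (r i) x * w ^ i)"
    using p(2) w(2) by simp
  then show ?thesis unfolding spanned_def using q p(1) by (intro exI[of _ "q * p"] exI[of _ u]) simp
qed

end

locale kummer_extension = constant_field \<iota>
  for \<iota> :: "'q::field \<Rightarrow> 'a::field" +
  fixes x y :: 'a and a :: "nat \<Rightarrow> 'q" and m n :: nat and E F :: "'a set"
  assumes transcendental_x: "transcendental_over \<iota> x"
    and m_pos: "m > 0" and n_pos: "n > 0" and coprime_mn: "coprime m n"
    and a_inj: "inj_on a {1..n}"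
    and kummer_eq: "y ^ m = (\<Prod>k=1..n. (x - \<iota> (a k)))"
    and E_eq: "E = adjoin \<iota> {x}" and F_eq: "F = adjoin \<iota> {x, y}"
begin

definition f_poly :: "'q poly" where
  "f_poly = (\<Prod>k=1..n. [:- a k, 1:])"

lemma ev_f_poly: "ev f_poly x = y ^ m"
  by (simp add: f_poly_def ev_prod kummer_eq)

lemma f_poly_nonzero: "f_poly \<noteq> 0"
  by (simp add: f_poly_def)

lemma y_nonzero [simp]: "y \<noteq> 0"
proof
  assume "y = 0"
  then have "ev f_poly x = 0" using ev_f_poly m_pos by simp
  then show False using transcendental_ev_eq_0[OF transcendental_x] f_poly_nonzero by blast
qed

text \<open>The ring \<open>K[x, y]\<close>: powers of \<open>y\<close> beyond \<open>y\<^sup>m\<^sup>-\<^sup>1\<close> are reduced with \<open>y\<^sup>m = f(x)\<close>.\<close>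

definition coord_ring :: "'a set" where
  "coord_ring = {w. \<exists>u. w = (\<Sum>j<m. ev (u j) x * y ^ j)}"

lemma coord_ringI: "w = (\<Sum>j<m. ev (u j) x * y ^ j) \<Longrightarrow> w \<in> coord_ring"
  unfolding coord_ring_def by blast

lemma coord_ring_add: "v \<in> coord_ring \<Longrightarrow> w \<in> coord_ring \<Longrightarrow> v + w \<in> coord_ring"
proof -
  assume "v \<in> coord_ring" "w \<in> coord_ring"
  then obtain u u' where "v = (\<Sum>j<m. ev (u j) x * y ^ j)" "w = (\<Sum>j<m. ev (u' j) x * y ^ j)"
    unfolding coord_ring_def by blast
  then show ?thesis
    by (intro coord_ringI[of _ "\<lambda>j. u j + u' j"]) (simp add: distrib_right sum.distrib)
qed

lemma coord_ring_ev: "w \<in> coord_ring \<Longrightarrow> ev p x * w \<in> coord_ring"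
proof -
  assume "w \<in> coord_ring"
  then obtain u where "w = (\<Sum>j<m. ev (u j) x * y ^ j)" unfolding coord_ring_def by blast
  then show ?thesis
    by (intro coord_ringI[of _ "\<lambda>j. p * u j"]) (simp add: sum_distrib_left mult.assoc)
qed

lemma coord_ring_0: "0 \<in> coord_ring"
  by (rule coord_ringI[of _ "\<lambda>_. 0"]) simp

lemma coord_ring_sum:
  "(\<And>i. i \<in> I \<Longrightarrow> f i \<in> coord_ring) \<Longrightarrow> sum f (I :: nat set) \<in> coord_ring"
  by (induction I rule: infinite_finite_induct) (auto intro: coord_ring_add coord_ring_0)

lemma coord_ring_power: "j < m \<Longrightarrow> y ^ j \<in> coord_ring"
proof (rule coord_ringI[of _ "\<lambda>i. if i = j then 1 else 0"])
  assume j: "j < m"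
  have "(\<Sum>i<m. ev (if i = j then 1 else 0) x * y ^ i) = (\<Sum>i<m. if i = j then y ^ i else 0)"
    by (rule sum.cong) auto
  then show "y ^ j = (\<Sum>i<m. ev (if i = j then 1 else 0) x * y ^ i)" using j by simp
qed

lemma coord_ring_y: "w \<in> coord_ring \<Longrightarrow> y * w \<in> coord_ring"
proof -
  assume "w \<in> coord_ring"
  then obtain u where u: "w = (\<Sum>j<m. ev (u j) x * y ^ j)" unfolding coord_ring_def by blast
  have "ev (u j) x * y ^ Suc j \<in> coord_ring" if j: "j < m" for j
  proof (cases "Suc j < m")
    case True
    then show ?thesis by (intro coord_ring_ev coord_ring_power)
  next
    case False
    then have "y ^ Suc j = y ^ m" using j by (metis Suc_lessI)
    then have "y ^ Suc j = ev f_poly x * y ^ 0" using ev_f_poly by simp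
    then show ?thesis using coord_ring_ev[OF coord_ring_ev[OF coord_ring_power[OF m_pos]]] by simp
  qed
  then have "(\<Sum>j<m. ev (u j) x * y ^ Suc j) \<in> coord_ring" by (intro coord_ring_sum) auto
  moreover have "y * w = (\<Sum>j<m. ev (u j) x * y ^ Suc j)"
    by (simp add: u sum_distrib_left mult_ac)
  ultimately show ?thesis by simp
qed

lemma coord_ring_mult:
  assumes v: "v \<in> coord_ring" and w: "w \<in> coord_ring"
  shows "v * w \<in> coord_ring"
proof -
  obtain u where u: "v = (\<Sum>j<m. ev (u j) x * y ^ j)" using v unfolding coord_ring_def by blast
  have yw: "y ^ j * w \<in> coord_ring" for j
    by (induction j) (use w coord_ring_y in \<open>auto simp: mult.assoc\<close>)
  have "v * w = (\<Sum>j<m. ev (u j) x * (y ^ j * w))"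
    by (simp add: u sum_distrib_right mult.assoc)
  also have "\<dots> \<in> coord_ring" by (intro coord_ring_sum coord_ring_ev yw)
  finally show ?thesis .
qed

lemma spanned_iff: "spanned x (\<lambda>j. y ^ j) m w \<longleftrightarrow> (\<exists>q. q \<noteq> 0 \<and> ev q x * w \<in> coord_ring)"
  unfolding spanned_def coord_ring_def by blast

lemma spannedI: "q \<noteq> 0 \<Longrightarrow> ev q x * w \<in> coord_ring \<Longrightarrow> spanned x (\<lambda>j. y ^ j) m w"
  unfolding spanned_iff by blast

lemma spanned_subfield: "is_subfield {w. spanned x (\<lambda>j. y ^ j) m w}"
proof -
  let ?sp = "spanned x (\<lambda>j. y ^ j) m"
  have in_ring: "?sp w" if "w \<in> coord_ring" for w using that by (intro spannedI[of 1]) simp_all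
  have one: "1 \<in> coord_ring" using coord_ring_power[OF m_pos] by simp
  have add: "?sp (v + w)" and mult: "?sp (v * w)" if vw: "?sp v" "?sp w" for v w
  proof -
    obtain q where q: "q \<noteq> 0" "ev q x * v \<in> coord_ring" using vw(1) unfolding spanned_iff by blast
    obtain r where r: "r \<noteq> 0" "ev r x * w \<in> coord_ring" using vw(2) unfolding spanned_iff by blast
    have "ev (q * r) x * (v + w) = ev r x * (ev q x * v) + ev q x * (ev r x * w)"
      by (simp add: algebra_simps)
    also have "\<dots> \<in> coord_ring" by (rule coord_ring_add[OF coord_ring_ev[OF q(2)] coord_ring_ev[OF r(2)]])
    finally show "?sp (v + w)" using q(1) r(1) by (intro spannedI[of "q * r"]) simp_all
    have "ev (q * r) x * (v * w) = (ev q x * v) * (ev r x * w)" by (simp add: mult_ac)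
    also have "\<dots> \<in> coord_ring" by (rule coord_ring_mult[OF q(2) r(2)])
    finally show "?sp (v * w)" using q(1) r(1) by (intro spannedI[of "q * r"]) simp_all
  qed
  have ev: "?sp (ev p x)" for p using in_ring[OF coord_ring_ev[OF one, of p]] by simp
  have zero: "?sp 0" using in_ring[OF coord_ring_0] .
  have pow: "?sp (w ^ i)" if "?sp w" for w i
    by (induction i) (use that mult in_ring[OF one] in auto)
  have inv: "?sp (inverse w)" if w: "?sp w" for w
  proof (cases "w = 0")
    case False
    show ?thesis
      by (rule spanned_inverse[OF transcendental_x pow[OF w] False add mult[OF ev] zero])
  qed (use zero in simp)
  have neg: "?sp (- w)" if "?sp w" for w using mult[OF ev[of "[:- 1:]"] that] by simp
  show ?thesis unfolding is_subfield_def mem_Collect_eq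
    using zero in_ring[OF one] add mult inv neg by (intro conjI ballI) simp_all
qed

lemma F_spanned: "w \<in> F \<Longrightarrow> spanned x (\<lambda>j. y ^ j) m w"
proof -
  have one: "1 \<in> coord_ring" using coord_ring_power[OF m_pos] by simp
  have const: "ev p x \<in> coord_ring" for p using coord_ring_ev[OF one, of p] by simp
  have ring: "w \<in> {w. spanned x (\<lambda>j. y ^ j) m w}" if "w \<in> coord_ring" for w
    using that spannedI[of 1 w] by simp
  have "F \<subseteq> {w. spanned x (\<lambda>j. y ^ j) m w}"
    unfolding F_eq
  proof (rule adjoin_minimal[OF spanned_subfield], rule subsetI)
    fix w assume "w \<in> range \<iota> \<union> {x, y}"
    then consider c where "w = \<iota> c" | "w = x" | "w = y" by blast
    then show "w \<in> {w. spanned x (\<lambda>j. y ^ j) m w}"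
    proof cases
      case 1
      then show ?thesis using ring[OF const[of "[:c:]"]] by simp
    next
      case 2
      then show ?thesis using ring[OF const[of "[:0, 1:]"]] by simp
    next
      case 3
      then show ?thesis using ring[OF coord_ring_y[OF one]] by simp
    qed
  qed
  then show "w \<in> F \<Longrightarrow> spanned x (\<lambda>j. y ^ j) m w" by blast
qed

lemma generators_in_F: "x \<in> F" "y \<in> F"
  using adjoin_superset[of "{x, y}"] unfolding F_eq by auto

sublocale function_field \<iota> F x "\<lambda>j. y ^ j" m
proof unfold_locales
  show "is_subfield F" unfolding F_eq by (rule adjoin_subfield)
  show "range \<iota> \<subseteq> F" using adjoin_superset[of "{x, y}"] unfolding F_eq by blast
  show "transcendental_over \<iota> x" by (rule transcendental_x)
  show "x \<in> F" by (rule generators_in_F)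
qed (rule F_spanned)

lemma E_subfield: "is_subfield E"
  unfolding E_eq by (rule adjoin_subfield)

lemma E_subset_F: "E \<subseteq> F"
  unfolding E_eq using adjoin_minimal[OF F_subfield, of "{x}"] K_subset_F x_in_F by blast

lemma ev_in_E: "ev p x \<in> E"
  using adjoin_superset[of "{x}"] unfolding E_eq
  by (intro ev_in_subfield[OF adjoin_subfield]) auto

lemma E_fractions:
  assumes "w \<in> E"
  shows "\<exists>p q. q \<noteq> 0 \<and> w = ev p x / ev q x"
proof -
  define S where "S = {w. \<exists>p q. q \<noteq> 0 \<and> w = ev p x / ev q x}"
  have SI: "w \<in> S" if "q \<noteq> 0" "w = ev p x / ev q x" for w p q using that unfolding S_def by blast
  have "is_subfield S" unfolding is_subfield_def
  proof (intro conjI ballI)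
    show "0 \<in> S" by (rule SI[of 1 _ 0]) simp_all
    show "1 \<in> S" by (rule SI[of 1 _ 1]) simp_all
    fix v assume "v \<in> S"
    then obtain p q where v: "q \<noteq> 0" "v = ev p x / ev q x" unfolding S_def by blast
    show "- v \<in> S" by (rule SI[of q _ "- p"]) (simp_all add: v)
    show "inverse v \<in> S"
    proof (cases "p = 0")
      case True
      then show ?thesis by (intro SI[of 1 _ 0]) (simp_all add: v)
    next
      case False
      then show ?thesis by (intro SI[of p _ q]) (simp_all add: v)
    qed
    fix w assume "w \<in> S"
    then obtain p' q' where w: "q' \<noteq> 0" "w = ev p' x / ev q' x" unfolding S_def by blast
    show "v + w \<in> S"
      by (rule SI[of "q * q'" _ "p * q' + p' * q"]) (use v w in \<open>simp_all add: add_frac_eq\<close>)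
    show "v * w \<in> S" by (rule SI[of "q * q'" _ "p * p'"]) (use v w in simp_all)
  qed
  moreover have "range \<iota> \<union> {x} \<subseteq> S"
  proof
    fix w assume "w \<in> range \<iota> \<union> {x}"
    then consider c where "w = \<iota> c" | "w = x" by blast
    then show "w \<in> S"
    proof cases
      case 1
      then show ?thesis by (intro SI[of 1 _ "[:c:]"]) simp_all
    next
      case 2
      then show ?thesis by (intro SI[of 1 _ "[:0, 1:]"]) simp_all
    qed
  qed
  ultimately have "E \<subseteq> S" unfolding E_eq by (rule adjoin_minimal)
  then show ?thesis using assms unfolding S_def by blast
qed

lemma F_expansion:
  assumes "w \<in> F"
  shows "\<exists>u. (\<forall>j. u j \<in> E) \<and> w = (\<Sum>j<m. u j * y ^ j)"
proof -
  obtain q u where q: "q \<noteq> 0" "ev q x * w = (\<Sum>j<m. ev (u j) x * y ^ j)"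
    using F_spanned[OF assms] unfolding spanned_def by blast
  have "w = (ev q x * w) / ev q x" using q(1) by simp
  also have "\<dots> = (\<Sum>j<m. ev (u j) x / ev q x * y ^ j)"
    unfolding q(2) by (simp add: sum_divide_distrib)
  finally have "w = (\<Sum>j<m. ev (u j) x / ev q x * y ^ j)" .
  moreover have "ev (u j) x / ev q x \<in> E" for j
    by (rule is_subfieldD(8)[OF E_subfield ev_in_E ev_in_E])
  ultimately show ?thesis by (intro exI[of _ "\<lambda>j. ev (u j) x / ev q x"]) simp
qed

subsection \<open>Total ramification\<close>

text \<open>
  The rational places of \<open>K(x)\<close> enter through a uniformizer \<open>\<tau>\<close>, namely \<open>x - c\<close> or \<open>1/x\<close>:
  nonzero elements of \<open>E\<close> are \<open>\<tau>\<^sup>k v\<close> with a \<open>v\<close> that has a nonzero constant residue.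
\<close>

definition has_order :: "'a \<Rightarrow> 'a \<Rightarrow> int \<Rightarrow> bool" where
  "has_order \<tau> u k \<longleftrightarrow> (\<exists>v c. c \<noteq> 0 \<and> u = \<tau> powi k * v \<and> (\<forall>P\<in>places \<iota> F. \<tau> \<in> P \<longrightarrow> v - \<iota> c \<in> P))"

lemma residue_unit:
  assumes P: "P \<in> places \<iota> F" and v: "v - \<iota> c \<in> P" "c \<noteq> 0"
  shows "v \<in> loc P - P"
proof -
  have "\<iota> c \<in> loc P - P" using v(2) place_iota[OF P] loc_iota[OF P] by blast
  from unit_plus_place[OF P this v(1)] show ?thesis by simp
qed

lemma has_order_divide:
  assumes \<tau>: "\<tau> \<noteq> 0" and u: "has_order \<tau> u k" and u': "has_order \<tau> u' k'"
  shows "has_order \<tau> (u / u') (k - k')"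
proof -
  obtain v c where v: "c \<noteq> 0" "u = \<tau> powi k * v" "\<forall>P\<in>places \<iota> F. \<tau> \<in> P \<longrightarrow> v - \<iota> c \<in> P"
    using u unfolding has_order_def by blast
  obtain v' c' where v': "c' \<noteq> 0" "u' = \<tau> powi k' * v'" "\<forall>P\<in>places \<iota> F. \<tau> \<in> P \<longrightarrow> v' - \<iota> c' \<in> P"
    using u' unfolding has_order_def by blast
  have "v / v' - \<iota> (c * inverse c') \<in> P" if P: "P \<in> places \<iota> F" "\<tau> \<in> P" for P
  proof -
    have 1: "v - \<iota> c \<in> P" "v' - \<iota> c' \<in> P" using v(3) v'(3) P by blast+
    have unit: "v' \<in> loc P - P" by (rule residue_unit[OF P(1) 1(2) v'(1)])
    have nz: "v' \<noteq> 0" using unit place_0[OF P(1)] by blast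
    have "v / v' - \<iota> c / \<iota> c' = (inverse (\<iota> c') * inverse v') * (\<iota> c' * (v - \<iota> c) - \<iota> c * (v' - \<iota> c'))"
      using nz v'(1) by (simp add: divide_simps) (simp add: algebra_simps)
    then have eq: "v / v' - \<iota> (c * inverse c')
        = (\<iota> (inverse c') * inverse v') * (\<iota> c' * (v - \<iota> c) - \<iota> c * (v' - \<iota> c'))"
      by (simp only: iota_simps divide_inverse)
    have "\<iota> (inverse c') * inverse v' \<in> loc P"
      by (rule loc_mult[OF P(1) loc_iota[OF P(1)]]) (use unit_inverse[OF P(1)] unit in blast)
    then show ?thesis unfolding eq
      by (rule place_mult[OF P(1)]) (intro place_diff[OF P(1)] place_mult[OF P(1) loc_iota[OF P(1)]] 1)
  qed
  moreover have "u / u' = \<tau> powi (k - k') * (v / v')"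
    by (simp add: v(2) v'(2) power_int_diff \<tau>)
  moreover have "c * inverse c' \<noteq> 0" using v(1) v'(1) by simp
  ultimately show ?thesis unfolding has_order_def by blast
qed

lemma ev_minus_residue:
  assumes P: "P \<in> places \<iota> F" and x: "x - \<iota> c \<in> P"
  shows "ev p x - \<iota> (poly p c) \<in> P"
proof -
  have xl: "x \<in> loc P"
    using loc_add[OF P, of "x - \<iota> c" "\<iota> c"] loc_iota[OF P] x place_subset_loc[OF P] by auto
  have "poly (p - [:poly p c:]) c = 0" by simp
  then obtain s where s: "p - [:poly p c:] = [:- c, 1:] * s" unfolding poly_eq_0_iff_dvd by (elim dvdE)
  have "ev p x - \<iota> (poly p c) = ev (p - [:poly p c:]) x" by simp
  also have "\<dots> = ev s x * (x - \<iota> c)" unfolding s by (simp add: algebra_simps)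
  also have "\<dots> \<in> P" by (rule place_mult[OF P loc_ev[OF P xl] x])
  finally show ?thesis .
qed

lemma poly_has_order_finite:
  assumes "p \<noteq> 0"
  shows "\<exists>k. has_order (x - \<iota> c) (ev p x) k"
proof -
  obtain r where r: "p = [:- c, 1:] ^ order c p * r" "\<not> [:- c, 1:] dvd r"
    using order_decomp[OF assms] by blast
  have "ev p x = ev ([:- c, 1:] ^ order c p) x * ev r x" by (subst r(1)) simp
  also have "\<dots> = (x - \<iota> c) powi int (order c p) * ev r x" by simp
  finally have "ev p x = (x - \<iota> c) powi int (order c p) * ev r x" .
  moreover have "poly r c \<noteq> 0" using r(2) by (simp add: poly_eq_0_iff_dvd)
  ultimately show ?thesis unfolding has_order_def using ev_minus_residue by blast
qed

lemma poly_has_order_infinite: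
  assumes "p \<noteq> 0"
  shows "\<exists>k. has_order (inverse x) (ev p x) k"
proof -
  obtain c r where cr: "reflect_poly p = pCons c r" by (cases "reflect_poly p")
  have c: "c \<noteq> 0" using coeff_0_reflect_poly[of p] assms by (simp add: cr)
  have "ev (reflect_poly p) (inverse x) = inverse x ^ degree p * ev p x"
    using ev_reflect_poly[of "inverse x" p] by simp
  then have "ev p x = inverse x powi (- int (degree p)) * ev (reflect_poly p) (inverse x)"
    by (simp add: power_int_minus)
  moreover have "ev (reflect_poly p) (inverse x) - \<iota> c \<in> P" if P: "P \<in> places \<iota> F" "inverse x \<in> P" for P
  proof -
    have "ev r (inverse x) * inverse x \<in> P"
      using place_subset_loc[OF P(1)] P(2) by (intro place_mult[OF P(1) _ P(2)] loc_ev[OF P(1)]) blast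
    then show ?thesis by (simp add: cr mult.commute)
  qed
  ultimately show ?thesis unfolding has_order_def using c by blast
qed

definition base_uniformizer :: "'a \<Rightarrow> bool" where
  "base_uniformizer \<tau> \<longleftrightarrow> \<tau> = inverse x \<or> (\<exists>c. \<tau> = x - \<iota> c)"

lemma base_uniformizer_in_F:
  assumes "base_uniformizer \<tau>"
  shows "\<tau> \<in> F" "\<tau> \<noteq> 0"
proof -
  have "x \<noteq> \<iota> c" for c using ev_eq_0_iff[of "[:- c, 1:]"] by auto
  then show "\<tau> \<in> F" "\<tau> \<noteq> 0" using assms x_in_F unfolding base_uniformizer_def by auto
qed

lemma E_has_order:
  assumes \<tau>: "base_uniformizer \<tau>" and u: "u \<in> E" "u \<noteq> 0"
  shows "\<exists>k. has_order \<tau> u k"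
proof -
  obtain p q where pq: "q \<noteq> 0" "u = ev p x / ev q x" using E_fractions[OF u(1)] by blast
  have p: "p \<noteq> 0" using pq u(2) by auto
  have *: "\<exists>k. has_order \<tau> (ev r x) k" if "r \<noteq> 0" for r
    using \<tau> poly_has_order_finite[OF that] poly_has_order_infinite[OF that]
    unfolding base_uniformizer_def by blast
  obtain k k' where "has_order \<tau> (ev p x) k" "has_order \<tau> (ev q x) k'" using *[OF p] *[OF pq(1)] by blast
  then have "has_order \<tau> (ev p x / ev q x) (k - k')"
    by (rule has_order_divide[OF base_uniformizer_in_F(2)[OF \<tau>]])
  then show ?thesis using pq(2) by blast
qed

lemma val_of_has_order:
  assumes \<tau>: "base_uniformizer \<tau>" and u: "has_order \<tau> u k" and P: "P \<in> places \<iota> F" "\<tau> \<in> P"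
  shows "val F P u = k * val F P \<tau>"
proof -
  have d: "discrete_place P" by (rule all_places_discrete[OF P(1)])
  obtain v c where v: "c \<noteq> 0" "u = \<tau> powi k * v" "v - \<iota> c \<in> P"
    using u P unfolding has_order_def by blast
  have unit: "v \<in> loc P - P" by (rule residue_unit[OF P(1) v(3,1)])
  have "v \<in> F" "v \<noteq> 0" using unit loc_subset_F[OF P(1)] place_0[OF P(1)] by blast+
  moreover have "\<tau> powi k \<in> F" "\<tau> powi k \<noteq> 0" using base_uniformizer_in_F[OF \<tau>] by auto
  ultimately have "val F P u = val F P (\<tau> powi k) + val F P v"
    unfolding v(2) by (intro val_mult[OF d])
  then show ?thesis
    using val_unit[OF d unit] val_powi[OF d base_uniformizer_in_F[OF \<tau>]] by simp
qed

text \<open>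
  At a place over \<open>\<tau>\<close> with \<open>m v(y) = e v(\<tau>)\<close> and \<open>e\<close> prime to \<open>m\<close>, the terms of \<open>\<Sum> u\<^sub>j y\<^sup>j\<close> have
  valuations in different classes modulo \<open>m\<close>.  So the valuation of the sum is the minimum, which
  determines the place, makes \<open>1, y, \<dots>, y\<^sup>m\<^sup>-\<^sup>1\<close> independent over \<open>E\<close>, and shows \<open>v(\<tau>) = m\<close>.
\<close>

lemma total_ramification:
  assumes \<tau>: "base_uniformizer \<tau>" and P: "P \<in> places \<iota> F" "\<tau> \<in> P"
    and y: "int m * val F P y = e * val F P \<tau>" and e: "coprime e (int m)"
  shows "val F P \<tau> = int m" "val F P y = e"
    and "\<And>u i j. u i \<in> E \<Longrightarrow> u j \<in> E \<Longrightarrow> u i \<noteq> 0 \<Longrightarrow> u j \<noteq> 0 \<Longrightarrow> i < m \<Longrightarrow> j < m \<Longrightarrow> i \<noteq> j \<Longrightarrow>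
      val F P (u i * y ^ i) \<noteq> val F P (u j * y ^ j)"
proof -
  have d: "discrete_place P" by (rule all_places_discrete[OF P(1)])
  have \<tau>F: "\<tau> \<in> F" "\<tau> \<noteq> 0" using base_uniformizer_in_F[OF \<tau>] by blast+
  have pos: "val F P \<tau> > 0" using place_iff_val[OF d \<tau>F] P(2) by blast
  have "int m dvd e * val F P \<tau>" using y by (metis dvd_triv_left)
  then have "int m dvd val F P \<tau>" using e by (simp add: coprime_dvd_mult_right_iff coprime_commute)
  then obtain r where r: "val F P \<tau> = int m * r" by (elim dvdE)
  have yr: "val F P y = e * r"
  proof -
    have "int m * val F P y = int m * (e * r)" using y r by simp
    then show ?thesis using m_pos by simp
  qed
  have rpos: "r > 0" using pos r m_pos by (simp add: zero_less_mult_iff)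
  have trm: "\<exists>k. val F P (u * y ^ j) = r * (int m * k + int j * e)" if u: "u \<in> E" "u \<noteq> 0" for u j
  proof -
    obtain k where k: "has_order \<tau> u k" using E_has_order[OF \<tau> u] by blast
    have "u \<in> F" using u E_subset_F by blast
    then have "val F P (u * y ^ j) = val F P u + int j * val F P y"
      using u generators_in_F d by simp
    then show ?thesis
      using val_of_has_order[OF \<tau> k P] r yr by (intro exI[of _ k]) (simp add: algebra_simps)
  qed
  have distinct: "val F P (u i * y ^ i) \<noteq> val F P (u j * y ^ j)"
    if u: "u i \<in> E" "u j \<in> E" "u i \<noteq> 0" "u j \<noteq> 0" and ij: "i < m" "j < m" "i \<noteq> j" for u :: "nat \<Rightarrow> 'a" and i j
  proof
    assume eq: "val F P (u i * y ^ i) = val F P (u j * y ^ j)"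
    obtain k where k: "val F P (u i * y ^ i) = r * (int m * k + int i * e)" using trm[OF u(1,3)] by blast
    obtain l where l: "val F P (u j * y ^ j) = r * (int m * l + int j * e)" using trm[OF u(2,4)] by blast
    have "int m * k + int i * e = int m * l + int j * e" using eq k l rpos by simp
    then have "(int i - int j) * e = int m * (l - k)" by (simp add: algebra_simps)
    then have "int m dvd (int i - int j) * e" by simp
    then have "int m dvd int i - int j" using e by (simp add: coprime_dvd_mult_left_iff coprime_commute)
    then have "int m \<le> \<bar>int i - int j\<bar>" using ij(3) by (intro zdvd_imp_le) (auto simp: dvd_abs_iff)
    then show False using ij by linarith
  qed
  then show "\<And>u i j. u i \<in> E \<Longrightarrow> u j \<in> E \<Longrightarrow> u i \<noteq> 0 \<Longrightarrow> u j \<noteq> 0 \<Longrightarrow> i < m \<Longrightarrow> j < m \<Longrightarrow> i \<noteq> j \<Longrightarrow>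
      val F P (u i * y ^ i) \<noteq> val F P (u j * y ^ j)" by blast
  obtain t where t: "t \<in> F" "t \<noteq> 0" "val F P t = 1" using uniformizer[OF d] by blast
  obtain u where u: "\<forall>j. u j \<in> E" "t = (\<Sum>j<m. u j * y ^ j)" using F_expansion[OF t(1)] by blast
  have inF: "u j * y ^ j \<in> F" for j
    using u(1) E_subset_F generators_in_F by (intro F_closed(4) F_closed(9)) blast+
  have "\<exists>j\<in>{..<m}. u j * y ^ j \<noteq> 0 \<and> val F P (\<Sum>j<m. u j * y ^ j) = val F P (u j * y ^ j)"
  proof (rule val_sum_ge_iff_distinct(3)[OF d])
    show "val F P (u i * y ^ i) \<noteq> val F P (u j * y ^ j)"
      if "i \<in> {..<m}" "j \<in> {..<m}" "i \<noteq> j" "u i * y ^ i \<noteq> 0" "u j * y ^ j \<noteq> 0" for i j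
      using distinct[of u i j] u(1) that by simp
  qed (use inF u(2) t(2) in auto)
  then obtain j where j: "u j * y ^ j \<noteq> 0" "1 = val F P (u j * y ^ j)" using t(3) u(2) by metis
  then obtain k where "1 = r * (int m * k + int j * e)" using trm[of "u j" j] u(1) by auto
  then have "r dvd 1" by (metis dvd_triv_left)
  then have "r = 1" using rpos by simp
  then show "val F P \<tau> = int m" "val F P y = e" using r yr by simp_all
qed

end

context kummer_extension begin

definition ramified :: "'a \<Rightarrow> int \<Rightarrow> 'a set \<Rightarrow> bool" where
  "ramified \<tau> e P \<longleftrightarrow> base_uniformizer \<tau> \<and> P \<in> places \<iota> F \<and> \<tau> \<in> P \<and>
     int m * val F P y = e * val F P \<tau> \<and> coprime e (int m)"

lemma ramified_place: "ramified \<tau> e P \<Longrightarrow> P \<in> places \<iota> F"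
  by (simp add: ramified_def)

lemma ramified_val:
  assumes "ramified \<tau> e P"
  shows "val F P \<tau> = int m" "val F P y = e"
  using total_ramification(1,2)[of \<tau> P e] assms unfolding ramified_def by simp_all

lemma E_term_in_F: "u \<in> E \<Longrightarrow> u * y ^ j \<in> F"
  using E_subset_F generators_in_F(2) by (intro F_closed(4) F_closed(9)) blast+

lemma ramified_sum:
  assumes r: "ramified \<tau> e P" and u: "\<forall>j. u j \<in> E"
  shows "(\<Sum>j<m. u j * y ^ j) \<in> val_ge P k \<longleftrightarrow> (\<forall>j<m. u j * y ^ j \<in> val_ge P k)"
    and "(\<Sum>j<m. u j * y ^ j) = 0 \<longleftrightarrow> (\<forall>j<m. u j = 0)"
proof -
  have d: "discrete_place P" by (rule all_places_discrete[OF ramified_place[OF r]])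
  have distinct: "val F P (u i * y ^ i) \<noteq> val F P (u j * y ^ j)"
    if "i \<in> {..<m}" "j \<in> {..<m}" "i \<noteq> j" "u i * y ^ i \<noteq> 0" "u j * y ^ j \<noteq> 0" for i j
    using total_ramification(3)[of \<tau> P e u i j] r u that unfolding ramified_def by simp
  note dist = val_sum_ge_iff_distinct[OF d finite_lessThan E_term_in_F distinct]
  have "(\<Sum>j<m. u j * y ^ j) \<in> val_ge P k \<longleftrightarrow> (\<forall>j\<in>{..<m}. u j * y ^ j \<in> val_ge P k)"
    by (rule dist(1)) (use u in blast)
  then show "(\<Sum>j<m. u j * y ^ j) \<in> val_ge P k \<longleftrightarrow> (\<forall>j<m. u j * y ^ j \<in> val_ge P k)"
    by (simp only: Ball_def lessThan_iff)
  have "(\<Sum>j<m. u j * y ^ j) = 0 \<longleftrightarrow> (\<forall>j\<in>{..<m}. u j * y ^ j = 0)"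
    by (rule dist(2)) (use u in blast)
  then show "(\<Sum>j<m. u j * y ^ j) = 0 \<longleftrightarrow> (\<forall>j<m. u j = 0)"
    by (simp only: Ball_def lessThan_iff) simp
qed

lemma ramified_val_term:
  assumes r: "ramified \<tau> e P" and u: "u \<in> E" "u \<noteq> 0" "has_order \<tau> u k"
  shows "val F P (u * y ^ j) = k * int m + int j * e"
proof -
  have d: "discrete_place P" by (rule all_places_discrete[OF ramified_place[OF r]])
  have "val F P u = k * val F P \<tau>"
    using val_of_has_order[of \<tau> u k P] r u(3) unfolding ramified_def by blast
  moreover have "u \<in> F" using u(1) E_subset_F by blast
  ultimately show ?thesis
    using u(2) generators_in_F(2) ramified_val[OF r] by (simp add: val_mult[OF d] val_power[OF d])
qed

text \<open>
  The criterion for \<open>\<Sum> u\<^sub>j y\<^sup>j \<in> P\<close> involves only the orders of the \<open>u\<^sub>j\<close> at \<open>\<tau>\<close>.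
\<close>

lemma ramified_unique:
  assumes P: "ramified \<tau> e P" and P': "ramified \<tau> e P'"
  shows "P = P'"
proof -
  have sub: "P1 \<subseteq> P2" if r: "ramified \<tau> e P1" "ramified \<tau> e P2" for P1 P2
  proof
    have \<tau>: "base_uniformizer \<tau>" using P by (simp add: ramified_def)
    fix z assume "z \<in> P1"
    then have z: "z \<in> val_ge P1 1" using place_eq_val_ge[OF all_places_discrete[OF ramified_place[OF r(1)]]] by blast
    then have "z \<in> F" by (simp add: val_ge_def)
    then obtain u where u: "\<forall>j. u j \<in> E" "z = (\<Sum>j<m. u j * y ^ j)" using F_expansion by blast
    have "u j * y ^ j \<in> val_ge P2 1" if j: "j < m" for j
    proof (cases "u j = 0")
      case True
      then show ?thesis using val_ge_0[OF all_places_discrete[OF ramified_place[OF r(2)]]] by simp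
    next
      case False
      then obtain k where k: "has_order \<tau> (u j) k" using E_has_order[OF \<tau>] u(1) by blast
      have "val F P1 (u j * y ^ j) = val F P2 (u j * y ^ j)"
        using ramified_val_term[OF r(1) _ False k] ramified_val_term[OF r(2) _ False k] u(1) by simp
      moreover have "u j * y ^ j \<in> val_ge P1 1"
        using ramified_sum(1)[OF r(1) u(1)] z u(2) j by blast
      ultimately show ?thesis by (simp add: val_ge_def)
    qed
    then have "z \<in> val_ge P2 1" using ramified_sum(1)[OF r(2) u(1)] u(2) by blast
    then show "z \<in> P2" using place_eq_val_ge[OF all_places_discrete[OF ramified_place[OF r(2)]]] by blast
  qed
  show ?thesis using sub[OF P P'] sub[OF P' P] by (rule subset_antisym)
qed

text \<open>The term \<open>u\<^sub>0\<close> is the only one of valuation divisible by \<open>m\<close>, and its residue is constant.\<close>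

lemma ramified_degree:
  assumes r: "ramified \<tau> e P"
  shows "place_degree \<iota> F P = 1"
proof -
  have PP: "P \<in> places \<iota> F" by (rule ramified_place[OF r])
  have d: "discrete_place P" by (rule all_places_discrete[OF PP])
  have \<tau>: "base_uniformizer \<tau>" "\<tau> \<in> P" and e: "coprime e (int m)" using r by (simp_all add: ramified_def)
  have residue: "\<exists>c. z - \<iota> c \<in> P" if z: "z \<in> loc P" for z
  proof -
    have "z \<in> F" using z loc_subset_F[OF PP] by blast
    then obtain u where u: "\<forall>j. u j \<in> E" "z = (\<Sum>j<m. u j * y ^ j)" using F_expansion by blast
    have "z \<in> val_ge P 0" using z loc_eq_val_ge[OF d] by blast
    then have ge: "u j * y ^ j \<in> val_ge P 0" if "j < m" for j
      using ramified_sum(1)[OF r u(1)] u(2) that by blast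
    have "u j * y ^ j \<in> P" if j: "j \<in> {1..<m}" for j
    proof (cases "u j = 0")
      case False
      have uE: "u j \<in> E" using u(1) by blast
      obtain k where k: "has_order \<tau> (u j) k" using E_has_order[OF \<tau>(1) uE False] by blast
      have v: "val F P (u j * y ^ j) = k * int m + int j * e" by (rule ramified_val_term[OF r uE False k])
      have nz: "u j * y ^ j \<noteq> 0" using False by simp
      have "val F P (u j * y ^ j) \<noteq> 0"
      proof
        assume "val F P (u j * y ^ j) = 0"
        then have "int j * e = int m * (- k)" using v by (simp add: eq_neg_iff_add_eq_0 add.commute mult.commute)
        then have "int m dvd int j * e" by (rule dvdI)
        then have "int m dvd int j" using e by (simp add: coprime_dvd_mult_left_iff coprime_commute)
        then have "m dvd j" by simp
        then have "m \<le> j" using j by (intro dvd_imp_le) auto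
        then show False using j by simp
      qed
      moreover have "0 \<le> val F P (u j * y ^ j)" using ge[of j] j nz by (simp add: val_ge_def)
      ultimately have "0 < val F P (u j * y ^ j)" by simp
      then show ?thesis using place_iff_val[OF d E_term_in_F[OF uE] nz] by blast
    qed (use place_0[OF PP] in simp)
    then have rest: "(\<Sum>j\<in>{1..<m}. u j * y ^ j) \<in> P" by (rule place_sum[OF PP])
    have z_eq: "z = u 0 + (\<Sum>j\<in>{1..<m}. u j * y ^ j)"
      unfolding u(2) using m_pos by (simp add: lessThan_atLeast0 sum.atLeast_Suc_lessThan)
    have "\<exists>c. u 0 - \<iota> c \<in> P"
    proof (cases "u 0 = 0")
      case True
      then show ?thesis using place_0[OF PP] by (intro exI[of _ 0]) simp
    next
      case False
      have uE: "u 0 \<in> E" using u(1) by blast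
      obtain k where k: "has_order \<tau> (u 0) k" using E_has_order[OF \<tau>(1) uE False] by blast
      have v: "val F P (u 0) = k * int m" using ramified_val_term[OF r uE False k, of 0] by simp
      have "0 \<le> val F P (u 0)" using ge[of 0] m_pos False by (simp add: val_ge_def)
      then have "k \<ge> 0" using v m_pos by (simp add: zero_le_mult_iff)
      show ?thesis
      proof (cases "k = 0")
        case True
        then show ?thesis using k \<tau>(2) PP unfolding has_order_def by auto
      next
        case nk: False
        then have "0 < val F P (u 0)" using v \<open>k \<ge> 0\<close> m_pos by simp
        moreover have "u 0 \<in> F" using uE E_subset_F by blast
        ultimately have "u 0 \<in> P" using place_iff_val[OF d] False by blast
        then show ?thesis by (intro exI[of _ 0]) simp
      qed
    qed
    then obtain c where "u 0 - \<iota> c \<in> P" by blast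
    from place_add[OF PP this rest] show ?thesis by (intro exI[of _ c]) (simp add: z_eq algebra_simps)
  qed
  have "has_qdim (range \<iota>) (loc P) P 1" unfolding has_qdim_def
  proof (intro exI[of _ "{1}"] conjI)
    show "{1} \<subseteq> loc P" using loc_1[OF PP] by simp
    show "indep_mod (range \<iota>) P {1}" unfolding indep_mod_def
    proof (intro conjI allI impI)
      fix c assume c: "\<forall>b\<in>{1}. c b \<in> range \<iota>" "(\<Sum>b\<in>{1}. c b * b) \<in> P"
      then obtain e where "c 1 = \<iota> e" by blast
      then show "\<forall>b\<in>{1}. c b = 0" using c(2) place_iota[OF PP, of e] by simp
    qed simp
    show "spans_mod (range \<iota>) P {1} (loc P)" unfolding spans_mod_def
    proof
      fix z assume "z \<in> loc P"
      then obtain c where "z - \<iota> c \<in> P" using residue by blast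
      then show "\<exists>c. (\<forall>b\<in>{1}. c b \<in> range \<iota>) \<and> z - (\<Sum>b\<in>{1}. c b * b) \<in> P"
        by (intro exI[of _ "\<lambda>_. \<iota> c"]) simp
    qed
  qed simp
  then show ?thesis
    using has_qdim_unique[OF K_subfield subspace_place[OF PP] has_qdim_place_degree[OF PP]] by blast
qed

text \<open>
  A single totally ramified place makes the powers of \<open>y\<close> independent over \<open>E\<close>.
\<close>

lemma ext_degree_eq:
  assumes r: "ramified \<tau> e P"
  shows "ext_degree F E = m"
proof -
  have indep: "\<forall>j\<in>{..<m}. c j = 0" if c: "\<forall>j\<in>{..<m}. c j \<in> E" "(\<Sum>j<m. c j * y ^ j) = 0" for c
  proof -
    define u where "u = (\<lambda>j. if j < m then c j else 0)"
    have u: "\<forall>j. u j \<in> E" using c(1) is_subfieldD(1)[OF E_subfield] by (simp add: u_def)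
    have "(\<Sum>j<m. u j * y ^ j) = 0" using c(2) by (simp add: u_def)
    then have "\<forall>j<m. u j = 0" using ramified_sum(2)[OF r u] by blast
    then show ?thesis by (simp add: u_def)
  qed
  note family = indep_family[OF E_subfield finite_lessThan indep]
  have inj: "inj_on (\<lambda>j. y ^ j) {..<m}" by (rule family(1))
  have "has_qdim E F {0} m" unfolding has_qdim_def
  proof (intro exI[of _ "(\<lambda>j. y ^ j) ` {..<m}"] conjI)
    show "(\<lambda>j. y ^ j) ` {..<m} \<subseteq> F" using generators_in_F(2) by (intro image_subsetI F_closed(9))
    show "indep_mod E {0} ((\<lambda>j. y ^ j) ` {..<m})" by (rule family(2))
    show "card ((\<lambda>j. y ^ j) ` {..<m}) = m" using card_image[OF inj] by simp
    show "spans_mod E {0} ((\<lambda>j. y ^ j) ` {..<m}) F" unfolding spans_mod_def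
    proof
      fix z assume "z \<in> F"
      then obtain u where u: "\<forall>j. u j \<in> E" "z = (\<Sum>j<m. u j * y ^ j)" using F_expansion by blast
      define c where "c = (\<lambda>b. u (the_inv_into {..<m} (\<lambda>j. y ^ j) b))"
      have "(\<Sum>b\<in>(\<lambda>j. y ^ j) ` {..<m}. c b * b) = (\<Sum>j<m. c (y ^ j) * y ^ j)"
        by (simp add: sum.reindex[OF inj])
      also have "\<dots> = (\<Sum>j<m. u j * y ^ j)"
        by (rule sum.cong) (simp_all add: c_def the_inv_into_f_f[OF inj])
      finally have "z - (\<Sum>b\<in>(\<lambda>j. y ^ j) ` {..<m}. c b * b) \<in> {0}" using u(2) by simp
      moreover have "\<forall>b\<in>(\<lambda>j. y ^ j) ` {..<m}. c b \<in> E" using u(1) by (simp add: c_def)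
      ultimately show "\<exists>c. (\<forall>b\<in>(\<lambda>j. y ^ j) ` {..<m}. c b \<in> E) \<and> z - (\<Sum>b\<in>(\<lambda>j. y ^ j) ` {..<m}. c b * b) \<in> {0}"
        by blast
    qed
  qed
  moreover have "subspace_over E F"
    unfolding subspace_over_def
    by (intro conjI ballI F_closed(1,3,4)) (use E_subset_F in blast)+
  moreover have "subspace_over E {0}" by (simp add: subspace_over_def)
  ultimately show ?thesis unfolding ext_degree_def by (intro quotient_dim_eq[OF E_subfield])
qed

lemma x_minus_in_F: "x - \<iota> c \<in> F" "x - \<iota> c \<noteq> 0"
  using base_uniformizer_in_F[of "x - \<iota> c"] unfolding base_uniformizer_def by blast+

lemma val_y_power:
  assumes P: "P \<in> places \<iota> F"
  shows "int m * val F P y = (\<Sum>k=1..n. val F P (x - \<iota> (a k)))"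
proof -
  have d: "discrete_place P" by (rule all_places_discrete[OF P])
  have "val F P (y ^ m) = (\<Sum>k=1..n. val F P (x - \<iota> (a k)))"
    unfolding kummer_eq by (rule val_prod[OF d finite_atLeastAtMost conjI[OF x_minus_in_F]])
  then show ?thesis using generators_in_F(2) d by simp
qed

lemma val_at_infinity:
  assumes P: "P \<in> places \<iota> F" "inverse x \<in> P"
  shows "val F P (x - \<iota> c) = val F P x" "val F P x < 0"
proof -
  have d: "discrete_place P" by (rule all_places_discrete[OF P(1)])
  have "0 < val F P (inverse x)" using place_iff_val[OF d, of "inverse x"] P(2) x_in_F x_nonzero by auto
  then show neg: "val F P x < 0" using x_in_F x_nonzero d by simp
  have "\<iota> (- c) \<in> val_ge P 0" using loc_eq_val_ge[OF d] loc_iota[OF P(1)] by blast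
  then have "\<iota> (- c) \<in> val_ge P (val F P x + 1)" by (rule val_ge_mono[OF d]) (use neg in simp)
  from val_add_eq(2)[OF d x_in_F x_nonzero this] show "val F P (x - \<iota> c) = val F P x" by simp
qed

lemma ramified_at_infinity:
  assumes P: "P \<in> places \<iota> F" "inverse x \<in> P"
  shows "ramified (inverse x) (- int n) P"
  unfolding ramified_def
proof (intro conjI P)
  show "base_uniformizer (inverse x)" by (simp add: base_uniformizer_def)
  have "int m * val F P y = int n * val F P x"
    unfolding val_y_power[OF P(1)] val_at_infinity(1)[OF P] by simp
  then show "int m * val F P y = - int n * val F P (inverse x)"
    using x_in_F x_nonzero all_places_discrete[OF P(1)] by simp
  show "coprime (- int n) (int m)" using coprime_mn by (simp add: coprime_commute)
qed

lemma ramified_at_root: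
  assumes P: "P \<in> places \<iota> F" "x - \<iota> (a i) \<in> P" and i: "i \<in> {1..n}"
  shows "ramified (x - \<iota> (a i)) 1 P"
  unfolding ramified_def
proof (intro conjI P)
  have d: "discrete_place P" by (rule all_places_discrete[OF P(1)])
  show "base_uniformizer (x - \<iota> (a i))" unfolding base_uniformizer_def by blast
  have zero: "val F P (x - \<iota> (a k)) = 0" if k: "k \<in> {1..n} - {i}" for k
  proof -
    have "a i \<noteq> a k" using inj_on_eq_iff[OF a_inj i, of k] k by blast
    then have "a i - a k \<noteq> 0" by simp
    moreover have "(x - \<iota> (a k)) - \<iota> (a i - a k) \<in> P" using P(2) by simp
    ultimately show ?thesis using val_unit[OF d residue_unit[OF P(1)]] by blast
  qed
  have "int m * val F P y = val F P (x - \<iota> (a i)) + (\<Sum>k\<in>{1..n} - {i}. val F P (x - \<iota> (a k)))"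
    unfolding val_y_power[OF P(1)] using i by (intro sum.remove) simp_all
  also have "(\<Sum>k\<in>{1..n} - {i}. val F P (x - \<iota> (a k))) = 0" using zero by (rule sum.neutral[OF ballI])
  finally show "int m * val F P y = 1 * val F P (x - \<iota> (a i))" by simp
qed simp

end

text \<open>The ramified places: \<open>Q\<^sub>0\<close> is the pole of \<open>x\<close>, and \<open>Q\<^sub>k\<close> is the zero of \<open>x - a\<^sub>k\<close>.\<close>

locale kummer_places = kummer_extension \<iota> x y a m n E F
  for \<iota> :: "'q::field \<Rightarrow> 'a::field" and x y a m n E F +
  fixes Q :: "nat \<Rightarrow> 'a set"
  assumes Q_infinity: "Q 0 \<in> places_over \<iota> F (place_at_infinity \<iota> x)"
    and Q_root: "\<And>k. k \<in> {1..n} \<Longrightarrow> Q k \<in> places_over \<iota> F (place_at \<iota> x (a k))"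
begin

lemma Q_place: "k \<le> n \<Longrightarrow> Q k \<in> places \<iota> F"
  using Q_infinity Q_root[of k] by (cases "k = 0") (simp_all add: places_over_def)

lemma inverse_x_in_Q: "inverse x \<in> Q 0"
proof -
  have "inverse x \<in> place_at_infinity \<iota> x"
    unfolding place_at_infinity_def mem_Collect_eq
    by (intro exI[of _ 1] exI[of _ "[:0, 1:]"]) (simp add: inverse_eq_divide)
  then show ?thesis using Q_infinity by (auto simp: places_over_def)
qed

lemma x_minus_in_Q:
  assumes k: "k \<in> {1..n}"
  shows "x - \<iota> (a k) \<in> Q k"
proof -
  have "x - \<iota> (a k) \<in> place_at \<iota> x (a k)"
    unfolding place_at_def mem_Collect_eq
    by (intro exI[of _ "[:- a k, 1:]"] exI[of _ 1]) simp
  then show ?thesis using Q_root[OF k] by (auto simp: places_over_def)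
qed

lemma ramified_Q: "ramified (inverse x) (- int n) (Q 0)" "k \<in> {1..n} \<Longrightarrow> ramified (x - \<iota> (a k)) 1 (Q k)"
  using ramified_at_infinity[OF Q_place inverse_x_in_Q] ramified_at_root[OF Q_place x_minus_in_Q] by auto

lemma Q_unique:
  assumes P: "P \<in> places \<iota> F"
  shows "inverse x \<in> P \<Longrightarrow> P = Q 0" "k \<in> {1..n} \<Longrightarrow> x - \<iota> (a k) \<in> P \<Longrightarrow> P = Q k"
  using ramified_unique[OF ramified_at_infinity[OF P] ramified_Q(1)]
    ramified_unique[OF ramified_at_root[OF P] ramified_Q(2)] by blast+

lemma Q_degree: "k \<le> n \<Longrightarrow> place_degree \<iota> F (Q k) = 1"
  using ramified_degree[OF ramified_Q(1)] ramified_degree[OF ramified_Q(2)[of k]] by (cases "k = 0") simp_all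

lemma x_in_loc: "P \<in> places \<iota> F \<Longrightarrow> P \<noteq> Q 0 \<Longrightarrow> x \<in> loc P"
  using in_loc_or_inverse[OF _ x_in_F] Q_unique(1) by blast

lemma val_Q0_x: "val F (Q 0) x = - int m"
  using ramified_val(1)[OF ramified_Q(1)] x_in_F x_nonzero
    val_inverse[OF all_places_discrete[OF Q_place[of 0]], of x] by simp

lemma val_Q_y: "val F (Q 0) y = - int n" "k \<in> {1..n} \<Longrightarrow> val F (Q k) y = 1"
  using ramified_val(2)[OF ramified_Q(1)] ramified_val(2)[OF ramified_Q(2)] by blast+

lemma y_in_loc:
  assumes P: "P \<in> places \<iota> F" "P \<noteq> Q 0"
  shows "y \<in> loc P"
proof -
  have d: "discrete_place P" by (rule all_places_discrete[OF P(1)])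
  have "val F P (x - \<iota> c) \<ge> 0" for c
    using loc_iff_val[OF d x_minus_in_F] loc_diff[OF P(1) x_in_loc[OF P] loc_iota[OF P(1)]] by blast
  then have "int m * val F P y \<ge> 0" unfolding val_y_power[OF P(1)] by (intro sum_nonneg)
  then have "val F P y \<ge> 0" using m_pos by (simp add: zero_le_mult_iff)
  then show ?thesis using loc_iff_val[OF d generators_in_F(2) y_nonzero] by blast
qed

lemma val_y_elsewhere:
  assumes P: "P \<in> places \<iota> F" "P \<notin> Q ` {0..n}"
  shows "val F P y = 0"
proof -
  have d: "discrete_place P" by (rule all_places_discrete[OF P(1)])
  have PQ: "P \<noteq> Q k" if "k \<le> n" for k using P(2) that by auto
  have "val F P (x - \<iota> (a k)) = 0" if k: "k \<in> {1..n}" for k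
  proof -
    have "x - \<iota> (a k) \<in> loc P" by (rule loc_diff[OF P(1) x_in_loc[OF P(1) PQ] loc_iota[OF P(1)]]) simp
    moreover have "x - \<iota> (a k) \<notin> P" using Q_unique(2)[OF P(1) k] PQ[of k] k by auto
    ultimately show ?thesis using val_unit[OF d] by blast
  qed
  then have "int m * val F P y = 0" unfolding val_y_power[OF P(1)] by (intro sum.neutral ballI)
  then show ?thesis using m_pos by simp
qed

lemma Q_inj: "inj_on Q {0..n}"
proof (rule inj_onI)
  have root_ne_infinity: "Q k \<noteq> Q 0" if k: "k \<in> {1..n}" for k
    using val_Q_y(2)[OF k] val_Q_y(1) by auto
  fix i j assume ij: "i \<in> {0..n}" "j \<in> {0..n}" "Q i = Q j"
  show "i = j"
  proof (cases "i = 0 \<or> j = 0")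
    case True
    show ?thesis
    proof (rule ccontr)
      assume "i \<noteq> j"
      then show False using True ij root_ne_infinity[of i] root_ne_infinity[of j] by (cases "i = 0") auto
    qed
  next
    case False
    then have k: "i \<in> {1..n}" "j \<in> {1..n}" using ij by auto
    have Qi: "Q i \<in> places \<iota> F" using k by (intro Q_place) simp
    have "(x - \<iota> (a j)) - (x - \<iota> (a i)) \<in> Q i"
      by (rule place_diff[OF Qi]) (use x_minus_in_Q[OF k(1)] x_minus_in_Q[OF k(2)] ij(3) in simp_all)
    then have "\<iota> (a i - a j) \<in> Q i" by simp
    then have "a i - a j = 0" using place_iota[OF Qi] by blast
    then have "a i = a j" by simp
    then show ?thesis using inj_on_eq_iff[OF a_inj k] by blast
  qed
qed

lemma ext_degree_F: "ext_degree F E = m"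
  by (rule ext_degree_eq[OF ramified_Q(1)])

text \<open>
  The functions \<open>x\<^sup>i y\<^sup>j\<close> with \<open>i \<le> l - n\<close> and \<open>j < m\<close> are independent and have no poles except
  for one of order \<open>m i + n j \<le> m l\<close> at \<open>Q\<^sub>0\<close>.
\<close>

lemma ell_multiple_Q0:
  "int (l * m) - int (ell \<iota> F (frag_cmul (int (l * m)) (frag_of (Q 0)))) \<le> int (m * n)"
proof (cases "l \<ge> n")
  case False
  then have "l * m \<le> n * m" by (intro mult_le_mono) simp_all
  then have "int (l * m) \<le> int (m * n)" by (simp only: of_nat_le_iff mult.commute)
  then show ?thesis by linarith
next
  case True
  let ?L = "frag_cmul (int (l * m)) (frag_of (Q 0))"
  define I where "I = {..l - n} \<times> {..<m}"
  define f where "f = (\<lambda>(i, j). x ^ i * y ^ j)"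
  have fin: "finite I" by (simp add: I_def)
  have indep: "\<forall>s\<in>I. c s = 0" if c: "\<forall>s\<in>I. c s \<in> range \<iota>" "(\<Sum>s\<in>I. c s * f s) = 0" for c
  proof -
    define e where "e = (\<lambda>s. inv \<iota> (c s))"
    have e: "c s = \<iota> (e s)" if "s \<in> I" for s
      using c(1) that by (simp add: e_def f_inv_into_f)
    define p where "p = (\<lambda>j. \<Sum>i\<le>l - n. monom (e (i, j)) i)"
    have "(\<Sum>j<m. ev (p j) x * y ^ j) = (\<Sum>j<m. \<Sum>i\<le>l - n. \<iota> (e (i, j)) * (x ^ i * y ^ j))"
      by (simp add: p_def ev_sum sum_distrib_right mult.assoc)
    also have "\<dots> = (\<Sum>i\<le>l - n. \<Sum>j<m. \<iota> (e (i, j)) * (x ^ i * y ^ j))" by (rule sum.swap)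
    also have "\<dots> = (\<Sum>(i, j)\<in>I. \<iota> (e (i, j)) * (x ^ i * y ^ j))"
      unfolding I_def by (rule sum.cartesian_product)
    also have "\<dots> = (\<Sum>s\<in>I. c s * f s)"
      by (rule sum.cong) (auto simp: e f_def)
    finally have "(\<Sum>j<m. ev (p j) x * y ^ j) = 0" using c(2) by simp
    then have "\<forall>j<m. ev (p j) x = 0" using ramified_sum(2)[OF ramified_Q(1), of "\<lambda>j. ev (p j) x"] ev_in_E by blast
    then have p0: "p j = 0" if "j < m" for j using that ev_eq_0_iff by blast
    have "e (i, j) = 0" if "i \<le> l - n" "j < m" for i j
    proof -
      have "coeff (p j) i = e (i, j)" using that(1) by (simp add: p_def coeff_sum)
      then show ?thesis using p0[OF that(2)] by simp
    qed
    then show ?thesis using e by (auto simp: I_def)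
  qed
  note family = indep_family[OF K_subfield fin indep]
  have sub: "f ` I \<subseteq> RR_space \<iota> F ?L"
  proof (rule image_subsetI)
    fix s assume "s \<in> I"
    then obtain i j where s: "s = (i, j)" "i \<le> l - n" "j < m" by (auto simp: I_def)
    have fF: "f s \<in> F" "f s \<noteq> 0" using x_in_F generators_in_F(2) by (simp_all add: s(1) f_def)
    have "f s \<in> val_ge P (- Poly_Mapping.lookup ?L P)" if P: "P \<in> places \<iota> F" for P
    proof (cases "P = Q 0")
      case True
      have d: "discrete_place P" by (rule all_places_discrete[OF P])
      have "m * i + n * j \<le> m * (l - n) + n * m" using s by (intro add_mono mult_le_mono) simp_all
      also have "\<dots> = l * m" using \<open>l \<ge> n\<close> by (simp add: algebra_simps flip: add_mult_distrib2)
      finally have "int (m * i + n * j) \<le> int (l * m)" by (simp only: of_nat_le_iff)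
      moreover have "val F P (f s) = - int (m * i + n * j)"
        using x_in_F generators_in_F(2) val_Q0_x val_Q_y(1) unfolding True
        by (simp add: s(1) f_def val_mult[OF d[unfolded True]] val_power[OF d[unfolded True]])
      ultimately show ?thesis using fF True by (simp add: val_ge_def)
    next
      case False
      have "f s \<in> loc P" unfolding s(1) f_def
        using x_in_loc[OF P False] y_in_loc[OF P False]
        by (simp add: loc_mult[OF P] loc_power[OF P])
      then show ?thesis using False loc_eq_val_ge[OF all_places_discrete[OF P]] by simp
    qed
    then show "f s \<in> RR_space \<iota> F ?L" using fF unfolding RR_space_eq bounded_poles_def by simp
  qed
  obtain B where B: "indep_mod (range \<iota>) {0} B" "spans_mod (range \<iota>) {0} B (RR_space \<iota> F ?L)" "card B = ell \<iota> F ?L"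
    using has_qdim_ell[of ?L] unfolding has_qdim_def by blast
  have "finite B" using B(1) by (simp add: indep_mod_def)
  moreover have "subspace_over (range \<iota>) {0}" by (simp add: subspace_over_def)
  ultimately have "card (f ` I) \<le> card B"
    using indep_mod_card_le_spanning[OF K_subfield _ sub family(2) _ B(2)] by blast
  then have "card (f ` I) \<le> ell \<iota> F ?L" unfolding B(3) .
  moreover have "card (f ` I) = (l - n + 1) * m"
    using card_image[OF family(1)] by (simp add: I_def)
  ultimately have "(l - n + 1) * m \<le> ell \<iota> F ?L" by simp
  moreover have "l * m \<le> (l - n + 1) * m + m * n"
    using True by (simp add: algebra_simps flip: add_mult_distrib2)
  ultimately show ?thesis by linarith
qed

lemma riemann_inequality:
  assumes "A \<in> divisors \<iota> F"
  shows "int (ell \<iota> F A) \<ge> div_degree \<iota> F A + 1 - genus \<iota> F"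
proof -
  have "div_degree \<iota> F A - int (ell \<iota> F A) \<le> int (m * n)" if "A \<in> divisors \<iota> F" for A
    by (rule deg_minus_ell_bounded[OF Q_place Q_degree inverse_x_in_Q m_pos val_Q0_x x_in_loc ell_multiple_Q0 that])
      simp_all
  from deg_minus_ell_le_genus[OF this assms] show ?thesis by simp
qed

end

section \<open>Evaluation codes\<close>

context function_field begin

lemma eval_atI:
  assumes P: "P \<in> places \<iota> F" and c: "z - \<iota> c \<in> P"
  shows "eval_at \<iota> P z = c"
  unfolding eval_at_def
proof (rule the_equality)
  show "z - \<iota> c \<in> P" by (rule c)
  fix e assume "z - \<iota> e \<in> P"
  then have "(z - \<iota> c) - (z - \<iota> e) \<in> P" by (rule place_diff[OF P c])
  then have "\<iota> (e - c) \<in> P" by simp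
  then have "e - c = 0" using place_iota[OF P] by blast
  then show "e = c" by simp
qed

text \<open>
  The one-element basis of the residue field can be replaced by 1.
\<close>

lemma constant_residue:
  assumes P: "P \<in> places \<iota> F" "place_degree \<iota> F P = 1" and z: "z \<in> loc P"
  shows "\<exists>c. z - \<iota> c \<in> P"
proof -
  obtain B where B: "B \<subseteq> loc P" "spans_mod (range \<iota>) P B (loc P)" "card B = 1"
    using has_qdim_place_degree[OF P(1)] P(2) unfolding has_qdim_def by auto
  obtain b where b: "B = {b}" using B(3) card_1_singletonE by blast
  have repr: "\<exists>c. w - \<iota> c * b \<in> P" if w: "w \<in> loc P" for w
  proof -
    obtain c where c: "\<forall>b\<in>B. c b \<in> range \<iota>" "w - (\<Sum>b\<in>B. c b * b) \<in> P"
      using B(2) w unfolding spans_mod_def by blast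
    obtain e where "c b = \<iota> e" using c(1) b by blast
    then show ?thesis using c(2) b by auto
  qed
  obtain c1 where c1: "1 - \<iota> c1 * b \<in> P" using repr[OF loc_1[OF P(1)]] by blast
  obtain c2 where c2: "z - \<iota> c2 * b \<in> P" using repr[OF z] by blast
  have "c1 \<noteq> 0" using c1 place_1[OF P(1)] by auto
  then have "z - \<iota> (c2 * inverse c1) = (z - \<iota> c2 * b) - \<iota> (c2 * inverse c1) * (1 - \<iota> c1 * b)"
    by (simp add: right_diff_distrib)
  also have "\<dots> \<in> P"
    by (intro place_diff[OF P(1)] place_mult[OF P(1) loc_iota[OF P(1)]] c1 c2)
  finally show ?thesis by blast
qed

lemma eval_at_residue:
  assumes "P \<in> places \<iota> F" "place_degree \<iota> F P = 1" "z \<in> loc P"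
  shows "z - \<iota> (eval_at \<iota> P z) \<in> P"
  using constant_residue[OF assms] eval_atI[OF assms(1)] by metis

lemma eval_at_lincomb:
  assumes P: "P \<in> places \<iota> F" "place_degree \<iota> F P = 1" and f: "\<And>s. s \<in> I \<Longrightarrow> f s \<in> loc P"
  shows "eval_at \<iota> P (\<Sum>s\<in>I. \<iota> (u s) * f s) = (\<Sum>s\<in>I. u s * eval_at \<iota> P (f s))"
proof (rule eval_atI[OF P(1)])
  have sum_iota: "\<iota> (sum h I) = (\<Sum>s\<in>I. \<iota> (h s))" for h
    by (induction I rule: infinite_finite_induct) simp_all
  have "(\<Sum>s\<in>I. \<iota> (u s) * f s) - \<iota> (\<Sum>s\<in>I. u s * eval_at \<iota> P (f s))
      = (\<Sum>s\<in>I. \<iota> (u s) * (f s - \<iota> (eval_at \<iota> P (f s))))"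
    by (simp add: sum_iota right_diff_distrib sum_subtractf)
  also have "\<dots> \<in> P"
    by (intro place_sum[OF P(1)] place_mult[OF P(1) loc_iota[OF P(1)]] eval_at_residue[OF P] f)
  finally show "(\<Sum>s\<in>I. \<iota> (u s) * f s) - \<iota> (\<Sum>s\<in>I. u s * eval_at \<iota> P (f s)) \<in> P" .
qed

lemma eval_at_diff:
  assumes P: "P \<in> places \<iota> F" "place_degree \<iota> F P = 1" and z: "z \<in> loc P" "w \<in> loc P"
  shows "eval_at \<iota> P (z - w) = eval_at \<iota> P z - eval_at \<iota> P w"
proof (rule eval_atI[OF P(1)])
  have "(z - \<iota> (eval_at \<iota> P z)) - (w - \<iota> (eval_at \<iota> P w)) \<in> P"
    by (intro place_diff[OF P(1)] eval_at_residue[OF P] z)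
  then show "z - w - \<iota> (eval_at \<iota> P z - eval_at \<iota> P w) \<in> P" by (simp add: algebra_simps)
qed

lemma eval_at_eq_0:
  assumes P: "P \<in> places \<iota> F" "place_degree \<iota> F P = 1" and z: "z \<in> loc P" "eval_at \<iota> P z = 0"
  shows "z \<in> P"
  using eval_at_residue[OF P z(1)] z(2) by simp

end

locale evaluation_code = function_field \<iota> F x b m
  for \<iota> :: "'q::field \<Rightarrow> 'a::field" and F x b m +
  fixes R :: "'l::finite \<Rightarrow> 'a set"
  assumes R_place: "\<And>i. R i \<in> places \<iota> F" and R_degree: "\<And>i. place_degree \<iota> F (R i) = 1"
begin

definition evaluation :: "'a \<Rightarrow> 'q ^ 'l" where
  "evaluation z = (\<chi> i. eval_at \<iota> (R i) z)"

definition avoids :: "('a set \<Rightarrow>\<^sub>0 int) \<Rightarrow> bool" where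
  "avoids A \<longleftrightarrow> (\<forall>i. Poly_Mapping.lookup A (R i) = 0)"

lemma AG_code_eq: "AG_code \<iota> F R A = evaluation ` RR_space \<iota> F A"
  unfolding AG_code_def evaluation_def by blast

lemma RR_space_loc:
  assumes "avoids A" "z \<in> RR_space \<iota> F A"
  shows "z \<in> loc (R i)"
proof -
  have "z \<in> val_ge (R i) (- Poly_Mapping.lookup A (R i))"
    using assms(2) R_place unfolding RR_space_eq bounded_poles_def by blast
  then show ?thesis
    using assms(1) loc_eq_val_ge[OF all_places_discrete[OF R_place]] by (simp add: avoids_def)
qed

lemma evaluation_lincomb:
  assumes "avoids A" "f ` I \<subseteq> RR_space \<iota> F A"
  shows "evaluation (\<Sum>s\<in>I. \<iota> (u s) * f s) = (\<Sum>s\<in>I. u s *s evaluation (f s))"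
proof -
  have "eval_at \<iota> (R i) (\<Sum>s\<in>I. \<iota> (u s) * f s) = (\<Sum>s\<in>I. u s * eval_at \<iota> (R i) (f s))" for i
  proof (rule eval_at_lincomb[OF R_place R_degree])
    fix s assume "s \<in> I"
    then have "f s \<in> RR_space \<iota> F A" using assms(2) by blast
    then show "f s \<in> loc (R i)" by (rule RR_space_loc[OF assms(1)])
  qed
  then show ?thesis by (simp add: evaluation_def vec_eq_iff)
qed

lemma AG_code_subspace:
  assumes A: "avoids A"
  shows "vec.subspace (AG_code \<iota> F R A)"
proof (rule vec.subspaceI)
  note sub = subspace_overD[OF subspace_RR_space[of A]]
  have comb: "u *s v + e *s w \<in> AG_code \<iota> F R A" if vw: "v \<in> AG_code \<iota> F R A" "w \<in> AG_code \<iota> F R A" for v w u e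
  proof -
    obtain z1 where z1: "z1 \<in> RR_space \<iota> F A" "v = evaluation z1" using vw(1) unfolding AG_code_eq by blast
    obtain z2 where z2: "z2 \<in> RR_space \<iota> F A" "w = evaluation z2" using vw(2) unfolding AG_code_eq by blast
    define f where "f = (\<lambda>s. if s then z1 else z2)"
    define c where "c = (\<lambda>s. if s then u else e)"
    have "f ` UNIV \<subseteq> RR_space \<iota> F A" using z1(1) z2(1) by (simp add: f_def image_subset_iff)
    from evaluation_lincomb[OF A this, of c]
    have "evaluation (\<iota> u * z1 + \<iota> e * z2) = u *s v + e *s w"
      by (simp add: UNIV_bool f_def c_def z1(2) z2(2) add.commute)
    moreover have "\<iota> u * z1 + \<iota> e * z2 \<in> RR_space \<iota> F A"
      by (intro sub(2) sub(3)[OF rangeI] z1(1) z2(1))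
    ultimately show ?thesis unfolding AG_code_eq by (metis imageI)
  qed
  have "evaluation 0 = 0"
    using evaluation_lincomb[OF A, of "\<lambda>_. 0" "{}"] by simp
  then show 0: "0 \<in> AG_code \<iota> F R A" using sub(1) unfolding AG_code_eq by (metis imageI)
  show "v + w \<in> AG_code \<iota> F R A" if "v \<in> AG_code \<iota> F R A" "w \<in> AG_code \<iota> F R A" for v w
    using comb[OF that, of 1 1] by simp
  show "u *s v \<in> AG_code \<iota> F R A" if "v \<in> AG_code \<iota> F R A" for u v
    using comb[OF that that, of u 0] by simp
qed

text \<open>
  The kernel of the evaluation map is \<open>L(A - D)\<close>, described by the second assumption.
\<close>

lemma AG_code_dim:
  assumes A: "avoids A" and inj: "\<And>z. z \<in> RR_space \<iota> F A \<Longrightarrow> (\<And>i. z \<in> R i) \<Longrightarrow> z = 0"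
  shows "vec.dim (AG_code \<iota> F R A) = ell \<iota> F A"
proof -
  let ?L = "RR_space \<iota> F A"
  note sub = subspace_overD[OF subspace_RR_space[of A]]
  obtain B where B: "B \<subseteq> ?L" "indep_mod (range \<iota>) {0} B" "spans_mod (range \<iota>) {0} B ?L" "card B = ell \<iota> F A"
    using has_qdim_ell[of A] unfolding has_qdim_def by blast
  have fin: "finite B" using B(2) by (simp add: indep_mod_def)
  have kernel: "z = 0" if z: "z \<in> ?L" "evaluation z = 0" for z
  proof (rule inj[OF z(1)])
    fix i
    have "eval_at \<iota> (R i) z = evaluation z $ i" by (simp add: evaluation_def)
    then show "z \<in> R i"
      using z(2) by (intro eval_at_eq_0[OF R_place R_degree RR_space_loc[OF A z(1)]]) simp
  qed
  have relation: "\<forall>b\<in>B. u b = 0" if u: "(\<Sum>b\<in>B. u b *s evaluation b) = 0" for u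
  proof -
    have "evaluation (\<Sum>b\<in>B. \<iota> (u b) * b) = 0"
      using evaluation_lincomb[OF A, of "\<lambda>b. b" B u] B(1) u by simp
    moreover have "(\<Sum>b\<in>B. \<iota> (u b) * b) \<in> ?L"
      by (rule subspace_over_lincomb[OF subspace_RR_space B(1)]) (rule rangeI)
    ultimately have "(\<Sum>b\<in>B. \<iota> (u b) * b) \<in> {0}" using kernel by simp
    then have "\<iota> (u b) = 0" if "b \<in> B" for b
      using indep_modD[OF B(2) rangeI _ that] by blast
    then show ?thesis by simp
  qed
  have inj_ev: "inj_on evaluation B"
  proof (rule inj_onI, rule ccontr)
    fix s t assume st: "s \<in> B" "t \<in> B" "evaluation s = evaluation t" "s \<noteq> t"
    define c where "c = (\<lambda>r. if r = s then 1 else if r = t then - 1 else (0 :: 'q))"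
    have "(\<Sum>b\<in>B. c b *s evaluation b) = (\<Sum>b\<in>{s, t}. c b *s evaluation b)"
      by (rule sum.mono_neutral_right) (use fin st in \<open>auto simp: c_def\<close>)
    also have "\<dots> = 0" using st by (simp add: c_def)
    finally have "c s = 0" using relation st(1) by blast
    then show False by (simp add: c_def)
  qed
  have "vec.independent (evaluation ` B)"
  proof
    assume "vec.dependent (evaluation ` B)"
    then obtain u where u: "\<exists>v\<in>evaluation ` B. u v \<noteq> 0" "(\<Sum>v\<in>evaluation ` B. u v *s v) = 0"
      unfolding vec.dependent_finite[OF finite_imageI[OF fin]] by blast
    have "(\<Sum>b\<in>B. u (evaluation b) *s evaluation b) = 0"
      using u(2) by (simp add: sum.reindex[OF inj_ev])
    then have "\<forall>b\<in>B. u (evaluation b) = 0" by (rule relation)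
    then show False using u(1) by blast
  qed
  moreover have "AG_code \<iota> F R A \<subseteq> vec.span (evaluation ` B)"
  proof
    fix v assume "v \<in> AG_code \<iota> F R A"
    then obtain z where z: "z \<in> ?L" "v = evaluation z" unfolding AG_code_eq by blast
    obtain c where c: "\<forall>b\<in>B. c b \<in> range \<iota>" "z - (\<Sum>b\<in>B. c b * b) \<in> {0}"
      using B(3) z(1) unfolding spans_mod_def by blast
    define e where "e = (\<lambda>b. inv \<iota> (c b))"
    have e: "c b = \<iota> (e b)" if "b \<in> B" for b
      using c(1) that by (simp add: e_def f_inv_into_f)
    have "z = (\<Sum>b\<in>B. c b * b)" using c(2) by simp
    also have "\<dots> = (\<Sum>b\<in>B. \<iota> (e b) * b)" by (intro sum.cong) (simp_all add: e)
    finally have "v = (\<Sum>b\<in>B. e b *s evaluation b)"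
      using evaluation_lincomb[OF A, of "\<lambda>b. b" B e] B(1) z(2) by simp
    then show "v \<in> vec.span (evaluation ` B)"
      by (simp add: vec.span_sum vec.span_scale vec.span_base)
  qed
  moreover have "evaluation ` B \<subseteq> AG_code \<iota> F R A" unfolding AG_code_eq using B(1) by blast
  ultimately have "card (evaluation ` B) = vec.dim (AG_code \<iota> F R A)"
    by (intro vec.basis_card_eq_dim)
  then show ?thesis using card_image[OF inj_ev] B(4) by simp
qed

text \<open>
  Two functions with the same codeword differ by a function with poles bounded by
  \<open>max(G, H) - D\<close>; if it vanishes, the functions are equal and have poles bounded by
  \<open>min(G, H)\<close>.  So the codes meet trivially, and the dimensions are forced to be the lower bounds
  as soon as these add up to the length.
\<close>

lemma LCP_of_AG_codes:
  assumes G: "avoids G" and H: "avoids H"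
    and meet: "\<And>z. z \<in> RR_space \<iota> F G \<Longrightarrow> z \<in> RR_space \<iota> F H \<Longrightarrow> z = 0"
    and join: "\<And>z. z \<in> F \<Longrightarrow> (\<And>P. P \<in> places \<iota> F \<Longrightarrow>
        z \<in> val_ge P (- max (Poly_Mapping.lookup G P) (Poly_Mapping.lookup H P))) \<Longrightarrow> (\<And>i. z \<in> R i) \<Longrightarrow> z = 0"
    and dims: "int (ell \<iota> F G) \<ge> kG" "int (ell \<iota> F H) \<ge> kH" "kG + kH = int CARD('l)"
  shows "LCP (AG_code \<iota> F R G) (AG_code \<iota> F R H) \<and>
    int (vec.dim (AG_code \<iota> F R G)) = kG \<and> int (vec.dim (AG_code \<iota> F R H)) = kH"
proof -
  let ?CG = "AG_code \<iota> F R G" and ?CH = "AG_code \<iota> F R H"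
  have bound: "z \<in> val_ge P (- max (Poly_Mapping.lookup G P) (Poly_Mapping.lookup H P))"
    if z: "z \<in> RR_space \<iota> F A" "A = G \<or> A = H" and P: "P \<in> places \<iota> F" for z A P
  proof (rule val_ge_mono[OF all_places_discrete[OF P]])
    show "z \<in> val_ge P (- Poly_Mapping.lookup A P)"
      using z(1) P unfolding RR_space_eq bounded_poles_def by blast
    show "- max (Poly_Mapping.lookup G P) (Poly_Mapping.lookup H P) \<le> - Poly_Mapping.lookup A P"
      using z(2) by auto
  qed
  have inF: "z \<in> F" if "z \<in> RR_space \<iota> F A" for z A using that by (simp add: RR_space_def)
  have dimG: "vec.dim ?CG = ell \<iota> F G"
    by (rule AG_code_dim[OF G]) (rule join[OF inF bound], auto)
  have dimH: "vec.dim ?CH = ell \<iota> F H"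
    by (rule AG_code_dim[OF H]) (rule join[OF inF bound], auto)
  note subG = AG_code_subspace[OF G] and subH = AG_code_subspace[OF H]
  have int0: "?CG \<inter> ?CH = {0}"
  proof (intro subset_antisym subsetI)
    fix v assume "v \<in> ?CG \<inter> ?CH"
    then obtain z w where z: "z \<in> RR_space \<iota> F G" "v = evaluation z" and w: "w \<in> RR_space \<iota> F H" "v = evaluation w"
      unfolding AG_code_eq by blast
    have "z - w = 0"
    proof (rule join)
      show "z - w \<in> F" using inF[OF z(1)] inF[OF w(1)] by (rule F_closed(7))
      show "z - w \<in> val_ge P (- max (Poly_Mapping.lookup G P) (Poly_Mapping.lookup H P))" if P: "P \<in> places \<iota> F" for P
        by (rule val_ge_diff[OF all_places_discrete[OF P] bound[OF z(1) _ P] bound[OF w(1) _ P]]) simp_all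
      show "z - w \<in> R i" for i
      proof (rule eval_at_eq_0[OF R_place R_degree])
        note l = RR_space_loc[OF G z(1), of i] RR_space_loc[OF H w(1), of i]
        show "z - w \<in> loc (R i)" by (rule loc_diff[OF R_place l])
        have "evaluation z $ i = evaluation w $ i" using z(2) w(2) by simp
        then show "eval_at \<iota> (R i) (z - w) = 0"
          unfolding eval_at_diff[OF R_place R_degree l] by (simp add: evaluation_def)
      qed
    qed
    then have "z = 0" using meet[OF z(1)] w(1) by simp
    moreover have "evaluation 0 = 0"
      using evaluation_lincomb[OF G, of "\<lambda>_. 0" "{}"] by simp
    ultimately show "v \<in> {0}" using z(2) by simp
  qed (use subG subH vec.subspace_0 in auto)
  have sum_dim: "vec.dim {u + v | u v. u \<in> ?CG \<and> v \<in> ?CH} = vec.dim ?CG + vec.dim ?CH"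
    using vec.dim_sums_Int[OF subG subH] int0 by (simp add: Bex_def)
  moreover have "vec.dim {u + v | u v. u \<in> ?CG \<and> v \<in> ?CH} \<le> CARD('l)"
    by (rule dim_subset_UNIV_cart_gen)
  ultimately have eqs: "int (vec.dim ?CG) = kG" "int (vec.dim ?CH) = kH"
    "vec.dim {u + v | u v. u \<in> ?CG \<and> v \<in> ?CH} = CARD('l)"
    using dims dimG dimH by linarith+
  have "vec.subspace {u + v | u v. u \<in> ?CG \<and> v \<in> ?CH}" by (rule vec.subspace_sums[OF subG subH])
  then have "{u + v | u v. u \<in> ?CG \<and> v \<in> ?CH} = UNIV"
    by (rule vec.subspace_dim_equal) (simp_all add: vec.subspace_UNIV eqs(3) card_cart_basis)
  then show ?thesis unfolding LCP_def using subG subH int0 eqs(1,2) by blast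
qed

end

section \<open>Completely split places\<close>

context kummer_places begin

sublocale base: extension_field \<iota> E
proof unfold_locales
  show "is_subfield E" by (rule E_subfield)
  show "range \<iota> \<subseteq> E" using adjoin_superset[of "{x}"] unfolding E_eq by blast
qed

text \<open>
  If \<open>s\<close> was a unit or a pole at \<open>P\<close>, then \<open>b s\<^sup>-\<^sup>k\<close> would lie in \<open>P\<close> and so in \<open>P'\<close> for
  every \<open>b \<in> P\<close> and every \<open>k\<close>.
\<close>

lemma contraction_of_place:
  assumes P: "P \<in> places \<iota> E" and P': "P' \<in> places_over \<iota> F P" and s: "s \<in> E" "s \<noteq> 0" "s \<in> P'"
  shows "s \<in> P"
proof (rule ccontr)
  assume nP: "s \<notin> P"
  have PP': "P' \<in> places \<iota> F" "P \<subseteq> P'" using P' by (simp_all add: places_over_def)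
  have d: "discrete_place P'" by (rule all_places_discrete[OF PP'(1)])
  have inv: "inverse s \<in> local_ring E P"
  proof (cases "s \<in> local_ring E P")
    case True
    then show ?thesis using base.unit_inverse[OF P] nP by blast
  next
    case False
    then have "inverse s \<in> P" using base.in_loc_or_inverse[OF P s(1)] by blast
    then show ?thesis using base.place_subset_loc[OF P] by blast
  qed
  obtain b where b: "b \<in> P" "b \<noteq> 0" using base.place_nontrivial[OF P] by blast
  have sF: "s \<in> F" using s(1) E_subset_F by blast
  have bF: "b \<in> F" using b(1) PP' place_subset_loc[OF PP'(1)] loc_subset_F[OF PP'(1)] by blast
  define k where "k = nat (val F P' b)"
  have "inverse s ^ k * b \<in> P'"
    using base.place_mult[OF P base.loc_power[OF P inv] b(1)] PP'(2) by blast
  moreover have "inverse s ^ k * b \<in> F" "inverse s ^ k * b \<noteq> 0" using sF bF s(2) b(2) by simp_all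
  ultimately have "0 < val F P' (inverse s ^ k * b)" using place_iff_val[OF d] by blast
  also have "val F P' (inverse s ^ k * b) = val F P' b - int k * val F P' s"
    using sF bF s(2) b(2) d by simp
  finally have lt: "int k * val F P' s < val F P' b" by simp
  have "1 \<le> val F P' s" using place_iff_val[OF d sF s(2)] s(3) by simp
  then have "int k * 1 \<le> int k * val F P' s" by (intro mult_left_mono) simp_all
  moreover have "val F P' b \<le> int k" by (simp add: k_def)
  ultimately show False using lt by linarith
qed

text \<open>
  The \<open>m\<close> places over a completely split place are zeros of some \<open>x - c\<close>, and
  \<open>\<Sum> v\<^sub>P(x - c) deg P \<le> [F : K(x)] \<le> m\<close> leaves room for no further zero and no multiplicity.
\<close>

lemma split_place:
  assumes m: "m \<ge> 2" and P: "P \<in> places \<iota> E" "splits_completely \<iota> F E P"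
    and rational: "\<And>P'. P' \<in> places_over \<iota> F P \<Longrightarrow> place_degree \<iota> F P' = 1"
  shows "\<exists>c. (\<forall>P'\<in>places_over \<iota> F P. x - \<iota> c \<in> P' \<and> val F P' (x - \<iota> c) = 1 \<and> P' \<notin> Q ` {0..n}) \<and>
    (\<forall>P'\<in>places \<iota> F. x - \<iota> c \<in> P' \<longrightarrow> P' \<in> places_over \<iota> F P)"
proof -
  define T where "T = places_over \<iota> F P"
  have T: "finite T" "card T = m"
    using P(2) ext_degree_F by (simp_all add: splits_completely_def T_def)
  have Tp: "P' \<in> places \<iota> F" "P \<subseteq> P'" if "P' \<in> T" for P'
    using that by (simp_all add: T_def places_over_def)
  have lift: "s \<in> P'" if s: "s \<in> E" "s \<noteq> 0" and P0: "P0 \<in> T" "s \<in> P0" and P': "P' \<in> T" for s P0 P'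
    using contraction_of_place[OF P(1) _ s P0(2)] P0(1) Tp(2)[OF P'] unfolding T_def by blast
  have "T \<noteq> {}" using T(2) m by auto
  then obtain P0 where P0: "P0 \<in> T" by blast
  have xE: "x \<in> E" using ev_in_E[of "[:0, 1:]"] by simp
  have "x \<in> loc P0"
  proof (rule ccontr)
    assume "x \<notin> loc P0"
    then have inv: "inverse x \<in> P0" using in_loc_or_inverse[OF Tp(1)[OF P0] x_in_F] by blast
    have "P' = Q 0" if P': "P' \<in> T" for P'
    proof (rule Q_unique(1)[OF Tp(1)[OF P']])
      have "inverse x \<in> E" using xE by (rule is_subfieldD(6)[OF E_subfield])
      then show "inverse x \<in> P'" using lift[OF _ _ P0 inv P'] by simp
    qed
    then have "T \<subseteq> {Q 0}" by blast
    then have "card T \<le> card {Q 0}" by (intro card_mono) simp_all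
    then show False using T(2) m by simp
  qed
  then obtain c where c: "x - \<iota> c \<in> P0"
    using constant_residue[OF Tp(1)[OF P0]] rational P0 unfolding T_def by blast
  let ?z = "x - \<iota> c"
  have zE: "?z \<in> E" using ev_in_E[of "[:- c, 1:]"] by simp
  note z = x_minus_in_F[of c]
  have zT: "?z \<in> P'" if "P' \<in> T" for P' by (rule lift[OF zE z(2) P0 c that])
  have deg: "degree_over_le ?z m" using degree_over_poly[of "[:- c, 1:]"] by simp
  have pos: "1 \<le> val F P' ?z * int (place_degree \<iota> F P')" if P': "P' \<in> places \<iota> F" "?z \<in> P'" for P'
  proof -
    have "0 < val F P' ?z" using place_iff_val[OF all_places_discrete[OF P'(1)] z] P'(2) by blast
    moreover have "0 < int (place_degree \<iota> F P')" using place_degree_pos[OF P'(1)] by simp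
    ultimately have "0 < val F P' ?z * int (place_degree \<iota> F P')" by (rule mult_pos_pos)
    then show ?thesis by simp
  qed
  have one: "val F P' ?z = 1" if P': "P' \<in> T" for P'
  proof -
    have "val F P' ?z * int (place_degree \<iota> F P') + int (m - 1)
        = val F P' ?z * int (place_degree \<iota> F P') + (\<Sum>P''\<in>T - {P'}. 1)"
      using T P' by simp
    also have "\<dots> \<le> val F P' ?z * int (place_degree \<iota> F P')
        + (\<Sum>P''\<in>T - {P'}. val F P'' ?z * int (place_degree \<iota> F P''))"
      using Tp(1) zT by (intro add_mono order_refl sum_mono pos) blast+
    also have "\<dots> = (\<Sum>P''\<in>T. val F P'' ?z * int (place_degree \<iota> F P''))"
      by (rule sum.remove[OF T(1) P', symmetric])
    also have "\<dots> \<le> int m" by (rule degree_of_zeros_le[OF T(1) _ z zT deg]) (use Tp(1) in blast)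
    finally have "val F P' ?z * int (place_degree \<iota> F P') \<le> 1" using m by simp
    moreover have "place_degree \<iota> F P' = 1" using rational P' unfolding T_def by blast
    ultimately show ?thesis using pos[OF Tp(1)[OF P'] zT[OF P']] by simp
  qed
  have all: "P' \<in> T" if P': "P' \<in> places \<iota> F" "?z \<in> P'" for P'
  proof (rule ccontr)
    assume nT: "P' \<notin> T"
    have "int (m + 1) = (\<Sum>P''\<in>insert P' T. 1)" using T nT by simp
    also have "\<dots> \<le> (\<Sum>P''\<in>insert P' T. val F P'' ?z * int (place_degree \<iota> F P''))"
      using Tp(1) zT P' by (intro sum_mono pos) blast+
    also have "\<dots> \<le> int m"
      by (rule degree_of_zeros_le[OF _ _ z _ deg]) (use T(1) Tp(1) zT P' in blast)+
    finally show False by simp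
  qed
  have notQ: "P' \<notin> Q ` {0..n}" if P': "P' \<in> T" for P'
  proof
    assume "P' \<in> Q ` {0..n}"
    then obtain k where k: "k \<le> n" "P' = Q k" by auto
    show False
    proof (cases "k = 0")
      case True
      have "val F P' ?z < 0"
        using val_at_infinity(1)[OF Q_place inverse_x_in_Q, of c] val_at_infinity(2)[OF Q_place inverse_x_in_Q] by (simp add: k(2) True)
      then show False using one[OF P'] by simp
    next
      case False
      then have k1: "k \<in> {1..n}" using k(1) by simp
      have "?z - (x - \<iota> (a k)) \<in> P'"
        using zT[OF P'] x_minus_in_Q[OF k1] unfolding k(2) by (rule place_diff[OF Q_place[OF k(1)]])
      then have "\<iota> (a k - c) \<in> Q k" by (simp add: k(2))
      then have "a k - c = 0" using place_iota[OF Q_place[OF k(1)]] by blast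
      then have "c = a k" by simp
      then have "val F P' ?z = int m" using ramified_val(1)[OF ramified_Q(2)[OF k1]] by (simp add: k(2))
      then show False using one[OF P'] m by simp
    qed
  qed
  show ?thesis unfolding T_def[symmetric] using zT one notQ all by blast
qed

text \<open>
  The support of \<open>D\<close> is cut out by \<open>h = \<Prod> (x - c\<^sub>i)\<close>.  Counting places shows that the \<open>R\<^sub>i\<close> are
  all the places over the \<open>P\<^sub>i\<close>, and that no place lies over two of them.
\<close>

lemma split_places_function:
  fixes R :: "'l::finite \<Rightarrow> 'a set" and t :: nat
  assumes m: "m \<ge> 2"
    and split: "\<And>i. i \<in> {1..t} \<Longrightarrow> P i \<in> places \<iota> E \<and> splits_completely \<iota> F E (P i)"
    and card: "CARD('l) = m * t"
    and R: "bij_betw R UNIV (rational_places \<iota> F \<inter> (\<Union>i\<in>{1..t}. places_over \<iota> F (P i)))"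
  shows "\<And>i. R i \<in> places \<iota> F" "\<And>i. place_degree \<iota> F (R i) = 1" "range R \<inter> Q ` {0..n} = {}"
    and "\<exists>h\<in>F. h \<noteq> 0 \<and> val F (Q 0) h = - int (m * t) \<and>
      (\<forall>P'\<in>places \<iota> F. P' \<noteq> Q 0 \<longrightarrow> val F P' h = (if P' \<in> range R then 1 else 0))"
proof -
  define T where "T = (\<lambda>i. places_over \<iota> F (P i))"
  define U where "U = (\<Union>i\<in>{1..t}. T i)"
  have T: "finite (T i)" "card (T i) = m" if "i \<in> {1..t}" for i
    using split[OF that] ext_degree_F by (simp_all add: splits_completely_def T_def)
  have finU: "finite U" unfolding U_def using T(1) by (intro finite_UN_I) simp_all
  have range: "range R = rational_places \<iota> F \<inter> U"
    using R unfolding bij_betw_def U_def T_def by blast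
  have "card (range R) = m * t"
    using R card unfolding bij_betw_def by (metis card_image)
  moreover have "card U \<le> (\<Sum>i\<in>{1..t}. card (T i))" unfolding U_def by (rule card_UN_le) simp
  moreover have sumT: "(\<Sum>i\<in>{1..t}. card (T i)) = m * t" using T(2) by simp
  ultimately have rangeU: "range R = U" and cardU: "card U = m * t"
    using card_mono[OF finU, of "range R"] card_subset_eq[OF finU, of "range R"] range by auto
  have disjoint: "i = j" if ij: "i \<in> {1..t}" "j \<in> {1..t}" "P' \<in> T i" "P' \<in> T j" for i j P'
  proof (rule ccontr)
    assume "i \<noteq> j"
    have "U \<subseteq> (T i - {P'}) \<union> (\<Union>k\<in>{1..t} - {i}. T k)"
      using ij \<open>i \<noteq> j\<close> unfolding U_def by blast
    moreover have "finite ((T i - {P'}) \<union> (\<Union>k\<in>{1..t} - {i}. T k))" using T(1) ij by auto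
    ultimately have "card U \<le> card ((T i - {P'}) \<union> (\<Union>k\<in>{1..t} - {i}. T k))" by (intro card_mono)
    also have "\<dots> \<le> card (T i - {P'}) + card (\<Union>k\<in>{1..t} - {i}. T k)" by (rule card_Un_le)
    also have "\<dots> \<le> card (T i - {P'}) + (\<Sum>k\<in>{1..t} - {i}. card (T k))"
      by (intro add_mono order_refl card_UN_le) simp
    also have "card (T i - {P'}) = m - 1" using T[OF ij(1)] ij(3) by simp
    also have "(m - 1) + (\<Sum>k\<in>{1..t} - {i}. card (T k)) < (\<Sum>k\<in>{1..t}. card (T k))"
      using T(2)[OF ij(1)] ij(1) m by (subst (2) sum.remove[of _ i]) simp_all
    finally show False using cardU sumT by simp
  qed
  have Uplace: "P' \<in> places \<iota> F" "place_degree \<iota> F P' = 1" if "P' \<in> U" for P'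
    using that range rangeU by (auto simp: rational_places_def)
  then show "\<And>i. R i \<in> places \<iota> F" "\<And>i. place_degree \<iota> F (R i) = 1" using rangeU by blast+
  have "\<forall>i\<in>{1..t}. \<exists>c. (\<forall>P'\<in>T i. x - \<iota> c \<in> P' \<and> val F P' (x - \<iota> c) = 1 \<and> P' \<notin> Q ` {0..n}) \<and>
    (\<forall>P'\<in>places \<iota> F. x - \<iota> c \<in> P' \<longrightarrow> P' \<in> T i)"
  proof
    fix i assume i: "i \<in> {1..t}"
    show "\<exists>c. (\<forall>P'\<in>T i. x - \<iota> c \<in> P' \<and> val F P' (x - \<iota> c) = 1 \<and> P' \<notin> Q ` {0..n}) \<and>
      (\<forall>P'\<in>places \<iota> F. x - \<iota> c \<in> P' \<longrightarrow> P' \<in> T i)"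
      unfolding T_def
    proof (rule split_place[OF m])
      show "P i \<in> places \<iota> E" "splits_completely \<iota> F E (P i)" using split[OF i] by simp_all
      show "place_degree \<iota> F P' = 1" if "P' \<in> places_over \<iota> F (P i)" for P'
        using that i by (intro Uplace(2)) (auto simp: U_def T_def)
    qed
  qed
  from bchoice[OF this] obtain c where
    c: "\<forall>i\<in>{1..t}. (\<forall>P'\<in>T i. x - \<iota> (c i) \<in> P' \<and> val F P' (x - \<iota> (c i)) = 1 \<and> P' \<notin> Q ` {0..n}) \<and>
    (\<forall>P'\<in>places \<iota> F. x - \<iota> (c i) \<in> P' \<longrightarrow> P' \<in> T i)" ..
  show "range R \<inter> Q ` {0..n} = {}" using c unfolding rangeU U_def by blast
  define h where "h = (\<Prod>i\<in>{1..t}. x - \<iota> (c i))"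
  have h: "h \<in> F" "h \<noteq> 0"
    unfolding h_def by (rule is_subfield_prod[OF F_subfield x_minus_in_F(1)]) (use x_minus_in_F(2) in simp)
  have val_h: "val F P' h = (\<Sum>i\<in>{1..t}. val F P' (x - \<iota> (c i)))" if "P' \<in> places \<iota> F" for P'
    unfolding h_def by (rule val_prod[OF all_places_discrete[OF that] finite_atLeastAtMost conjI[OF x_minus_in_F]])
  have "val F (Q 0) h = - int (m * t)"
    unfolding val_h[OF Q_place[of 0, simplified]]
    using val_at_infinity(1)[OF Q_place inverse_x_in_Q] val_Q0_x by simp
  moreover have "val F P' h = (if P' \<in> range R then 1 else 0)" if P': "P' \<in> places \<iota> F" "P' \<noteq> Q 0" for P'
  proof -
    have zero: "val F P' (x - \<iota> (c i)) = 0" if i: "i \<in> {1..t}" "P' \<notin> T i" for i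
    proof (rule val_unit[OF all_places_discrete[OF P'(1)]])
      have "x - \<iota> (c i) \<notin> P'" using c i P'(1) by blast
      then show "x - \<iota> (c i) \<in> loc P' - P'"
        using loc_diff[OF P'(1) x_in_loc[OF P'] loc_iota[OF P'(1)]] by blast
    qed
    show ?thesis
    proof (cases "P' \<in> U")
      case True
      then obtain i where i: "i \<in> {1..t}" "P' \<in> T i" unfolding U_def by blast
      have "(\<Sum>j\<in>{1..t}. val F P' (x - \<iota> (c j))) = val F P' (x - \<iota> (c i)) + (\<Sum>j\<in>{1..t} - {i}. val F P' (x - \<iota> (c j)))"
        by (rule sum.remove[OF _ i(1)]) simp
      also have "(\<Sum>j\<in>{1..t} - {i}. val F P' (x - \<iota> (c j))) = 0"
        using disjoint[OF i(1) _ i(2)] by (intro sum.neutral ballI zero) blast+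
      also have "val F P' (x - \<iota> (c i)) = 1" using c i by blast
      finally show ?thesis using True val_h[OF P'(1)] rangeU by simp
    next
      case False
      then have "(\<Sum>j\<in>{1..t}. val F P' (x - \<iota> (c j))) = 0"
        unfolding U_def by (intro sum.neutral ballI zero) blast+
      then show ?thesis using False val_h[OF P'(1)] rangeU by simp
    qed
  qed
  ultimately show "\<exists>h\<in>F. h \<noteq> 0 \<and> val F (Q 0) h = - int (m * t) \<and>
      (\<forall>P'\<in>places \<iota> F. P' \<noteq> Q 0 \<longrightarrow> val F P' h = (if P' \<in> range R then 1 else 0))"
    using h by blast
qed

subsection \<open>Divisors supported at the ramified places\<close>

lemma lookup_Q_sum:
  assumes "I \<subseteq> {0..n}" "j \<le> n"
  shows "Poly_Mapping.lookup (\<Sum>k\<in>I. frag_cmul (c k) (frag_of (Q k))) (Q j) = (if j \<in> I then c j else 0)"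
proof -
  have fin: "finite I" using assms(1) by (rule finite_subset) simp
  have "Poly_Mapping.lookup (\<Sum>k\<in>I. frag_cmul (c k) (frag_of (Q k))) (Q j)
      = (\<Sum>k\<in>I. if j = k then c k else 0)"
    unfolding lookup_sum
  proof (intro sum.cong refl)
    fix k assume "k \<in> I"
    then have "Q k = Q j \<longleftrightarrow> j = k" using inj_on_eq_iff[OF Q_inj, of k j] assms by auto
    then show "Poly_Mapping.lookup (frag_cmul (c k) (frag_of (Q k))) (Q j) = (if j = k then c k else 0)"
      by (cases "j = k") simp_all
  qed
  then show ?thesis using fin by simp
qed

lemma lookup_Q_sum_elsewhere:
  assumes "I \<subseteq> {0..n}" "P \<notin> Q ` {0..n}"
  shows "Poly_Mapping.lookup (\<Sum>k\<in>I. frag_cmul (c k) (frag_of (Q k))) P = 0"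
  unfolding lookup_sum
proof (intro sum.neutral ballI)
  fix k assume "k \<in> I"
  then have "Q k \<noteq> P" using assms by blast
  then show "Poly_Mapping.lookup (frag_cmul (c k) (frag_of (Q k))) P = 0" by simp
qed

lemma div_degree_Q_sum:
  assumes "I \<subseteq> {0..n}"
  shows "div_degree \<iota> F (\<Sum>k\<in>I. frag_cmul (c k) (frag_of (Q k))) = (\<Sum>k\<in>I. c k)"
  unfolding div_degree_sum
proof (intro sum.cong refl)
  fix k assume "k \<in> I"
  then have "place_degree \<iota> F (Q k) = 1" using assms by (intro Q_degree) auto
  then show "div_degree \<iota> F (frag_cmul (c k) (frag_of (Q k))) = c k" by (simp add: div_degree_single)
qed

lemma divisor_at_Q:
  assumes "\<And>P. P \<notin> Q ` {0..n} \<Longrightarrow> Poly_Mapping.lookup A P = 0"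
  shows "A \<in> divisors \<iota> F" "Poly_Mapping.keys A \<subseteq> Q ` {0..n}"
proof -
  show keys: "Poly_Mapping.keys A \<subseteq> Q ` {0..n}" using assms by (auto simp: in_keys_iff)
  moreover have "Q ` {0..n} \<subseteq> places \<iota> F" using Q_place by auto
  ultimately show "A \<in> divisors \<iota> F" unfolding divisors_def by blast
qed

end

section \<open>The complementary pair\<close>

lemma (in function_field) RR_space_trivial:
  assumes "ell \<iota> F A = 0" "z \<in> RR_space \<iota> F A"
  shows "z = 0"
  using has_qdim_0D[of "range \<iota>" "RR_space \<iota> F A" "{0}"] has_qdim_ell[of A] assms by auto

theorem theorem5p4:
  fixes \<iota> :: "'q::{field,finite} \<Rightarrow> 'a::field"
    and x y :: 'a
    and m n t N :: nat
    and a :: "nat \<Rightarrow> 'q"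
    and E F :: "'a set"
    and Q P :: "nat \<Rightarrow> 'a set"
    and R :: "'l::finite \<Rightarrow> 'a set"
    and \<alpha> \<beta> :: "nat \<Rightarrow> int"
    and g s :: int
    and D E1 E2 G H :: "'a set \<Rightarrow>\<^sub>0 int"
  assumes "field_hom \<iota>"
    and "m \<ge> 2" and "n \<ge> 2" and "\<not> CHAR('q) dvd m" and "coprime m n"
    and "inj_on a {1..n}"
    and "transcendental_over \<iota> x"
    and "y ^ m = (\<Prod>k=1..n. (x - \<iota> (a k)))"
    and E_def: "E = adjoin \<iota> {x}"
    and F_def: "F = adjoin \<iota> {x, y}"
    and g_def: "g = genus \<iota> F" and "g \<ge> 1"
    and "Q 0 \<in> places_over \<iota> F (place_at_infinity \<iota> x)"
    and "\<And>k. k \<in> {1..n} \<Longrightarrow> Q k \<in> places_over \<iota> F (place_at \<iota> x (a k))"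
    and "inj_on P {1..t}"
    and "\<And>i. i \<in> {1..t} \<Longrightarrow> P i \<in> rational_places \<iota> E \<and> splits_completely \<iota> F E (P i)"
    and "N = m * t" and "CARD('l) = N"
    and "bij_betw R UNIV (rational_places \<iota> F \<inter> (\<Union>i\<in>{1..t}. places_over \<iota> F (P i)))"
    and D_def: "D = (\<Sum>i\<in>UNIV. frag_of (R i))"
    and E1_def: "E1 = (\<Sum>k=1..n. frag_cmul (\<alpha> k) (frag_of (Q k)))"
    and E2_def: "E2 = (\<Sum>k=0..n-1. frag_cmul (\<beta> k) (frag_of (Q k)))"
    and "non_special \<iota> F E1" and "div_degree \<iota> F E1 = g - 1"
    and "non_special \<iota> F E2" and "div_degree \<iota> F E2 = g - 1"
    and "\<And>k. k \<in> {1..n-1} \<Longrightarrow> \<alpha> k - \<beta> k \<le> s"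
    and "\<alpha> n \<le> s" and "real_of_int s \<le> (real_of_int (\<beta> 0) + real N) / real n"
    and "(real_of_int g - 1 + real_of_int (\<beta> 0) - real_of_int (\<alpha> n)) / (real n - 1) < real_of_int s"
    and "real_of_int s < (real N - real_of_int g + 1 + real_of_int (\<beta> 0) - real_of_int (\<alpha> n)) / (real n - 1)"
    and G_def: "G = (\<Sum>k=1..n-1. frag_cmul (\<alpha> k) (frag_of (Q k))) + frag_cmul s (frag_of (Q n))
                    + frag_cmul (\<beta> 0 + int N - s * int n) (frag_of (Q 0))"
    and H_def: "H = (\<Sum>k=1..n-1. frag_cmul (s + \<beta> k) (frag_of (Q k))) + frag_cmul (\<alpha> n) (frag_of (Q n))"
  shows "Poly_Mapping.keys D \<inter> Poly_Mapping.keys G = {}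
       \<and> Poly_Mapping.keys D \<inter> Poly_Mapping.keys H = {}
       \<and> LCP (AG_code \<iota> F R G) (AG_code \<iota> F R H)
       \<and> int (vec.dim (AG_code \<iota> F R G)) = int N - s * (int n - 1) - (\<alpha> n - \<beta> 0)
       \<and> int (vec.dim (AG_code \<iota> F R H)) = s * (int n - 1) + \<alpha> n - \<beta> 0"
proof -
  note assumptions = assms
  have m: "m \<ge> 2" and n: "n \<ge> 2" by fact+
  interpret kummer_places \<iota> x y a m n E F Q
  proof unfold_locales
    show "field_hom \<iota>" "transcendental_over \<iota> x" "coprime m n" "inj_on a {1..n}"
      "y ^ m = (\<Prod>k=1..n. (x - \<iota> (a k)))" "E = adjoin \<iota> {x}" "F = adjoin \<iota> {x, y}"
      "Q 0 \<in> places_over \<iota> F (place_at_infinity \<iota> x)" by fact+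
    show "m > 0" "n > 0" using m n by simp_all
    show "Q k \<in> places_over \<iota> F (place_at \<iota> x (a k))" if "k \<in> {1..n}" for k
      by (rule assumptions(14)[OF that])
  qed
  have split: "P i \<in> places \<iota> E \<and> splits_completely \<iota> F E (P i)" if "i \<in> {1..t}" for i
    using assms(16)[OF that] by (simp add: rational_places_def)
  have cardl: "CARD('l) = m * t" using assms(17,18) by simp
  note R = split_places_function[where P = P and t = t and R = R, OF m split cardl assms(19)]
  interpret evaluation_code \<iota> F x "\<lambda>j. y ^ j" m R
  proof unfold_locales
    show "R i \<in> places \<iota> F" for i by (rule R(1))
    show "place_degree \<iota> F (R i) = 1" for i by (rule R(2))
  qed
  obtain h where h: "h \<in> F" "h \<noteq> 0" "val F (Q 0) h = - int N"
    "\<And>P'. P' \<in> places \<iota> F \<Longrightarrow> P' \<noteq> Q 0 \<Longrightarrow> val F P' h = (if P' \<in> range R then 1 else 0)"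
    using R(4) assms(17) by blast
  let ?lk = "Poly_Mapping.lookup"

  have sn: "s * int n \<le> \<beta> 0 + int N"
  proof -
    have "real_of_int s * real n \<le> real_of_int (\<beta> 0) + real N"
      using assms(29) n by (simp add: pos_le_divide_eq)
    then have "real_of_int (s * int n) \<le> real_of_int (\<beta> 0 + int N)" by simp
    then show ?thesis by (simp only: of_int_le_iff)
  qed
  have an: "\<alpha> n \<le> s" by fact
  have ab: "\<alpha> k \<le> s + \<beta> k" if "k \<in> {1..n-1}" for k using assms(27)[OF that] by simp

  have sub: "{1..n} \<subseteq> {0..n}" "{0..n-1} \<subseteq> {0..n}" "{1..n-1} \<subseteq> {0..n}" by auto
  have Q0n: "Q 0 \<noteq> Q n" using inj_on_eq_iff[OF Q_inj, of 0 n] n by simp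
  have Qk: "Q k \<noteq> Q n" "Q k \<noteq> Q 0" if k: "k \<in> {1..n-1}" for k
  proof -
    have "k \<in> {0..n}" "k \<noteq> n" "k \<noteq> 0" using k n by auto
    then show "Q k \<noteq> Q n" "Q k \<noteq> Q 0"
      using inj_on_eq_iff[OF Q_inj, of k n] inj_on_eq_iff[OF Q_inj, of k 0] by simp_all
  qed
  have E1: "?lk E1 (Q j) = (if j \<in> {1..n} then \<alpha> j else 0)" if "j \<le> n" for j
    unfolding E1_def by (rule lookup_Q_sum[OF sub(1) that])
  have E2: "?lk E2 (Q j) = (if j \<in> {0..n-1} then \<beta> j else 0)" if "j \<le> n" for j
    unfolding E2_def by (rule lookup_Q_sum[OF sub(2) that])
  have mid: "?lk (\<Sum>k=1..n-1. frag_cmul (c k) (frag_of (Q k))) (Q 0) = 0"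
    "?lk (\<Sum>k=1..n-1. frag_cmul (c k) (frag_of (Q k))) (Q n) = 0"
    "\<And>k. k \<in> {1..n-1} \<Longrightarrow> ?lk (\<Sum>k=1..n-1. frag_cmul (c k) (frag_of (Q k))) (Q k) = c k" for c
  proof -
    show "?lk (\<Sum>k=1..n-1. frag_cmul (c k) (frag_of (Q k))) (Q 0) = 0"
      by (subst lookup_Q_sum[OF sub(3)]) simp_all
    show "?lk (\<Sum>k=1..n-1. frag_cmul (c k) (frag_of (Q k))) (Q n) = 0"
      by (subst lookup_Q_sum[OF sub(3)]) (use n in auto)
    show "?lk (\<Sum>k=1..n-1. frag_cmul (c k) (frag_of (Q k))) (Q k) = c k" if "k \<in> {1..n-1}" for k
      by (subst lookup_Q_sum[OF sub(3)]) (use that in auto)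
  qed
  have single: "?lk (frag_cmul c (frag_of P1)) P2 = (if P1 = P2 then c else 0)" for c :: int and P1 P2 :: "'a set"
    by simp
  have G: "?lk G (Q 0) = \<beta> 0 + int N - s * int n" "?lk G (Q n) = s"
    "\<And>k. k \<in> {1..n-1} \<Longrightarrow> ?lk G (Q k) = \<alpha> k"
    unfolding G_def lookup_add single using Q0n Qk by (simp_all only: mid not_sym simp_thms if_True if_False add_0 add_0_right)
  have H: "?lk H (Q 0) = 0" "?lk H (Q n) = \<alpha> n" "\<And>k. k \<in> {1..n-1} \<Longrightarrow> ?lk H (Q k) = s + \<beta> k"
    unfolding H_def lookup_add single using Q0n Qk by (simp_all only: mid not_sym simp_thms if_True if_False add_0 add_0_right)
  have elsewhere: "?lk E1 P' = 0" "?lk E2 P' = 0" "?lk G P' = 0" "?lk H P' = 0" if P': "P' \<notin> Q ` {0..n}" for P'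
  proof -
    have ne: "Q n \<noteq> P'" "Q 0 \<noteq> P'" using P' by auto
    show "?lk E1 P' = 0" "?lk E2 P' = 0" "?lk G P' = 0" "?lk H P' = 0"
      unfolding E1_def E2_def G_def H_def lookup_add single lookup_Q_sum_elsewhere[OF sub(1) P']
        lookup_Q_sum_elsewhere[OF sub(2) P'] lookup_Q_sum_elsewhere[OF sub(3) P']
      using ne by simp_all
  qed
  note divG = divisor_at_Q[OF elsewhere(3)] and divH = divisor_at_Q[OF elsewhere(4)]
  have Q_cases: "P' = Q 0 \<or> P' = Q n \<or> (\<exists>k\<in>{1..n-1}. P' = Q k) \<or> P' \<notin> Q ` {0..n}" for P'
  proof (cases "P' \<in> Q ` {0..n}")
    case True
    then obtain k where k: "k \<le> n" "P' = Q k" by auto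
    then have "k = 0 \<or> k = n \<or> k \<in> {1..n-1}" by auto
    then show ?thesis using k by blast
  qed blast

  have ell_E1: "ell \<iota> F E1 = 0" and ell_E2: "ell \<iota> F E2 = 0"
    using assms(23-26) unfolding non_special_def g_def by simp_all
  have RnQ: "R i \<notin> Q ` {0..n}" for i using R(3) by (metis IntI empty_iff rangeI)
  have avoids: "avoids G" "avoids H"
    unfolding avoids_def by (simp_all only: elsewhere(3,4)[OF RnQ] simp_thms)

  have meet: "z = 0" if z: "z \<in> RR_space \<iota> F G" "z \<in> RR_space \<iota> F H" for z
  proof (rule RR_space_trivial[OF ell_E1])
    have zG: "z \<in> val_ge P' (- ?lk G P')" and zH: "z \<in> val_ge P' (- ?lk H P')" if "P' \<in> places \<iota> F" for P'
      using z that unfolding RR_space_eq bounded_poles_def mem_Collect_eq by blast+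
    have "z \<in> val_ge P' (- ?lk E1 P')" if P': "P' \<in> places \<iota> F" for P'
    proof -
      consider "P' = Q 0" | "P' = Q n" | k where "k \<in> {1..n-1}" "P' = Q k" | "P' \<notin> Q ` {0..n}"
        using Q_cases by blast
      then show ?thesis
      proof cases
        case 1
        then show ?thesis using zH[OF P'] H(1) E1[of 0] by simp
      next
        case 2
        then show ?thesis using zH[OF P'] H(2) E1[of n] n by simp
      next
        case (3 k)
        then have "k \<le> n" "k \<in> {1..n}" by auto
        then have "?lk E1 P' = ?lk G P'" using G(3)[OF 3(1)] E1[of k] by (simp add: 3(2))
        then show ?thesis using zG[OF P'] by simp
      next
        case 4
        then show ?thesis using zG[OF P'] elsewhere(1,3)[OF 4] by simp
      qed
    qed
    then show "z \<in> RR_space \<iota> F E1"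
      using z(1) unfolding RR_space_eq bounded_poles_def by blast
  qed

  have join: "z = 0" if z: "z \<in> F" "\<And>P'. P' \<in> places \<iota> F \<Longrightarrow> z \<in> val_ge P' (- max (?lk G P') (?lk H P'))"
    "\<And>i. z \<in> R i" for z
  proof -
    \<comment> \<open>multiplication by \<open>y\<^sup>s / h\<close> takes the functions with poles bounded by \<open>max(G, H) - D\<close> to \<open>L(E\<^sub>2)\<close>\<close>
    define w where "w = y powi s / h"
    have w: "w \<in> F" "w \<noteq> 0" using h generators_in_F(2) y_nonzero by (auto simp: w_def)
    have val_w: "val F P' w = s * val F P' y - val F P' h" if P': "P' \<in> places \<iota> F" for P'
      using h(1,2) generators_in_F(2) y_nonzero all_places_discrete[OF P'] by (simp add: w_def)
    have "w * z \<in> val_ge P' (- ?lk E2 P')" if P': "P' \<in> places \<iota> F" for P'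
    proof -
      have d: "discrete_place P'" by (rule all_places_discrete[OF P'])
      have RQ: "P' \<notin> range R" if "P' \<in> Q ` {0..n}" using that RnQ by auto
      consider "P' = Q 0" | "P' = Q n" | k where "k \<in> {1..n-1}" "P' = Q k" | "P' \<notin> Q ` {0..n}"
        using Q_cases by blast
      then have "z \<in> val_ge P' (- ?lk E2 P' - val F P' w)"
      proof cases
        case 1
        have "- ?lk E2 P' - val F P' w = - max (?lk G P') (?lk H P')"
          using val_w[OF P'] E2[of 0] G(1) H(1) h(3) val_Q_y(1) sn by (simp add: 1)
        then show ?thesis using z(2)[OF P'] by simp
      next
        case 2
        have "P' \<in> Q ` {0..n}" "P' \<noteq> Q 0" using 2 Q0n by auto
        then have "val F P' h = 0" using h(4)[OF P'] RQ by simp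
        then have "- ?lk E2 P' - val F P' w = - max (?lk G P') (?lk H P')"
          using val_w[OF P'] E2[of n] G(2) H(2) val_Q_y(2)[of n] an n by (simp add: 2)
        then show ?thesis using z(2)[OF P'] by simp
      next
        case (3 k)
        have "P' \<in> Q ` {0..n}" "P' \<noteq> Q 0" using 3 Qk by auto
        then have "val F P' h = 0" using h(4)[OF P'] RQ by simp
        moreover have k: "k \<le> n" "k \<in> {1..n}" "k \<in> {0..n-1}" using 3(1) by auto
        ultimately have "- ?lk E2 P' - val F P' w = - max (?lk G P') (?lk H P')"
          using val_w[OF P'] E2[OF k(1)] k(3) G(3)[OF 3(1)] H(3)[OF 3(1)] val_Q_y(2)[OF k(2)] ab[OF 3(1)] by (simp add: 3(2))
        then show ?thesis using z(2)[OF P'] by simp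
      next
        case 4
        then have "P' \<noteq> Q 0" by auto
        have vw: "val F P' w = - val F P' h" using val_w[OF P'] val_y_elsewhere[OF P' 4] by simp
        show ?thesis
        proof (cases "P' \<in> range R")
          case True
          then have "z \<in> val_ge P' 1" using z(3) place_eq_val_ge[OF d] by blast
          then show ?thesis using vw h(4)[OF P' \<open>P' \<noteq> Q 0\<close>] True elsewhere(2)[OF 4] by simp
        next
          case False
          then show ?thesis
            using vw h(4)[OF P' \<open>P' \<noteq> Q 0\<close>] z(2)[OF P'] elsewhere(2-4)[OF 4] by simp
        qed
      qed
      then show ?thesis using val_ge_mult_iff[OF d w, of z "- ?lk E2 P' - val F P' w"] by simp
    qed
    then have "w * z \<in> RR_space \<iota> F E2"
      using w(1) z(1) unfolding RR_space_eq bounded_poles_def by blast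
    then have "w * z = 0" by (rule RR_space_trivial[OF ell_E2])
    then show ?thesis using w(2) by simp
  qed

  have sum1: "(\<Sum>k=1..n-1. \<alpha> k) + \<alpha> n = g - 1"
  proof -
    have "{1..n} = insert n {1..n-1}" using n by auto
    then have "(\<Sum>k=1..n. \<alpha> k) = \<alpha> n + (\<Sum>k=1..n-1. \<alpha> k)" using n by simp
    then show ?thesis using assms(24) unfolding E1_def div_degree_Q_sum[OF sub(1)] by simp
  qed
  have sum2: "\<beta> 0 + (\<Sum>k=1..n-1. \<beta> k) = g - 1"
  proof -
    have "{0..n-1} = insert 0 {1..n-1}" by auto
    then have "(\<Sum>k=0..n-1. \<beta> k) = \<beta> 0 + (\<Sum>k=1..n-1. \<beta> k)" by simp
    then show ?thesis using assms(26) unfolding E2_def div_degree_Q_sum[OF sub(2)] by simp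
  qed
  have degQ: "place_degree \<iota> F (Q n) = 1" "place_degree \<iota> F (Q 0) = 1" by (simp_all add: Q_degree)
  have n1: "int (n - 1) = int n - 1" using n by simp
  have degG: "div_degree \<iota> F G = (g - 1 - \<alpha> n) + s + (\<beta> 0 + int N - s * int n)"
    unfolding G_def div_degree_add div_degree_Q_sum[OF sub(3)] div_degree_single degQ using sum1 by simp
  have degH: "div_degree \<iota> F H = s * (int n - 1) + (g - 1 - \<beta> 0) + \<alpha> n"
    unfolding H_def div_degree_add div_degree_Q_sum[OF sub(3)] div_degree_single degQ
    using sum2 n1 by (simp add: sum.distrib algebra_simps)
  have ellG: "int (ell \<iota> F G) \<ge> int N - s * (int n - 1) - (\<alpha> n - \<beta> 0)"
    using riemann_inequality[OF divG(1)] unfolding degG g_def by (simp add: algebra_simps)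
  have ellH: "int (ell \<iota> F H) \<ge> s * (int n - 1) + \<alpha> n - \<beta> 0"
    using riemann_inequality[OF divH(1)] unfolding degH g_def by (simp add: algebra_simps)
  have total: "int N - s * (int n - 1) - (\<alpha> n - \<beta> 0) + (s * (int n - 1) + \<alpha> n - \<beta> 0) = int CARD('l)"
    using assms(18) by simp
  have main: "LCP (AG_code \<iota> F R G) (AG_code \<iota> F R H)
       \<and> int (vec.dim (AG_code \<iota> F R G)) = int N - s * (int n - 1) - (\<alpha> n - \<beta> 0)
       \<and> int (vec.dim (AG_code \<iota> F R H)) = s * (int n - 1) + \<alpha> n - \<beta> 0"
  proof (rule LCP_of_AG_codes[OF avoids _ _ ellG ellH total])
    show "z = 0" if "z \<in> RR_space \<iota> F G" "z \<in> RR_space \<iota> F H" for z by (rule meet[OF that])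
    show "z = 0" if "z \<in> F" "\<And>P'. P' \<in> places \<iota> F \<Longrightarrow> z \<in> val_ge P' (- max (?lk G P') (?lk H P'))"
      "\<And>i. z \<in> R i" for z by (rule join[OF that])
  qed

  have keysD: "Poly_Mapping.keys D \<subseteq> range R"
    unfolding D_def by (rule order_trans[OF keys_sum]) (auto simp: keys_frag_of)
  have disjoint: "X \<inter> Y = {}" if X: "X \<subseteq> range R" and Y: "Y \<subseteq> Q ` {0..n}" for X Y
  proof (rule equals0I)
    fix P' assume P': "P' \<in> X \<inter> Y"
    then obtain i where "P' = R i" using X by blast
    moreover have "P' \<in> Q ` {0..n}" using P' Y by blast
    ultimately show False using RnQ[of i] by simp
  qed
  show ?thesis
    using disjoint[OF keysD divG(2)] disjoint[OF keysD divH(2)] main by (intro conjI) simp_all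
qed

end
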